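(* Let $A\in\mathcal{B}(\mathcal{H})$ be a positive invertible operator on a complex Hilbert space $\mathcal{H}$ and let $T\in\mathcal{B}(\mathcal{H})$. Then the following are equivalent: (i) $T$ is in the $\mathcal{C}_A$-class. (ii) For every $N\in\mathbb{N}$ and $c_0,c_1,\dots,c_N\in\mathbb{C}$, $\sum_{\ell,k=0}^N\overline{c_\ell}c_k\,\zeta_A(k-\ell)\ge0$, where $\zeta_A(n)=A^{-1/2}T^nA^{-1/2}$ if $n>0$, $\zeta_A(0)=I$, and $\zeta_A(n)=A^{-1/2}(T^* )^{-n}A^{-1/2}$ if $n<0$. (iii) For all $z\in\mathbb{C}$ with $|z|<1$, the operator $I-zT$ is invertible and $(I-zT)^{-1}+(I-\overline{z}T^* )^{-1}+A-2I\ge0$. (iv) For all $z\in\mathbb{C}$ with $|z|<1$ and all $h\in\mathcal{H}$, $\langle(I-zT)h,(A-2I)(I-zT)h\rangle+2\,\mathrm{Re}\,\langle h,(I-zT)h\rangle\ge0$.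
   Context: Inner products are linear in the second variable. An operator $T\in\mathcal{B}(\mathcal{H})$ is in the $\mathcal{C}_A$-class if there is a unitary operator $U$ on some Hilbert space $\mathcal{K}\supseteq\mathcal{H}$ such that $A^{-1/2}T^nA^{-1/2}=P_{\mathcal{H}}U^n|_{\mathcal{H}}$ for all $n\ge1$, where $P_{\mathcal{H}}$ is the orthogonal projection of $\mathcal{K}$ onto $\mathcal{H}$. *)

theory Defs
  imports "HOL-Analysis.Analysis"
begin

section \<open>Complex Hilbert spaces as types\<close>

text \<open>
  The inner product \<open>cinner\<close> is linear in the second variable. The norm and the
  positive definiteness of \<open>cinner\<close> come from \<^class>\<open>real_inner\<close>, since
  \<open>x \<bullet> y = Re (cinner x y)\<close>, and completeness comes from \<^class>\<open>banach\<close>.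
\<close>

class complex_hilbert = real_inner + banach +
  fixes scaleC :: "complex \<Rightarrow> 'a \<Rightarrow> 'a"  (infixr "*\<^sub>C" 75)
    and cinner :: "'a \<Rightarrow> 'a \<Rightarrow> complex"
  assumes scaleC_add_right: "a *\<^sub>C (x + y) = a *\<^sub>C x + a *\<^sub>C y"
    and scaleC_add_left: "(a + b) *\<^sub>C x = a *\<^sub>C x + b *\<^sub>C x"
    and scaleC_scaleC: "a *\<^sub>C b *\<^sub>C x = (a * b) *\<^sub>C x"
    and scaleR_scaleC: "r *\<^sub>R x = complex_of_real r *\<^sub>C x"
    and cinner_commute: "cinner x y = cnj (cinner y x)"
    and cinner_add_right: "cinner x (y + z) = cinner x y + cinner x z"
    and cinner_scaleC_right: "cinner x (a *\<^sub>C y) = a * cinner x y"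
    and inner_eq_Re_cinner: "x \<bullet> y = Re (cinner x y)"


section \<open>Bounded operators\<close>

definition bounded_op :: "('h::complex_hilbert \<Rightarrow> 'h) \<Rightarrow> bool" where
  "bounded_op T \<longleftrightarrow> bounded_linear T \<and> (\<forall>c x. T (c *\<^sub>C x) = c *\<^sub>C T x)"

text \<open>When \<open>invertible_op T\<close> holds, the inverse operator is \<^term>\<open>inv T\<close>.\<close>

definition invertible_op :: "('h::complex_hilbert \<Rightarrow> 'h) \<Rightarrow> bool" where
  "invertible_op T \<longleftrightarrow>
     bounded_op T \<and> (\<exists>S. bounded_op S \<and> S \<circ> T = id \<and> T \<circ> S = id)"

text \<open>The set \<^term>\<open>nonneg_Reals :: complex set\<close> makes the quadratic form
  real-valued as well as nonnegative.\<close>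

definition positive_op :: "('h::complex_hilbert \<Rightarrow> 'h) \<Rightarrow> bool" where
  "positive_op T \<longleftrightarrow> bounded_op T \<and> (\<forall>h. cinner h (T h) \<in> \<real>\<^sub>\<ge>\<^sub>0)"

definition adjoint_op :: "('h::complex_hilbert \<Rightarrow> 'h) \<Rightarrow> 'h \<Rightarrow> 'h" where
  "adjoint_op T = (THE S. bounded_op S \<and> (\<forall>x y. cinner (S x) y = cinner x (T y)))"

definition sqrt_op :: "('h::complex_hilbert \<Rightarrow> 'h) \<Rightarrow> 'h \<Rightarrow> 'h" where
  "sqrt_op A = (THE B. positive_op B \<and> B \<circ> B = A)"

definition inv_sqrt_op :: "('h::complex_hilbert \<Rightarrow> 'h) \<Rightarrow> 'h \<Rightarrow> 'h" where
  "inv_sqrt_op A = inv (sqrt_op A)"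

text \<open>The operator \<open>I - zT\<close>.\<close>

definition id_minus :: "complex \<Rightarrow> ('h::complex_hilbert \<Rightarrow> 'h) \<Rightarrow> 'h \<Rightarrow> 'h" where
  "id_minus z T = (\<lambda>h. h - z *\<^sub>C T h)"

definition zeta :: "('h::complex_hilbert \<Rightarrow> 'h) \<Rightarrow> ('h \<Rightarrow> 'h) \<Rightarrow> int \<Rightarrow> 'h \<Rightarrow> 'h" where
  "zeta A T n =
     (if n > 0 then inv_sqrt_op A \<circ> (T ^^ nat n) \<circ> inv_sqrt_op A
      else if n = 0 then id
      else inv_sqrt_op A \<circ> (adjoint_op T ^^ nat (- n)) \<circ> inv_sqrt_op A)"


section \<open>Complex Hilbert spaces with an explicit carrier\<close>

text \<open>
  The dilation space is existentially quantified, so it cannot be a type. It is instead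
  a record of operations on a carrier set; values outside the carrier are irrelevant.
\<close>

record 'k hilbert_structure =
  hcarrier :: "'k set"
  hzero :: 'k
  hadd :: "'k \<Rightarrow> 'k \<Rightarrow> 'k"
  hscale :: "complex \<Rightarrow> 'k \<Rightarrow> 'k"
  hinner :: "'k \<Rightarrow> 'k \<Rightarrow> complex"

definition hdiff :: "'k hilbert_structure \<Rightarrow> 'k \<Rightarrow> 'k \<Rightarrow> 'k" where
  "hdiff K x y = hadd K x (hscale K (- 1) y)"

definition hnorm :: "'k hilbert_structure \<Rightarrow> 'k \<Rightarrow> real" where
  "hnorm K x = sqrt (Re (hinner K x x))"

locale hilbert_space_on =
  fixes K :: "'k hilbert_structure"
  assumes zero_closed: "hzero K \<in> hcarrier K"
    and add_closed: "\<lbrakk>x \<in> hcarrier K; y \<in> hcarrier K\<rbrakk> \<Longrightarrow> hadd K x y \<in> hcarrier K"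
    and scale_closed: "x \<in> hcarrier K \<Longrightarrow> hscale K a x \<in> hcarrier K"
    and add_assoc: "\<lbrakk>x \<in> hcarrier K; y \<in> hcarrier K; z \<in> hcarrier K\<rbrakk> \<Longrightarrow>
          hadd K (hadd K x y) z = hadd K x (hadd K y z)"
    and add_commute: "\<lbrakk>x \<in> hcarrier K; y \<in> hcarrier K\<rbrakk> \<Longrightarrow> hadd K x y = hadd K y x"
    and add_zero: "x \<in> hcarrier K \<Longrightarrow> hadd K x (hzero K) = x"
    and add_inverse: "x \<in> hcarrier K \<Longrightarrow> \<exists>y \<in> hcarrier K. hadd K x y = hzero K"
    and scale_add_right: "\<lbrakk>x \<in> hcarrier K; y \<in> hcarrier K\<rbrakk> \<Longrightarrow>
          hscale K a (hadd K x y) = hadd K (hscale K a x) (hscale K a y)"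
    and scale_add_left: "x \<in> hcarrier K \<Longrightarrow>
          hscale K (a + b) x = hadd K (hscale K a x) (hscale K b x)"
    and scale_scale: "x \<in> hcarrier K \<Longrightarrow> hscale K a (hscale K b x) = hscale K (a * b) x"
    and scale_one: "x \<in> hcarrier K \<Longrightarrow> hscale K 1 x = x"
    and inner_commute: "\<lbrakk>x \<in> hcarrier K; y \<in> hcarrier K\<rbrakk> \<Longrightarrow>
          hinner K x y = cnj (hinner K y x)"
    and inner_add_right: "\<lbrakk>x \<in> hcarrier K; y \<in> hcarrier K; z \<in> hcarrier K\<rbrakk> \<Longrightarrow>
          hinner K x (hadd K y z) = hinner K x y + hinner K x z"
    and inner_scale_right: "\<lbrakk>x \<in> hcarrier K; y \<in> hcarrier K\<rbrakk> \<Longrightarrow>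
          hinner K x (hscale K a y) = a * hinner K x y"
    and inner_nonneg: "x \<in> hcarrier K \<Longrightarrow> hinner K x x \<in> \<real>\<^sub>\<ge>\<^sub>0"
    and inner_definite: "\<lbrakk>x \<in> hcarrier K; hinner K x x = 0\<rbrakk> \<Longrightarrow> x = hzero K"
    and complete: "\<lbrakk>\<And>n::nat. X n \<in> hcarrier K;
          \<And>e. e > 0 \<Longrightarrow> \<exists>M. \<forall>m\<ge>M. \<forall>n\<ge>M. hnorm K (hdiff K (X m) (X n)) < e\<rbrakk> \<Longrightarrow>
          \<exists>x \<in> hcarrier K. (\<lambda>n. hnorm K (hdiff K (X n) x)) \<longlonglongrightarrow> 0"

definition unitary_on :: "'k hilbert_structure \<Rightarrow> ('k \<Rightarrow> 'k) \<Rightarrow> bool" where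
  "unitary_on K U \<longleftrightarrow>
     bij_betw U (hcarrier K) (hcarrier K) \<and>
     (\<forall>x\<in>hcarrier K. \<forall>y\<in>hcarrier K. U (hadd K x y) = hadd K (U x) (U y)) \<and>
     (\<forall>a. \<forall>x\<in>hcarrier K. U (hscale K a x) = hscale K a (U x)) \<and>
     (\<forall>x\<in>hcarrier K. \<forall>y\<in>hcarrier K. hinner K (U x) (U y) = hinner K x y)"

definition isometric_embedding ::
    "'k hilbert_structure \<Rightarrow> ('h::complex_hilbert \<Rightarrow> 'k) \<Rightarrow> bool" where
  "isometric_embedding K J \<longleftrightarrow>
     (\<forall>x. J x \<in> hcarrier K) \<and>
     (\<forall>x y. J (x + y) = hadd K (J x) (J y)) \<and>
     (\<forall>a x. J (a *\<^sub>C x) = hscale K a (J x)) \<and>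
     (\<forall>x y. hinner K (J x) (J y) = cinner x y)"

text \<open>Orthogonal projection onto a closed subspace \<open>S\<close> of \<open>K\<close>.\<close>

definition orth_proj :: "'k hilbert_structure \<Rightarrow> 'k set \<Rightarrow> 'k \<Rightarrow> 'k" where
  "orth_proj K S x = (THE y. y \<in> S \<and> (\<forall>s\<in>S. hinner K s (hdiff K x y) = 0))"


section \<open>The class \<open>C_A\<close>\<close>

text \<open>
  The inclusion of \<open>H\<close> in \<open>K\<close> is an isometric embedding \<open>J\<close>, so that \<open>P\<^sub>H\<close> is the
  orthogonal projection onto \<open>range J\<close> and both sides of the dilation identity are
  compared inside \<open>K\<close>.

  HOL cannot quantify over types, so the carrier of \<open>K\<close> has to live in some fixed type.
  The type argument \<^typ>\<open>'k\<close> is arbitrary, so that spaces \<open>K\<close> carried by any type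
  whatsoever are covered. The summand \<^typ>\<open>int \<Rightarrow> 'h\<close> guarantees enough room: if a
  dilation exists, then replacing \<open>K\<close> by the closed linear span of the subspaces
  \<open>U\<^sup>n H\<close> (\<open>n\<close> an integer) gives a dilation whose space injects into \<^typ>\<open>int \<Rightarrow> 'h\<close>
  by sending \<open>x\<close> to the sequence \<open>P\<^sub>H U\<^sup>n x\<close>. Hence the notion does not depend on the
  choice of \<^typ>\<open>'k\<close>.
\<close>

definition C_class ::
    "'k itself \<Rightarrow> ('h::complex_hilbert \<Rightarrow> 'h) \<Rightarrow> ('h \<Rightarrow> 'h) \<Rightarrow> bool" where
  "C_class _ A T \<longleftrightarrow>
     bounded_op T \<and>
     (\<exists>(K :: ('k + (int \<Rightarrow> 'h)) hilbert_structure) J U.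
        hilbert_space_on K \<and> isometric_embedding K J \<and> unitary_on K U \<and>
        (\<forall>n\<ge>1. \<forall>h. J ((inv_sqrt_op A \<circ> (T ^^ n) \<circ> inv_sqrt_op A) h)
                     = orth_proj K (range J) ((U ^^ n) (J h))))"

end

theory Submission
  imports Defs "HOL-Complex_Analysis.Complex_Analysis" "HOL-Library.Real_Mod"
begin

text \<open>
  Conjugating by \<open>A\<^sup>1\<^sup>/\<^sup>2\<close> turns \<open>\<zeta>\<^sub>A\<close> into the kernel \<open>a\<^sub>n(x, y)\<close> equal to \<open>\<langle>x, Ay\<rangle>\<close> for \<open>n = 0\<close>,
  to \<open>\<langle>x, T\<^sup>n y\<rangle>\<close> for \<open>n > 0\<close> and hermitian in \<open>n\<close>. Condition (iv) says that its Poisson sums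
  \<open>Re (\<langle>y, Ay\<rangle> + 2 \<Sum>n\<ge>1. z\<^sup>n \<langle>y, T\<^sup>n y\<rangle>)\<close> are nonnegative on the disc, since
  \<open>\<Sum>n\<ge>0. z\<^sup>n T\<^sup>n y = h\<close> for \<open>y = (I - zT)h\<close>; it also bounds \<open>I - zT\<close> below, which gives the
  invertibility in (iii). The Toeplitz sums in (ii) yield the Poisson sums by taking \<open>c\<^sub>k = z\<^sup>k\<close>.
  Conversely, averaging the Poisson sums of the vectors \<open>\<Sum>i. u\<^sup>-\<^sup>n\<^sup>i x\<^sub>i\<close> over roots of unity \<open>u\<close>
  makes the kernel positive definite even with vector coefficients, not just with the scalar ones
  of (ii), and this is what the dilation needs: \<open>K\<close> is the completion of the formal sums of the
  \<open>U\<^sup>n h\<close> with Gram matrix \<open>\<zeta>\<^sub>A\<close>, and \<open>U\<close> is the shift.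
\<close>

section \<open>The inner product and bounded operators\<close>

text \<open>The resolvent inequality is the bridge between scalar and vector coefficients. The sums
  in (ii) keep one vector fixed while the scalars vary; (iv) holds for each \<open>z\<close> and
  each vector separately, so the vector may be chosen depending on \<open>z\<close>, and this
  freedom is what the averaging exploits. No bound on the powers of \<open>T\<close> is given in
  advance. (iv) yields only a lower bound for \<open>I - zT\<close>, uniform on smaller discs, and
  the power series of the resolvent is obtained weakly, one matrix element at a time. Hence the
  damping by \<open>r < 1\<close> and the truncation at \<open>L\<close> with an explicit tail
  estimate; first \<open>L\<close> tends to infinity, then \<open>r\<close> to 1. The dilation
  identity speaks of \<open>n >= 1\<close> only. The entry at 0 comes from the isometry of the
  embedding and the negative ones from unitarity, which is why the kernel has the identity at 0, and
  \<open>A\<close> after conjugation. The completion consists of functionals on lists, while the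
  class asks for a carrier inside \<open>'k + (int => 'h)\<close>. Riesz vectors of the functionals
  provide the injection that moves it there.\<close>

lemma scaleC_one [simp]: "1 *\<^sub>C (x::'h::complex_hilbert) = x"
  using scaleR_scaleC[of 1 x] by simp

lemma scaleC_zero_left [simp]: "0 *\<^sub>C (x::'h::complex_hilbert) = 0"
  using scaleR_scaleC[of 0 x] by simp

lemma scaleC_zero_right [simp]: "a *\<^sub>C (0::'h::complex_hilbert) = 0"
  using scaleC_add_right[of a 0 "0::'h"] by simp

lemma scaleC_minus_right: "a *\<^sub>C (- x::'h::complex_hilbert) = - (a *\<^sub>C x)"
  using scaleC_add_right[of a x "- x"] by (simp add: eq_neg_iff_add_eq_0 add.commute)

lemma scaleC_minus_left: "(- a) *\<^sub>C (x::'h::complex_hilbert) = - (a *\<^sub>C x)"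
  using scaleC_add_left[of a "- a" x] by (simp add: eq_neg_iff_add_eq_0 add.commute)

lemma scaleC_diff_right: "a *\<^sub>C (x - y::'h::complex_hilbert) = a *\<^sub>C x - a *\<^sub>C y"
  using scaleC_add_right[of a x "- y"] by (simp add: scaleC_minus_right)

lemma scaleC_diff_left: "(a - b) *\<^sub>C (x::'h::complex_hilbert) = a *\<^sub>C x - b *\<^sub>C x"
  using scaleC_add_left[of a "- b" x] by (simp add: scaleC_minus_left)

lemma cinner_add_left: "cinner (x + y) (z::'h::complex_hilbert) = cinner x z + cinner y z"
  by (metis cinner_add_right cinner_commute complex_cnj_add)

lemma cinner_scaleC_left: "cinner (a *\<^sub>C x) (y::'h::complex_hilbert) = cnj a * cinner x y"
  by (metis cinner_scaleC_right cinner_commute complex_cnj_mult)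

lemma cinner_zero_right [simp]: "cinner x (0::'h::complex_hilbert) = 0"
  using cinner_add_right[of x 0 0] by simp

lemma cinner_zero_left [simp]: "cinner (0::'h::complex_hilbert) x = 0"
  using cinner_add_left[of 0 0 x] by simp

lemma cinner_minus_right: "cinner x (- y::'h::complex_hilbert) = - cinner x y"
  using cinner_add_right[of x y "- y"] by (simp add: eq_neg_iff_add_eq_0 add.commute)

lemma cinner_minus_left: "cinner (- x::'h::complex_hilbert) y = - cinner x y"
  using cinner_add_left[of x "- x" y] by (simp add: eq_neg_iff_add_eq_0 add.commute)

lemma cinner_diff_right: "cinner x (y - z::'h::complex_hilbert) = cinner x y - cinner x z"
  using cinner_add_right[of x y "- z"] by (simp add: cinner_minus_right)

lemma cinner_diff_left: "cinner (x - y) (z::'h::complex_hilbert) = cinner x z - cinner y z"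
  using cinner_add_left[of x "- y" z] by (simp add: cinner_minus_left)

lemma cinner_sum_right: "cinner x (\<Sum>i\<in>I. f i) = (\<Sum>i\<in>I. cinner x (f i :: 'h::complex_hilbert))"
  by (induction I rule: infinite_finite_induct) (auto simp: cinner_add_right)

lemma cinner_sum_left: "cinner (\<Sum>i\<in>I. f i) x = (\<Sum>i\<in>I. cinner (f i :: 'h::complex_hilbert) x)"
  by (induction I rule: infinite_finite_induct) (auto simp: cinner_add_left)

lemmas cinner_simps = cinner_add_left cinner_add_right cinner_diff_left cinner_diff_right
  cinner_scaleC_left cinner_scaleC_right cinner_minus_left cinner_minus_right

lemma cinner_self: "cinner x x = complex_of_real ((norm (x::'h::complex_hilbert))\<^sup>2)"
proof (rule complex_eqI)
  show "Re (cinner x x) = Re (complex_of_real ((norm x)\<^sup>2))"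
    by (simp add: inner_eq_Re_cinner[symmetric] power2_norm_eq_inner)
  have "Im (cinner x x) = - Im (cinner x x)"
    by (subst cinner_commute) simp
  then show "Im (cinner x x) = Im (complex_of_real ((norm x)\<^sup>2))"
    by simp
qed

lemma norm_scaleC: "norm (a *\<^sub>C (x::'h::complex_hilbert)) = cmod a * norm x"
proof -
  have "complex_of_real ((norm (a *\<^sub>C x))\<^sup>2) = (a * cnj a) * cinner x x"
    by (simp only: cinner_self[symmetric] cinner_scaleC_left cinner_scaleC_right mult_ac)
  also have "\<dots> = complex_of_real ((cmod a)\<^sup>2 * (norm x)\<^sup>2)"
    by (simp only: complex_norm_square[symmetric] cinner_self of_real_mult)
  finally have "complex_of_real ((norm (a *\<^sub>C x))\<^sup>2) = complex_of_real ((cmod a)\<^sup>2 * (norm x)\<^sup>2)" .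
  then have "(norm (a *\<^sub>C x))\<^sup>2 = (cmod a * norm x)\<^sup>2"
    by (simp only: of_real_eq_iff power_mult_distrib)
  then show ?thesis
    by (rule power2_eq_imp_eq) auto
qed

lemma norm_cinner_le: "cmod (cinner x (y::'h::complex_hilbert)) \<le> norm x * norm y"
proof (cases "cinner x y = 0")
  case False
  \<comment> \<open>This unimodular factor turns the inner product into its modulus, so the real
    Cauchy-Schwarz inequality applies to \<open>x\<close> and \<open>a y\<close>.\<close>
  define a where "a = cnj (cinner x y) / cmod (cinner x y)"
  have a: "cmod a = 1" "a * cinner x y = cmod (cinner x y)"
    using False complex_norm_square[of "cinner x y"]
    by (simp_all add: a_def norm_divide field_simps power2_eq_square)
  have "cmod (cinner x y) = x \<bullet> (a *\<^sub>C y)"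
    by (simp add: inner_eq_Re_cinner cinner_scaleC_right a)
  also have "\<dots> \<le> norm x * norm (a *\<^sub>C y)"
    by (rule norm_cauchy_schwarz)
  finally show ?thesis
    by (simp add: norm_scaleC a)
qed auto

lemma cinner_extensionality:
  assumes "\<And>z. cinner z x = cinner z (y::'h::complex_hilbert)"
  shows "x = y"
proof -
  have "cinner (x - y) (x - y) = 0"
    using assms by (simp add: cinner_diff_right)
  then show ?thesis
    by (simp add: cinner_self)
qed

lemma bounded_bilinear_cinner: "bounded_bilinear (cinner :: 'h::complex_hilbert \<Rightarrow> 'h \<Rightarrow> complex)"
proof
  show "\<exists>K. \<forall>a b. cmod (cinner a (b::'h)) \<le> norm a * norm b * K"
    by (intro exI[of _ 1]) (auto simp: norm_cinner_le)
qed (auto simp: cinner_simps scaleR_scaleC scaleR_conv_of_real)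

section \<open>Algebra of bounded operators and bounded inverses\<close>

lemma bounded_opI:
  assumes "\<And>x y. T (x + y) = T x + T (y::'h::complex_hilbert)"
    and "\<And>c x. T (c *\<^sub>C x) = c *\<^sub>C T x"
    and "\<And>x. norm (T x) \<le> norm x * K"
  shows "bounded_op T"
  unfolding bounded_op_def
  by (intro conjI bounded_linear_intro[of T K] allI) (simp_all add: assms scaleR_scaleC)

lemma
  assumes "bounded_op (T :: 'h::complex_hilbert \<Rightarrow> 'h)"
  shows bounded_op_add: "T (x + y) = T x + T y"
    and bounded_op_diff: "T (x - y) = T x - T y"
    and bounded_op_zero: "T 0 = 0"
    and bounded_op_sum: "T (\<Sum>i\<in>I. f i) = (\<Sum>i\<in>I. T (f i))"
    and bounded_op_scaleC: "T (c *\<^sub>C x) = c *\<^sub>C T x"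
proof -
  interpret bounded_linear T
    using assms by (simp add: bounded_op_def)
  show "T (x + y) = T x + T y" "T (x - y) = T x - T y" "T 0 = 0"
    "T (\<Sum>i\<in>I. f i) = (\<Sum>i\<in>I. T (f i))"
    by (simp_all add: add diff zero sum)
  show "T (c *\<^sub>C x) = c *\<^sub>C T x"
    using assms by (simp add: bounded_op_def)
qed

lemma bounded_op_bound:
  assumes "bounded_op (T :: 'h::complex_hilbert \<Rightarrow> 'h)"
  obtains K where "K > 0" "\<And>x. norm (T x) \<le> norm x * K"
proof -
  interpret bounded_linear T
    using assms by (simp add: bounded_op_def)
  show ?thesis
    using pos_bounded that by blast
qed

lemma bounded_op_id: "bounded_op (id :: 'h::complex_hilbert \<Rightarrow> 'h)"
  by (rule bounded_opI[of _ 1]) auto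

lemma bounded_op_comp:
  assumes "bounded_op (S :: 'h::complex_hilbert \<Rightarrow> 'h)" "bounded_op T"
  shows "bounded_op (S \<circ> T)"
  using assms by (auto simp: bounded_op_def o_def intro: bounded_linear_compose)

lemma bounded_op_funpow:
  assumes "bounded_op (T :: 'h::complex_hilbert \<Rightarrow> 'h)"
  shows "bounded_op (T ^^ n)"
  by (induction n) (simp_all only: funpow.simps bounded_op_id bounded_op_comp assms)

lemma bounded_op_plus:
  assumes "bounded_op (S :: 'h::complex_hilbert \<Rightarrow> 'h)" "bounded_op T"
  shows "bounded_op (\<lambda>x. S x + T x)"
  using assms by (auto simp: bounded_op_def scaleC_add_right intro: bounded_linear_add)

lemma bounded_op_scale:
  assumes "bounded_op (T :: 'h::complex_hilbert \<Rightarrow> 'h)"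
  shows "bounded_op (\<lambda>x. a *\<^sub>C T x)"
proof -
  obtain K where K: "\<And>x. norm (T x) \<le> norm x * K"
    using bounded_op_bound[OF assms] by blast
  show ?thesis
  proof (rule bounded_opI)
    show "norm (a *\<^sub>C T x) \<le> norm x * (cmod a * K)" for x
      using mult_left_mono[OF K norm_ge_zero[of a]] by (simp add: norm_scaleC mult_ac)
  qed (simp_all add: bounded_op_add[OF assms] bounded_op_scaleC[OF assms] scaleC_add_right
      scaleC_scaleC mult.commute)
qed

lemma bounded_op_minus:
  assumes "bounded_op (S :: 'h::complex_hilbert \<Rightarrow> 'h)" "bounded_op T"
  shows "bounded_op (\<lambda>x. S x - T x)"
  using bounded_op_plus[OF assms(1) bounded_op_scale[OF assms(2), of "-1"]]
  by (simp add: scaleC_minus_left)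

lemma bounded_op_zero_op: "bounded_op (\<lambda>x. 0 :: 'h::complex_hilbert)"
  by (rule bounded_opI[of _ 0]) auto

lemma bounded_op_sum_op:
  assumes "\<And>i. i \<in> I \<Longrightarrow> bounded_op (T i :: 'h::complex_hilbert \<Rightarrow> 'h)"
  shows "bounded_op (\<lambda>x. \<Sum>i\<in>I. T i x)"
  using assms
  by (induction I rule: infinite_finite_induct) (auto intro: bounded_op_plus simp: bounded_op_zero_op)

lemma bounded_op_id_minus:
  assumes "bounded_op (T :: 'h::complex_hilbert \<Rightarrow> 'h)"
  shows "bounded_op (id_minus z T)"
  unfolding id_minus_def
  using bounded_op_minus[OF bounded_op_id bounded_op_scale[OF assms]] by simp

lemma invertible_op_bij: "invertible_op (T :: 'h::complex_hilbert \<Rightarrow> 'h) \<Longrightarrow> bij T"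
  unfolding invertible_op_def by (metis o_bij)

lemma bounded_op_inv:
  assumes "invertible_op (T :: 'h::complex_hilbert \<Rightarrow> 'h)"
  shows "bounded_op (inv T)"
  using assms unfolding invertible_op_def by (metis inv_unique_comp)

text \<open>The lower bound serves twice: it gives injectivity, and it bounds the inverse by
  \<open>1 / c\<close>.\<close>

lemma invertible_opI:
  assumes T: "bounded_op (T :: 'h::complex_hilbert \<Rightarrow> 'h)" and "surj T"
    and c: "c > 0" "\<And>x. c * norm x \<le> norm (T x)"
  shows "invertible_op T"
proof -
  have inj: "inj T"
  proof (rule injI)
    fix x y assume "T x = T y"
    then have "c * norm (x - y) \<le> 0"
      using c(2)[of "x - y"] by (simp add: bounded_op_diff[OF T])
    then show "x = y"
      using c(1) by (simp add: mult_le_0_iff)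
  qed
  have inv: "T (inv T x) = x" "inv T (T x) = x" for x
    using \<open>surj T\<close> inj by (simp_all add: surj_f_inv_f)
  have "bounded_op (inv T)"
  proof (rule bounded_opI)
    show "inv T (x + y) = inv T x + inv T y" for x y
      by (rule injD[OF inj]) (simp add: bounded_op_add[OF T] inv)
    show "inv T (a *\<^sub>C x) = a *\<^sub>C inv T x" for a x
      by (rule injD[OF inj]) (simp add: bounded_op_scaleC[OF T] inv)
    show "norm (inv T x) \<le> norm x * (1 / c)" for x
      using c(2)[of "inv T x"] c(1) by (simp add: inv field_simps)
  qed
  then show ?thesis
    unfolding invertible_op_def using T inv by (auto simp: fun_eq_iff)
qed

section \<open>Riesz representation and adjoints\<close>

text \<open>The representing vector minimises \<open>\<parallel>v\<parallel>\<^sup>2 - 2 f v\<close>.\<close>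

lemma riesz_real:
  fixes f :: "'h::{real_inner,banach} \<Rightarrow> real"
  assumes "bounded_linear f"
  shows "\<exists>v. \<forall>u. f u = v \<bullet> u"
proof -
  interpret f: bounded_linear f by fact
  define p where "p = (\<lambda>v. (norm v)\<^sup>2 - 2 * f v)"
  obtain K where K: "\<And>x. norm (f x) \<le> norm x * K" "K > 0"
    using f.pos_bounded by blast
  have lower: "p v \<ge> - K\<^sup>2" for v
  proof -
    have "f v \<le> norm v * K"
      using K(1)[of v] by simp
    moreover have "0 \<le> (norm v - K)\<^sup>2"
      by simp
    ultimately show ?thesis
      by (simp add: p_def power2_diff)
  qed
  define d where "d = Inf (range p)"
  have bdd: "bdd_below (range p)"
    using lower by (auto intro!: bdd_belowI)
  have d_le: "d \<le> p v" for v
    unfolding d_def by (rule cInf_lower[OF _ bdd]) auto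
  have "\<exists>v. p v < d + 1 / real (Suc n)" for n
    using cInf_lessD[of "range p" "d + 1 / real (Suc n)"] by (auto simp: d_def)
  then obtain v where v: "\<And>n. p (v n) < d + 1 / real (Suc n)"
    by metis
  \<comment> \<open>Parallelogram law: the linear term cancels, so two nearly minimal points are
    close because their midpoint cannot lie below \<open>d\<close>.\<close>
  have par: "(norm (x - y))\<^sup>2 = 2 * p x + 2 * p y - 4 * p ((1/2) *\<^sub>R (x + y))" for x y
    by (simp add: p_def power2_norm_eq_inner f.add f.scaleR inner_add_left inner_add_right
        inner_diff_left inner_diff_right inner_commute algebra_simps)
  have "Cauchy v"
  proof (rule metric_CauchyI)
    fix e :: real assume "e > 0"
    obtain M where M: "4 / e\<^sup>2 < real M"
      using reals_Archimedean2 by blast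
    have "dist (v m) (v n) < e" if "m \<ge> M" "n \<ge> M" for m n
    proof -
      have M0: "real M > 0"
        using M \<open>e > 0\<close> by (smt (verit) divide_pos_pos zero_less_power)
      have "1 / real (Suc m) \<le> 1 / real M" "1 / real (Suc n) \<le> 1 / real M"
        using that M0 by (auto simp: field_simps)
      then have "(norm (v m - v n))\<^sup>2 < 4 / real M"
        using par[of "v m" "v n"] v[of m] v[of n] d_le[of "(1/2) *\<^sub>R (v m + v n)"] by linarith
      also have "\<dots> < e\<^sup>2"
        using M M0 \<open>e > 0\<close> by (simp add: field_simps)
      finally show ?thesis
        using \<open>e > 0\<close> by (simp add: dist_norm power_less_imp_less_base)
    qed
    then show "\<exists>M. \<forall>m\<ge>M. \<forall>n\<ge>M. dist (v m) (v n) < e"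
      by blast
  qed
  then obtain w where w: "v \<longlonglongrightarrow> w"
    using Cauchy_convergent convergent_def by blast
  have "(\<lambda>n. p (v n)) \<longlonglongrightarrow> p w"
    unfolding p_def using w by (intro tendsto_intros f.tendsto)
  moreover have "(\<lambda>n. d + 1 / real (Suc n)) \<longlonglongrightarrow> d + 0"
    by (intro tendsto_intros LIMSEQ_Suc[OF lim_1_over_n])
  ultimately have "p w \<le> d + 0"
    by (rule LIMSEQ_le) (use v in \<open>auto intro: less_imp_le\<close>)
  then have pw: "p w \<le> d"
    by simp
  have "f u = w \<bullet> u" for u
  proof (cases "u = 0")
    case False
    define a where "a = w \<bullet> u - f u"
    \<comment> \<open>The minimiser of \<open>p\<close> along the line through \<open>w\<close> in
      direction \<open>u\<close>; the gain \<open>a^2 / (u . u)\<close> must vanish since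
      \<open>w\<close> is already minimal.\<close>
    define t where "t = - a / (u \<bullet> u)"
    have "p (w + t *\<^sub>R u) = p w + 2 * t * a + t * t * (u \<bullet> u)"
      by (simp add: p_def a_def power2_norm_eq_inner f.add f.scaleR inner_add_left inner_add_right
          inner_commute algebra_simps)
    also have "\<dots> = p w - a\<^sup>2 / (u \<bullet> u)"
      using False by (simp add: t_def field_simps power2_eq_square)
    finally have "a\<^sup>2 / (u \<bullet> u) \<le> 0"
      using d_le[of "w + t *\<^sub>R u"] pw by simp
    moreover have "u \<bullet> u > 0"
      using False by simp
    ultimately have "a\<^sup>2 \<le> 0"
      by (simp add: divide_le_0_iff)
    then show ?thesis
      by (simp add: a_def)
  qed (simp add: f.zero)
  then show ?thesis
    by blast
qed

text \<open>A complex-linear functional is determined by its real part, as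
  \<open>Im (f u) = - Re (f (i u))\<close>, so the real theorem suffices.\<close>

lemma riesz:
  fixes f :: "'h::complex_hilbert \<Rightarrow> complex"
  assumes add: "\<And>x y. f (x + y) = f x + f y"
    and scale: "\<And>c x. f (c *\<^sub>C x) = c * f x"
    and bound: "\<And>x. cmod (f x) \<le> norm x * K"
  shows "\<exists>v. \<forall>u. f u = cinner v u"
proof -
  have "bounded_linear (\<lambda>x. Re (f x))"
  proof (rule bounded_linear_intro)
    show "norm (Re (f x)) \<le> norm x * K" for x
      using abs_Re_le_cmod[of "f x"] bound[of x] by simp
  qed (auto simp: add scale scaleR_scaleC)
  then obtain v where v: "\<And>u. Re (f u) = v \<bullet> u"
    using riesz_real by blast
  have "f u = cinner v u" for u
  proof (rule complex_eqI)
    show "Re (f u) = Re (cinner v u)" for u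
      by (simp add: v inner_eq_Re_cinner)
    from this[of "\<i> *\<^sub>C u"] show "Im (f u) = Im (cinner v u)"
      by (simp add: scale cinner_scaleC_right)
  qed
  then show ?thesis
    by blast
qed

text \<open>Riesz supplies the witness for the definite description. Its bound comes from testing
  against \<open>S x\<close> itself, and uniqueness needs only the defining identity.\<close>

lemma
  assumes T: "bounded_op (T :: 'h::complex_hilbert \<Rightarrow> 'h)"
  shows bounded_op_adjoint: "bounded_op (adjoint_op T)"
    and cinner_adjoint: "cinner (adjoint_op T x) y = cinner x (T y)"
proof -
  obtain K where K: "K > 0" "\<And>x. norm (T x) \<le> norm x * K"
    using bounded_op_bound[OF T] by blast
  have "\<exists>v. \<forall>y. cinner x (T y) = cinner v y" for x
  proof (rule riesz)
    show "cmod (cinner x (T y)) \<le> norm y * (norm x * K)" for y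
      using order_trans[OF norm_cinner_le mult_left_mono[OF K(2) norm_ge_zero]]
      by (simp add: mult_ac)
  qed (auto simp: bounded_op_add[OF T] bounded_op_scaleC[OF T] cinner_simps)
  then obtain S where S: "\<And>x y. cinner x (T y) = cinner (S x) y"
    by metis
  have S': "cinner y (S x) = cinner (T y) x" for x y
    by (metis S cinner_commute)
  have "bounded_op S"
  proof (rule bounded_opI)
    show "S (x + y) = S x + S y" for x y
      by (rule cinner_extensionality) (simp add: S' cinner_simps)
    show "S (c *\<^sub>C x) = c *\<^sub>C S x" for c x
      by (rule cinner_extensionality) (simp add: S' cinner_simps)
    show "norm (S x) \<le> norm x * K" for x
    proof (cases "S x = 0")
      case False
      have "(norm (S x))\<^sup>2 = cmod (cinner x (T (S x)))"
        using cinner_self[of "S x"] S[of x "S x"] by (simp add: norm_power)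
      also have "\<dots> \<le> norm x * (norm (S x) * K)"
        by (rule order_trans[OF norm_cinner_le mult_left_mono[OF K(2) norm_ge_zero]])
      finally show ?thesis
        using False by (simp add: power2_eq_square)
    qed (use K in simp)
  qed
  then have 1: "bounded_op S \<and> (\<forall>x y. cinner (S x) y = cinner x (T y))"
    using S by simp
  have 2: "S' = S" if "\<forall>x y. cinner (S' x) y = cinner x (T y)" for S'
  proof
    show "S' x = S x" for x
      by (rule cinner_extensionality, subst (1 2) cinner_commute) (simp add: that S[symmetric])
  qed
  have "adjoint_op T = S"
    unfolding adjoint_op_def using 1 2 by (intro the_equality) auto
  then show "bounded_op (adjoint_op T)" "cinner (adjoint_op T x) y = cinner x (T y)"
    using 1 by auto
qed

lemma cinner_adjoint_right:
  assumes "bounded_op (T :: 'h::complex_hilbert \<Rightarrow> 'h)"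
  shows "cinner x (adjoint_op T y) = cinner (T x) y"
  by (metis assms cinner_adjoint cinner_commute)

lemma cinner_adjoint_funpow:
  assumes "bounded_op (T :: 'h::complex_hilbert \<Rightarrow> 'h)"
  shows "cinner x ((adjoint_op T ^^ n) y) = cinner ((T ^^ n) x) y"
  by (induction n arbitrary: x y) (simp_all add: cinner_adjoint_right[OF assms] funpow_swap1)

section \<open>Square roots of positive invertible operators\<close>

text \<open>The common source of the Cauchy-Schwarz inequalities below: for positive operators, for
  the semi-inner product, for carrier-based Hilbert spaces, and for 2 by 2 minors of the Toeplitz
  matrix. The phase of \<open>t\<close> is spent on making \<open>t * b\<close> real, which leaves a
  real quadratic.\<close>

lemma complex_quadratic_nonneg_discriminant:
  fixes a c :: real and b :: complex
  assumes "\<And>t. 0 \<le> a + 2 * Re (t * b) + (cmod t)\<^sup>2 * c"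
  shows "(cmod b)\<^sup>2 \<le> a * c"
proof -
  have real: "0 \<le> a - 2 * s * cmod b + s\<^sup>2 * c" for s
  proof (cases "b = 0")
    case True
    then show ?thesis
      using assms[of "complex_of_real s"] by simp
  next
    case False
    define t where "t = - complex_of_real s * (cnj b / cmod b)"
    have "b * cnj b = cmod b * cmod b"
      using complex_norm_square[of b] by (simp add: power2_eq_square)
    then have "t * b = complex_of_real (- (s * cmod b))"
      using False by (simp add: t_def field_simps)
    moreover have "cmod t = \<bar>s\<bar>"
      using False by (simp add: t_def norm_mult norm_divide)
    ultimately show ?thesis
      using assms[of t] by simp
  qed
  show ?thesis
  proof (cases "c > 0")
    case True
    then show ?thesis
      using real[of "cmod b / c"] by (simp add: field_simps power2_eq_square)
  next
    case False
    have "b = 0"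
    proof (rule ccontr)
      assume "b \<noteq> 0"
      \<comment> \<open>Large enough that \<open>a - 2 * s * cmod b\<close> is negative, while the
        quadratic term is nonpositive.\<close>
      define s where "s = (\<bar>a\<bar> + 1) / cmod b"
      have "s\<^sup>2 * c \<le> 0"
        using False by (simp add: mult_nonneg_nonpos)
      then show False
        using real[of s] \<open>b \<noteq> 0\<close> by (simp add: s_def)
    qed
    moreover have "c \<ge> 0 \<or> a \<le> 0"
    proof (rule ccontr)
      assume "\<not> (c \<ge> 0 \<or> a \<le> 0)"
      then have ac: "a > 0" "c < 0"
        by auto
      \<comment> \<open>Makes \<open>s^2 * c = - 2 * a\<close>, so the quadratic takes the value
        \<open>- a < 0\<close>.\<close>
      define s where "s = sqrt (2 * a / - c)"
      have "s\<^sup>2 = 2 * a / - c"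
        unfolding s_def using ac by (intro real_sqrt_pow2) (simp add: divide_nonneg_neg)
      then show False
        using real[of s] ac \<open>b = 0\<close> by simp
    qed
    moreover have "a \<ge> 0"
      using real[of 0] by simp
    ultimately have "a * c = 0"
      using False by auto
    then show ?thesis
      using \<open>b = 0\<close> by auto
  qed
qed

section \<open>Cauchy-Schwarz for positive operators\<close>

lemma positive_op_bounded: "positive_op P \<Longrightarrow> bounded_op P"
  by (simp add: positive_op_def)

lemma positive_op_Re: "positive_op P \<Longrightarrow> 0 \<le> Re (cinner h (P h))"
  by (auto simp: positive_op_def complex_nonneg_Reals_iff)

lemma positive_op_Im: "positive_op P \<Longrightarrow> Im (cinner h (P h)) = 0"
  by (auto simp: positive_op_def complex_nonneg_Reals_iff)

lemma positive_opI:
  assumes "bounded_op P" "\<And>x y. cinner (P x) y = cinner x (P y)" "\<And>h. 0 \<le> Re (cinner h (P h))"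
  shows "positive_op P"
proof -
  have "Im (cinner h (P h)) = 0" for h
    using arg_cong[OF cinner_commute[of h "P h"], of Im] assms(2)[of h h] by simp
  then show ?thesis
    using assms by (auto simp: positive_op_def complex_nonneg_Reals_iff)
qed

text \<open>Polarization: reality of the form at \<open>x + y\<close> compares imaginary parts,
  reality at \<open>x + i y\<close> compares real parts.\<close>

lemma positive_op_selfadjoint:
  assumes P: "positive_op P"
  shows "cinner (P x) y = cinner x (P y)"
proof -
  note B = positive_op_bounded[OF P]
  have "cinner y (P x) = cnj (cinner x (P y))"
    using positive_op_Im[OF P, of "x + y"] positive_op_Im[OF P, of "x + \<i> *\<^sub>C y"]
      positive_op_Im[OF P, of x] positive_op_Im[OF P, of y]
    by (auto simp: bounded_op_add[OF B] bounded_op_scaleC[OF B] cinner_simps complex_eq_iff)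
  then show ?thesis
    by (metis cinner_commute complex_cnj_cnj)
qed

lemma positive_op_cauchy_schwarz:
  assumes P: "positive_op P"
  shows "(cmod (cinner x (P y)))\<^sup>2 \<le> Re (cinner x (P x)) * Re (cinner y (P y))"
proof (rule complex_quadratic_nonneg_discriminant)
  fix t
  note B = positive_op_bounded[OF P]
  have "cinner y (P x) = cnj (cinner x (P y))"
    by (metis positive_op_selfadjoint[OF P] cinner_commute)
  then have "Re (cinner (x + t *\<^sub>C y) (P (x + t *\<^sub>C y)))
      = Re (cinner x (P x)) + 2 * Re (t * cinner x (P y)) + Re (t * cnj t * cinner y (P y))"
    by (simp add: bounded_op_add[OF B] bounded_op_scaleC[OF B] cinner_simps algebra_simps)
  also have "Re (t * cnj t * cinner y (P y)) = (cmod t)\<^sup>2 * Re (cinner y (P y))"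
    by (simp only: complex_norm_square[symmetric] Re_complex_of_real times_complex.sel) simp
  finally show "0 \<le> Re (cinner x (P x)) + 2 * Re (t * cinner x (P y))
      + (cmod t)\<^sup>2 * Re (cinner y (P y))"
    using positive_op_Re[OF P, of "x + t *\<^sub>C y"] by simp
qed

text \<open>Cauchy-Schwarz for the form of \<open>P\<close> at the vectors \<open>P x\<close> and
  \<open>x\<close>, divided by the square of the norm of \<open>P x\<close>. It turns bounds on the
  form into bounds on the norm.\<close>

lemma positive_op_norm_le:
  assumes P: "positive_op P" and q: "\<And>h. Re (cinner h (P h)) \<le> q * (norm h)\<^sup>2"
  shows "(norm (P x))\<^sup>2 \<le> q * Re (cinner x (P x))"
proof (cases "P x = 0")
  case False
  have "((norm (P x))\<^sup>2)\<^sup>2 = (cmod (cinner (P x) (P x)))\<^sup>2"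
    by (simp add: cinner_self norm_power)
  also have "\<dots> \<le> Re (cinner (P x) (P (P x))) * Re (cinner x (P x))"
    by (rule positive_op_cauchy_schwarz[OF P])
  also have "\<dots> \<le> q * (norm (P x))\<^sup>2 * Re (cinner x (P x))"
    by (intro mult_right_mono q positive_op_Re[OF P])
  finally show ?thesis
    using False by (simp add: power2_eq_square mult_ac)
qed simp

text \<open>A bounded inverse only controls the norm of \<open>h\<close> by that of
  \<open>A h\<close>; \<open>positive_op_norm_le\<close> then controls \<open>A h\<close> by the
  form. The two bounds multiply to the constant \<open>1 / (K * L^2)\<close>.\<close>

lemma positive_invertible_lower_bound:
  assumes "positive_op A" "invertible_op A"
  obtains d where "d > 0" "\<And>h. d * (norm h)\<^sup>2 \<le> Re (cinner h (A h))"
proof -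
  obtain K where K: "K > 0" "\<And>x. norm (A x) \<le> norm x * K"
    using bounded_op_bound[OF positive_op_bounded[OF assms(1)]] by blast
  obtain L where L: "L > 0" "\<And>x. norm (inv A x) \<le> norm x * L"
    using bounded_op_bound[OF bounded_op_inv[OF assms(2)]] by blast
  have KA: "Re (cinner h (A h)) \<le> K * (norm h)\<^sup>2" for h
  proof -
    have "Re (cinner h (A h)) \<le> norm h * norm (A h)"
      using order_trans[OF complex_Re_le_cmod norm_cinner_le] .
    also have "\<dots> \<le> norm h * (norm h * K)"
      by (intro mult_left_mono K) simp
    finally show ?thesis
      by (simp add: power2_eq_square mult_ac)
  qed
  have "1 / (K * L\<^sup>2) * (norm h)\<^sup>2 \<le> Re (cinner h (A h))" for h
  proof -
    have "norm h \<le> norm (A h) * L"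
      using L(2)[of "A h"] invertible_op_bij[OF assms(2)] by (simp add: bij_is_inj)
    then have "(norm h)\<^sup>2 \<le> (norm (A h))\<^sup>2 * L\<^sup>2"
      by (metis norm_ge_zero power_mono power_mult_distrib)
    also have "\<dots> \<le> K * Re (cinner h (A h)) * L\<^sup>2"
      by (intro mult_right_mono positive_op_norm_le[OF assms(1) KA]) simp
    finally show ?thesis
      using K(1) L(1) by (simp add: field_simps)
  qed
  then show ?thesis
    using that[of "1 / (K * L\<^sup>2)"] K(1) L(1) by simp
qed

text \<open>If \<open>Y = (X + Y\<^sup>2) / 2\<close> then \<open>(I - Y)\<^sup>2 = I - X\<close>; for \<open>\<parallel>X\<parallel> \<le> q < 1\<close> the right-hand side
  is a contraction of the ball of radius \<open>q\<close>.\<close>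

lemma sqrt_fixed_point:
  fixes X :: "'h::complex_hilbert \<Rightarrow> 'h"
  assumes X: "bounded_op X" and sa: "\<And>x y. cinner (X x) y = cinner x (X y)"
    and q: "0 \<le> q" "q < 1" "\<And>x. norm (X x) \<le> q * norm x"
  obtains Y where "bounded_op Y" "\<And>x y. cinner (Y x) y = cinner x (Y y)"
    "\<And>x. norm (Y x) \<le> q * norm x" "\<And>x. 2 *\<^sub>R Y x = X x + Y (Y x)"
    "\<forall>D. bounded_op D \<longrightarrow> (\<forall>x. D (X x) = X (D x)) \<longrightarrow> (\<forall>x. D (Y x) = Y (D x))"
proof -
  have blX: "bounded_linear X"
    using X by (simp add: bounded_op_def)
  define B where "B = Blinfun X"
  have BX: "blinfun_apply B x = X x" for x
    by (simp add: B_def bounded_linear_Blinfun_apply[OF blX])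
  \<comment> \<open>All properties wanted of the fixed point are closed conditions preserved by the
    iteration, so they are built into the set. Commuting with the commutant of \<open>X\<close> is
    included because uniqueness of the square root rests on it.\<close>
  define S where "S = {Y :: 'h \<Rightarrow>\<^sub>L 'h. norm Y \<le> q \<and> (\<forall>c x. blinfun_apply Y (c *\<^sub>C x) = c *\<^sub>C blinfun_apply Y x)
    \<and> (\<forall>x y. cinner (blinfun_apply Y x) y = cinner x (blinfun_apply Y y))
    \<and> (\<forall>D. bounded_op D \<longrightarrow> (\<forall>x. D (X x) = X (D x)) \<longrightarrow>
          (\<forall>x. D (blinfun_apply Y x) = blinfun_apply Y (D x)))}"
  define f where "f = (\<lambda>Y :: 'h \<Rightarrow>\<^sub>L 'h. (1/2) *\<^sub>R (B + (Y o\<^sub>L Y)))"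
  have fY: "blinfun_apply (f Y) x = (1/2) *\<^sub>R (X x + Y (Y x))" for Y x
    by (simp add: f_def blinfun.bilinear_simps BX)
  have "closed S"
    unfolding closed_sequential_limits
  proof (intro allI impI, elim conjE)
    fix Z :: "nat \<Rightarrow> 'h \<Rightarrow>\<^sub>L 'h" and Y
    assume ZS: "\<forall>n. Z n \<in> S" and lim: "Z \<longlonglongrightarrow> Y"
    have limx: "(\<lambda>n. Z n x) \<longlonglongrightarrow> Y x" for x
      by (intro blinfun.tendsto lim tendsto_const)
    have "norm Y \<le> q"
      using ZS by (intro Lim_bounded[OF tendsto_norm[OF lim], of 0]) (auto simp: S_def)
    moreover have "Y (c *\<^sub>C x) = c *\<^sub>C Y x" for c x
    proof -
      have "bounded_op (\<lambda>x::'h. c *\<^sub>C x)"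
        using bounded_op_scale[OF bounded_op_id, of c] by simp
      then have "bounded_linear (\<lambda>x::'h. c *\<^sub>C x)"
        by (simp add: bounded_op_def)
      then have "(\<lambda>n. c *\<^sub>C Z n x) \<longlonglongrightarrow> c *\<^sub>C Y x"
        by (rule bounded_linear.tendsto[OF _ limx])
      moreover have "(\<lambda>n. c *\<^sub>C Z n x) = (\<lambda>n. Z n (c *\<^sub>C x))"
        using ZS by (auto simp: S_def)
      ultimately show ?thesis
        using LIMSEQ_unique limx by metis
    qed
    moreover have "cinner (Y x) y = cinner x (Y y)" for x y
    proof -
      have "(\<lambda>n. cinner (Z n x) y) \<longlonglongrightarrow> cinner (Y x) y"
        by (intro bounded_bilinear.tendsto[OF bounded_bilinear_cinner] limx tendsto_const)
      moreover have "(\<lambda>n. cinner x (Z n y)) \<longlonglongrightarrow> cinner x (Y y)"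
        by (intro bounded_bilinear.tendsto[OF bounded_bilinear_cinner] limx tendsto_const)
      moreover have "(\<lambda>n. cinner (Z n x) y) = (\<lambda>n. cinner x (Z n y))"
        using ZS by (auto simp: S_def)
      ultimately show ?thesis
        using LIMSEQ_unique by metis
    qed
    moreover have "D (Y x) = Y (D x)" if D: "bounded_op D" "\<forall>x. D (X x) = X (D x)" for D x
    proof -
      have "bounded_linear D"
        using D(1) by (simp add: bounded_op_def)
      then have "(\<lambda>n. D (Z n x)) \<longlonglongrightarrow> D (Y x)"
        by (rule bounded_linear.tendsto[OF _ limx])
      moreover have "(\<lambda>n. D (Z n x)) = (\<lambda>n. Z n (D x))"
        using ZS D by (auto simp: S_def)
      ultimately show ?thesis
        using LIMSEQ_unique limx by metis
    qed
    ultimately show "Y \<in> S"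
      by (simp add: S_def)
  qed
  then have "complete S"
    by (simp add: complete_eq_closed)
  moreover have "S \<noteq> {}"
  proof -
    have "0 \<in> S"
      using q(1) by (auto simp: S_def bounded_op_zero)
    then show ?thesis
      by blast
  qed
  moreover have "f ` S \<subseteq> S"
  proof
    fix W assume "W \<in> f ` S"
    then obtain Y where Y: "Y \<in> S" and W: "W = f Y"
      by blast
    have nY: "norm Y \<le> q"
      using Y by (simp add: S_def)
    have nB: "norm B \<le> q"
      by (rule norm_blinfun_bound) (use q BX in auto)
    have "norm (Y o\<^sub>L Y) \<le> q * 1"
      using order_trans[OF norm_blinfun_compose mult_mono[OF nY order_trans[OF nY less_imp_le[OF q(2)]]]]
        q(1) by simp
    then have "norm (B + (Y o\<^sub>L Y)) \<le> q + q"
      using norm_triangle_le[of B "Y o\<^sub>L Y"] nB by simp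
    then have "norm W \<le> q"
      by (simp add: W f_def)
    moreover have "D (W x) = W (D x)" if D: "bounded_op D" "\<forall>x. D (X x) = X (D x)" for D x
      using Y D unfolding W fY S_def
      by (simp add: scaleR_scaleC bounded_op_scaleC[OF D(1)] bounded_op_add[OF D(1)])
    ultimately show "W \<in> S"
      using Y unfolding S_def W
      by (auto simp: fY sa cinner_simps scaleR_scaleC scaleC_scaleC mult.commute
          bounded_op_scaleC[OF X] scaleC_add_right)
  qed
  moreover have "dist (f Y) (f Z) \<le> q * dist Y Z" if "Y \<in> S" "Z \<in> S" for Y Z
  proof -
    have n: "norm Y \<le> q" "norm Z \<le> q"
      using that by (auto simp: S_def)
    \<comment> \<open>This splitting of \<open>Y Y - Z Z\<close> does not require \<open>Y\<close>
      and \<open>Z\<close> to commute.\<close>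
    have "f Y - f Z = (1/2) *\<^sub>R ((Y o\<^sub>L (Y - Z)) + ((Y - Z) o\<^sub>L Z))"
      by (rule blinfun_eqI) (simp add: fY blinfun.bilinear_simps algebra_simps)
    then have "norm (f Y - f Z) = (1/2) * norm ((Y o\<^sub>L (Y - Z)) + ((Y - Z) o\<^sub>L Z))"
      by simp
    also have "\<dots> \<le> (1/2) * (norm (Y o\<^sub>L (Y - Z)) + norm ((Y - Z) o\<^sub>L Z))"
      by (intro mult_left_mono norm_triangle_ineq) simp
    also have "\<dots> \<le> (1/2) * (norm Y * norm (Y - Z) + norm (Y - Z) * norm Z)"
      by (intro mult_left_mono add_mono norm_blinfun_compose) simp
    also have "\<dots> \<le> (1/2) * (q * norm (Y - Z) + norm (Y - Z) * q)"
      by (intro mult_left_mono add_mono mult_right_mono n) simp_all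
    finally show ?thesis
      by (simp add: dist_norm)
  qed
  ultimately have "\<exists>!Y\<in>S. f Y = Y"
    using Banach_fix[of S q f] q(1,2) by blast
  then obtain Y where Y: "Y \<in> S" "f Y = Y"
    by blast
  show ?thesis
  proof (rule that[of "blinfun_apply Y"])
    show "norm (Y x) \<le> q * norm x" for x
      using Y(1) order_trans[OF norm_blinfun mult_right_mono] by (auto simp: S_def)
    show "bounded_op Y"
      using Y(1) by (auto simp: S_def bounded_op_def blinfun.bounded_linear_right)
    show "2 *\<^sub>R Y x = X x + Y (Y x)" for x
      using fY[of Y x] Y(2) by (metis scaleR_half_double scaleR_scaleR scaleR_2 scaleR_right_distrib)
  qed (use Y(1) in \<open>auto simp: S_def\<close>)
qed

text \<open>Rescaled, \<open>A / K = I - X\<close> with \<open>0 <= X <= q\<close> and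
  \<open>q = 1 - d / K\<close>. The lower bound \<open>d\<close> keeps \<open>q\<close> below 1, so
  the fixed point \<open>Y\<close> exists by contraction, and \<open>B = sqrt K (I - Y)\<close>
  inherits a lower bound because the norm of \<open>Y\<close> is at most \<open>q\<close>.\<close>

lemma positive_sqrt_exists:
  fixes A :: "'h::complex_hilbert \<Rightarrow> 'h"
  assumes A: "positive_op A" and d: "d > 0" "\<And>h. d * (norm h)\<^sup>2 \<le> Re (cinner h (A h))"
  obtains B e where "positive_op B" "B \<circ> B = A" "e > 0"
    "\<And>h. e * (norm h)\<^sup>2 \<le> Re (cinner h (B h))"
    "\<forall>D. bounded_op D \<longrightarrow> D \<circ> A = A \<circ> D \<longrightarrow> D \<circ> B = B \<circ> D"
proof -
  note bA = positive_op_bounded[OF A]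
  obtain K0 where K0: "K0 > 0" "\<And>x. norm (A x) \<le> norm x * K0"
    using bounded_op_bound[OF bA] by blast
  \<comment> \<open>The maximum ensures \<open>q >= 0\<close>.\<close>
  define K where "K = max K0 d"
  have K: "K > 0" "d \<le> K" "\<And>x. norm (A x) \<le> norm x * K"
    using K0 d(1) order_trans[OF K0(2) mult_left_mono[of K0 K]] by (auto simp: K_def)
  define k where "k = complex_of_real (1 / K)"
  define X where "X = (\<lambda>x. x - k *\<^sub>C A x)"
  define q where "q = 1 - d / K"
  have q: "0 \<le> q" "q < 1"
    using K d(1) by (auto simp: q_def)
  have bX: "bounded_op X"
    using bounded_op_minus[OF bounded_op_id bounded_op_scale[OF bA, of k]] by (simp add: X_def)
  have sX: "cinner (X x) y = cinner x (X y)" for x y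
    by (simp add: X_def cinner_simps positive_op_selfadjoint[OF A] k_def)
  have ReX: "Re (cinner h (X h)) = (norm h)\<^sup>2 - Re (cinner h (A h)) / K" for h
    by (simp add: X_def cinner_simps k_def cinner_self)
  have "Re (cinner h (A h)) \<le> norm h * (norm h * K)" for h
    using order_trans[OF complex_Re_le_cmod order_trans[OF norm_cinner_le mult_left_mono[OF K(3) norm_ge_zero]]] .
  then have pX: "positive_op X"
    using K(1) by (intro positive_opI bX sX) (auto simp: ReX field_simps power2_eq_square)
  have qX: "Re (cinner h (X h)) \<le> q * (norm h)\<^sup>2" for h
    using d(2)[of h] K(1) by (auto simp: ReX q_def field_simps)
  have nX: "norm (X x) \<le> q * norm x" for x
  proof (rule power2_le_imp_le)
    have "(norm (X x))\<^sup>2 \<le> q * Re (cinner x (X x))"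
      by (rule positive_op_norm_le[OF pX qX])
    also have "\<dots> \<le> q * (q * (norm x)\<^sup>2)"
      by (intro mult_left_mono qX q)
    finally show "(norm (X x))\<^sup>2 \<le> (q * norm x)\<^sup>2"
      by (simp add: power2_eq_square mult_ac)
  qed (use q in simp)
  obtain Y where Y: "bounded_op Y" "\<And>x y. cinner (Y x) y = cinner x (Y y)"
    "\<And>x. norm (Y x) \<le> q * norm x" "\<And>x. 2 *\<^sub>R Y x = X x + Y (Y x)"
    "\<forall>D. bounded_op D \<longrightarrow> (\<forall>x. D (X x) = X (D x)) \<longrightarrow> (\<forall>x. D (Y x) = Y (D x))"
    using sqrt_fixed_point[OF bX sX q nX] by blast
  define s where "s = complex_of_real (sqrt K)"
  define B where "B = (\<lambda>x. s *\<^sub>C (x - Y x))"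
  have bB: "bounded_op B"
    using bounded_op_scale[OF bounded_op_minus[OF bounded_op_id Y(1)], of s] by (simp add: B_def)
  have lowB: "sqrt K * (d / K) * (norm h)\<^sup>2 \<le> Re (cinner h (B h))" for h
  proof -
    have "Re (cinner h (Y h)) \<le> norm h * (q * norm h)"
      using order_trans[OF complex_Re_le_cmod order_trans[OF norm_cinner_le mult_left_mono[OF Y(3) norm_ge_zero]]] .
    then have "d / K * (norm h)\<^sup>2 \<le> (norm h)\<^sup>2 - Re (cinner h (Y h))"
      by (simp add: q_def power2_eq_square algebra_simps)
    then have "sqrt K * (d / K * (norm h)\<^sup>2) \<le> sqrt K * ((norm h)\<^sup>2 - Re (cinner h (Y h)))"
      using K(1) by (intro mult_left_mono) auto
    then show ?thesis
      by (simp add: B_def s_def cinner_simps cinner_self mult_ac)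
  qed
  have e: "sqrt K * (d / K) > 0"
    using K(1) d(1) by simp
  have BB: "B (B x) = A x" for x
  proof -
    have "2 *\<^sub>C Y x = X x + Y (Y x)"
      using Y(4)[of x] by (simp add: scaleR_scaleC)
    then have *: "x - Y x - Y (x - Y x) = k *\<^sub>C A x"
      using scaleC_add_left[of 1 1 "Y x"]
      by (simp add: bounded_op_diff[OF Y(1)] X_def algebra_simps)
    have "B (B x) = (s * s) *\<^sub>C (x - Y x - Y (x - Y x))"
      by (simp add: B_def bounded_op_scaleC[OF Y(1)] scaleC_diff_right[symmetric] scaleC_scaleC)
    also have "\<dots> = (s * s * k) *\<^sub>C A x"
      by (simp add: * scaleC_scaleC)
    also have "s * s * k = 1"
      using K(1) by (simp add: s_def k_def flip: of_real_mult)
    finally show ?thesis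
      by simp
  qed
  show ?thesis
  proof (rule that[OF _ _ e lowB])
    show "positive_op B"
    proof (rule positive_opI[OF bB])
      show "cinner (B x) y = cinner x (B y)" for x y
        by (simp add: B_def s_def cinner_simps Y(2))
      show "0 \<le> Re (cinner h (B h))" for h
        using lowB[of h] e by (meson less_imp_le mult_nonneg_nonneg order_trans zero_le_power2)
    qed
    show "B \<circ> B = A"
      using BB by (auto simp: fun_eq_iff)
    have "D \<circ> B = B \<circ> D" if D: "bounded_op D" "D \<circ> A = A \<circ> D" for D
    proof -
      from D have "D (X x) = X (D x)" for x
        by (simp add: X_def bounded_op_diff[OF D(1)] bounded_op_scaleC[OF D(1)] fun_eq_iff)
      then have "D (Y x) = Y (D x)" for x
        using Y(5) D(1) by blast
      then show ?thesis
        by (simp add: B_def bounded_op_diff[OF D(1)] bounded_op_scaleC[OF D(1)] fun_eq_iff)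
    qed
    then show "\<forall>D. bounded_op D \<longrightarrow> D \<circ> A = A \<circ> D \<longrightarrow> D \<circ> B = B \<circ> D"
      by blast
  qed
qed

text \<open>Uniqueness in the definite description: a positive root \<open>C\<close> commutes with
  \<open>A = C C\<close>, hence with \<open>B\<close>, so \<open>(C + B) (C h - B h) = 0\<close>.
  Both forms are nonnegative and that of \<open>B\<close> is bounded below, which forces
  \<open>C h = B h\<close>.\<close>

lemma
  fixes A :: "'h::complex_hilbert \<Rightarrow> 'h"
  assumes A: "positive_op A" "invertible_op A"
  shows positive_sqrt_op: "positive_op (sqrt_op A)"
    and sqrt_op_sqrt_op: "sqrt_op A \<circ> sqrt_op A = A"
proof -
  obtain d where d: "d > 0" "\<And>h. d * (norm h)\<^sup>2 \<le> Re (cinner h (A h))"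
    using positive_invertible_lower_bound[OF A] by blast
  obtain B e where B: "positive_op B" "B \<circ> B = A" "e > 0"
    "\<And>h. e * (norm h)\<^sup>2 \<le> Re (cinner h (B h))"
    "\<forall>D. bounded_op D \<longrightarrow> D \<circ> A = A \<circ> D \<longrightarrow> D \<circ> B = B \<circ> D"
    using positive_sqrt_exists[OF A(1) d] by blast
  note bB = positive_op_bounded[OF B(1)]
  have uniq: "C = B" if C: "positive_op C" "C \<circ> C = A" for C
  proof
    fix h
    note bC = positive_op_bounded[OF C(1)]
    have "C \<circ> B = B \<circ> C"
      using B(5) bC C(2) by (metis comp_assoc)
    then have CB: "C (B x) = B (C x)" for x
      by (simp add: fun_eq_iff)
    define v where "v = C h - B h"
    have "C (C h) = B (B h)"
      using B(2) C(2) by (metis comp_apply)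
    then have "C v + B v = 0"
      by (simp add: v_def bounded_op_diff[OF bB] bounded_op_diff[OF bC] CB)
    then have "Re (cinner v (C v)) + Re (cinner v (B v)) = 0"
      by (metis cinner_add_right cinner_zero_right plus_complex.sel(1) zero_complex.sel(1))
    then have "e * (norm v)\<^sup>2 \<le> 0"
      using B(4)[of v] positive_op_Re[OF C(1), of v] by linarith
    then show "C h = B h"
      using B(3) by (simp add: v_def mult_le_0_iff)
  qed
  have "sqrt_op A = B"
    unfolding sqrt_op_def using B(1,2) uniq by (intro the_equality conjI) blast+
  then show "positive_op (sqrt_op A)" "sqrt_op A \<circ> sqrt_op A = A"
    using B(1,2) by auto
qed

lemma
  fixes A :: "'h::complex_hilbert \<Rightarrow> 'h"
  assumes A: "positive_op A" "invertible_op A"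
  shows bounded_inv_sqrt_op: "bounded_op (inv_sqrt_op A)"
    and inv_sqrt_op_selfadjoint: "cinner (inv_sqrt_op A x) y = cinner x (inv_sqrt_op A y)"
    and inv_sqrt_op_sqrt_op: "inv_sqrt_op A (sqrt_op A x) = x"
    and cinner_inv_sqrt_op: "cinner (inv_sqrt_op A x) (A (inv_sqrt_op A y)) = cinner x y"
proof -
  define B where "B = sqrt_op A"
  have B: "positive_op B" "B \<circ> B = A"
    by (simp_all add: B_def positive_sqrt_op[OF A] sqrt_op_sqrt_op[OF A])
  note bB = positive_op_bounded[OF B(1)]
  obtain S where S: "bounded_op S" "S \<circ> A = id" "A \<circ> S = id"
    using A(2) by (auto simp: invertible_op_def)
  have "bij B"
  proof (rule bijI)
    show "inj B"
      using S(2) B(2) by (metis inj_on_id inj_on_imageI2 comp_assoc)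
    show "surj B"
      using S(3) B(2) by (metis comp_apply id_apply surjI)
  qed
  moreover have "bounded_op (S \<circ> B)"
    by (rule bounded_op_comp[OF S(1) bB])
  moreover have "(S \<circ> B) \<circ> B = id"
    using S(2) B(2) by (simp add: comp_assoc)
  \<comment> \<open>Boundedness of the inverse root is read off from the formula: the inverse of
    \<open>A\<close> times \<open>B\<close>.\<close>
  ultimately have inv: "inv B = S \<circ> B"
    by (metis bij_is_surj comp_assoc comp_id surj_iff id_comp)
  have Q: "inv_sqrt_op A = inv B"
    by (simp add: inv_sqrt_op_def B_def)
  have BQ: "B (inv B x) = x" for x
    using \<open>bij B\<close> by (simp add: bij_is_surj surj_f_inv_f)
  show "bounded_op (inv_sqrt_op A)"
    unfolding Q inv by (rule bounded_op_comp[OF S(1) bB])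
  show "cinner (inv_sqrt_op A x) y = cinner x (inv_sqrt_op A y)"
    using positive_op_selfadjoint[OF B(1), of "inv B x" "inv B y"] by (simp add: Q BQ)
  show "inv_sqrt_op A (sqrt_op A x) = x"
    using \<open>bij B\<close> by (simp add: Q B_def[symmetric] bij_is_inj)
  show "cinner (inv_sqrt_op A x) (A (inv_sqrt_op A y)) = cinner x y"
    using positive_op_selfadjoint[OF B(1), of "inv B x" "B (inv B y)"] fun_cong[OF B(2), of "inv B y"]
    by (simp add: Q BQ)
qed

section \<open>Positivity of the resolvent\<close>

text \<open>Condition (iv) as a real inequality.\<close>

definition resolvent_positive :: "('h::complex_hilbert \<Rightarrow> 'h) \<Rightarrow> ('h \<Rightarrow> 'h) \<Rightarrow> bool" where
  "resolvent_positive A T \<longleftrightarrow> (\<forall>z h. cmod z < 1 \<longrightarrow>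
     0 \<le> Re (cinner (id_minus z T h) (A (id_minus z T h))) - 2 * (norm (id_minus z T h))\<^sup>2
         + 2 * Re (cinner h (id_minus z T h)))"

lemma resolvent_positive_iff:
  assumes A: "positive_op A"
  shows "resolvent_positive A T \<longleftrightarrow> (\<forall>z h. cmod z < 1 \<longrightarrow>
    cinner (id_minus z T h) (A (id_minus z T h) - 2 *\<^sub>C id_minus z T h)
      + 2 * complex_of_real (Re (cinner h (id_minus z T h))) \<in> \<real>\<^sub>\<ge>\<^sub>0)"
  by (simp add: resolvent_positive_def complex_nonneg_Reals_iff cinner_simps cinner_self
      positive_op_Im[OF A])

text \<open>If \<open>(I - zT)h\<close> were small compared with \<open>h\<close>, then \<open>(I - (1 + \<delta>)zT)h\<close> would be close to
  \<open>- \<delta>h\<close>, and the term \<open>2 Re \<langle>h, (I - (1 + \<delta>)zT)h\<rangle>\<close> would dominate and be negative.\<close>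

lemma resolvent_positive_bounded_below:
  assumes A: "bounded_op A" and T: "bounded_op T" and pos: "resolvent_positive A T"
    and r: "r < 1"
  obtains c where "c > 0" "\<And>z h. cmod z \<le> r \<Longrightarrow> c * norm h \<le> norm (id_minus z T h)"
proof -
  obtain M where M: "M > 0" "\<And>x. norm (A x) \<le> norm x * M"
    using bounded_op_bound[OF A] by blast
  define \<delta> where "\<delta> = Min {1, 1 / (4 * M), (1 - r) / 2}"
  \<comment> \<open>The bound 1 gives \<open>1 + \<delta> <= 2\<close>, the bound
    \<open>1 / (4 * M)\<close> keeps the \<open>A\<close>-term below \<open>9/16\<close> of the
    negative term, and \<open>(1 - r) / 2\<close> keeps \<open>z'\<close> inside the disc.\<close>
  have \<delta>: "\<delta> > 0" "\<delta> \<le> 1" "\<delta> \<le> 1 / (4 * M)" "\<delta> \<le> (1 - r) / 2"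
    using M(1) r by (simp_all only: \<delta>_def Min_gr_iff Min_le finite.intros insert_not_empty insert_iff simp_thms) simp
  have "\<delta> / 4 * norm h \<le> norm (id_minus z T h)" if z: "cmod z \<le> r" for z h
  proof (rule ccontr)
    assume "\<not> ?thesis"
    then have small: "norm (id_minus z T h) < \<delta> / 4 * norm h"
      by simp
    then have h: "norm h > 0"
      using \<delta>(1) by (smt (verit) norm_ge_zero mult_eq_0_iff)
    define y where "y = id_minus z T h"
    define z' where "z' = complex_of_real (1 + \<delta>) * z"
    define y' where "y' = id_minus z' T h"
    have y': "y' = (1 + \<delta>) *\<^sub>R y - \<delta> *\<^sub>R h"
      by (simp add: y'_def y_def z'_def id_minus_def scaleR_scaleC scaleC_diff_right scaleC_scaleC
          scaleC_add_left algebra_simps)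
    have "cmod z' = (1 + \<delta>) * cmod z"
      using \<delta>(1) by (simp add: z'_def norm_mult del: of_real_add)
    also have "\<dots> \<le> (1 + \<delta>) * r"
      using z \<delta>(1) by simp
    also have "\<dots> \<le> r + \<delta>"
      using r \<delta>(1) by (simp add: algebra_simps)
    also have "\<dots> < 1"
      using \<delta>(4) r by simp
    finally have pos': "0 \<le> Re (cinner y' (A y')) - 2 * (norm y')\<^sup>2 + 2 * Re (cinner h y')"
      using pos by (simp add: resolvent_positive_def y'_def)
    have "norm y' \<le> (1 + \<delta>) * norm y + \<delta> * norm h"
      unfolding y' using norm_triangle_ineq4[of "(1 + \<delta>) *\<^sub>R y" "\<delta> *\<^sub>R h"] \<delta>(1) by simp
    also have "\<dots> \<le> 2 * norm y + \<delta> * norm h"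
      using \<delta>(2) by (intro add_mono mult_right_mono) auto
    also have "\<dots> \<le> (3 / 2) * \<delta> * norm h"
      using small by (simp add: y_def)
    finally have ny': "norm y' \<le> (3 / 2) * \<delta> * norm h" .
    have "Re (cinner y' (A y')) \<le> norm y' * (norm y' * M)"
      using order_trans[OF complex_Re_le_cmod order_trans[OF norm_cinner_le mult_left_mono[OF M(2) norm_ge_zero]]] .
    also have "\<dots> = M * (norm y')\<^sup>2"
      by (simp add: power2_eq_square)
    also have "\<dots> \<le> M * ((3 / 2) * \<delta> * norm h)\<^sup>2"
      using M(1) ny' by (intro mult_left_mono power_mono) auto
    finally have 1: "Re (cinner y' (A y')) \<le> (9 / 4) * (M * \<delta>) * (\<delta> * (norm h)\<^sup>2)"
      by (simp add: power_mult_distrib power_divide) (simp add: power2_eq_square mult_ac)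
    have "h \<bullet> y \<le> norm h * norm y"
      by (rule norm_cauchy_schwarz)
    also have "\<dots> \<le> norm h * (\<delta> / 4 * norm h)"
      using small by (intro mult_left_mono) (auto simp: y_def)
    finally have "(1 + \<delta>) * (h \<bullet> y) \<le> (1 + \<delta>) * (\<delta> / 4 * (norm h)\<^sup>2)"
      using \<delta>(1) by (intro mult_left_mono) (auto simp: power2_eq_square mult_ac)
    also have "\<dots> \<le> 2 * (\<delta> / 4 * (norm h)\<^sup>2)"
      using \<delta>(1,2) by (intro mult_right_mono) auto
    finally have "h \<bullet> y' \<le> - (\<delta> / 2) * (norm h)\<^sup>2"
      by (simp add: y' inner_diff_right power2_norm_eq_inner)
    then have 2: "2 * Re (cinner h y') \<le> - (\<delta> * (norm h)\<^sup>2)"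
      by (simp add: inner_eq_Re_cinner)
    have "M * \<delta> \<le> 1 / 4"
      using \<delta>(3) M(1) by (simp add: field_simps)
    then have "(9 / 4) * (M * \<delta>) * (\<delta> * (norm h)\<^sup>2) \<le> (9 / 16) * (\<delta> * (norm h)\<^sup>2)"
      using \<delta>(1) by (intro mult_right_mono) auto
    moreover have "\<delta> * (norm h)\<^sup>2 > 0"
      using \<delta>(1) h by simp
    ultimately show False
      using pos' 1 2 zero_le_power2[of "norm y'"] by linarith
  qed
  then show ?thesis
    using that[of "\<delta> / 4"] \<delta>(1) by simp
qed

text \<open>\<open>(I - zT) x = y\<close> is equivalent to
  \<open>(I - wT) x = y + (z - w) T x\<close>, a fixed-point equation for a contraction with factor
  \<open>cmod (z - w) * K / c\<close>.\<close>

lemma surj_id_minus_perturb: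
  fixes T :: "'h::complex_hilbert \<Rightarrow> 'h"
  assumes T: "bounded_op T" and K: "\<And>x. norm (T x) \<le> norm x * K"
    and w: "invertible_op (id_minus w T)"
    and c: "c > 0" "\<And>h. c * norm h \<le> norm (id_minus w T h)" and zw: "cmod (z - w) * K < c"
    and K0: "K \<ge> 0"
  shows "surj (id_minus z T)"
proof -
  note bw = bounded_op_id_minus[OF T, of w] and bi = bounded_op_inv[OF w]
  define S where "S = inv (id_minus w T)"
  have S: "id_minus w T (S x) = x" "S (id_minus w T x) = x" for x
    using invertible_op_bij[OF w] by (simp_all add: S_def bij_is_surj surj_f_inv_f bij_is_inj)
  have nS: "norm (S x) \<le> norm x / c" for x
    using c(2)[of "S x"] c(1) by (simp add: S field_simps)
  define g where "g = (\<lambda>y x. S (y + (z - w) *\<^sub>C T x))"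
  have "\<exists>!x. g y x = x" for y
  proof (rule banach_fix_type)
    show "0 \<le> cmod (z - w) * K / c" "cmod (z - w) * K / c < 1"
      using c(1) zw K0 by simp_all
    show "\<forall>x x'. dist (g y x) (g y x') \<le> cmod (z - w) * K / c * dist x x'"
    proof (intro allI)
      fix x x'
      have "g y x - g y x' = S ((z - w) *\<^sub>C T (x - x'))"
        by (simp add: g_def S_def bounded_op_diff[OF bi, symmetric] bounded_op_diff[OF T] scaleC_diff_right)
      then have "norm (g y x - g y x') \<le> norm ((z - w) *\<^sub>C T (x - x')) / c"
        using nS by simp
      also have "\<dots> \<le> cmod (z - w) * (norm (x - x') * K) / c"
        unfolding norm_scaleC using c(1) by (intro divide_right_mono mult_left_mono K) auto
      finally show "dist (g y x) (g y x') \<le> cmod (z - w) * K / c * dist x x'"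
        by (simp add: dist_norm mult_ac)
    qed
  qed
  then obtain x where x: "\<And>y. g y (x y) = x y"
    by metis
  have "id_minus z T (x y) = y" for y
  proof -
    have "id_minus w T (x y) = y + (z - w) *\<^sub>C T (x y)"
      using arg_cong[OF x[of y], of "id_minus w T"] by (simp add: g_def S)
    then show ?thesis
      by (simp add: id_minus_def scaleC_diff_left algebra_simps)
  qed
  then show ?thesis
    by (rule surjI)
qed

text \<open>Method of continuity: a lower bound alone does not give surjectivity, but the same
  \<open>c\<close> serves all along the segment from 0 to \<open>z\<close>, so steps of equal
  length, short compared with \<open>c / K\<close>, carry invertibility from the identity to
  \<open>I - zT\<close>.\<close>

lemma invertible_id_minus:
  fixes T :: "'h::complex_hilbert \<Rightarrow> 'h"
  assumes T: "bounded_op T"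
    and c: "c > 0" "\<And>z h. cmod z \<le> r \<Longrightarrow> c * norm h \<le> norm (id_minus z T h)"
    and z: "cmod z \<le> r"
  shows "invertible_op (id_minus z T)"
proof -
  obtain K where K: "K > 0" "\<And>x. norm (T x) \<le> norm x * K"
    using bounded_op_bound[OF T] by blast
  obtain n where n: "cmod z * K / c < real n"
    using reals_Archimedean2 by blast
  have n0: "real n > 0"
    using n K(1) c(1) by (smt (verit) divide_nonneg_pos mult_nonneg_nonneg norm_ge_zero)
  define w where "w = (\<lambda>k. complex_of_real (real k / real n) * z)"
  have wr: "cmod (w k) \<le> r" if "k \<le> n" for k
  proof -
    have "cmod (w k) = real k / real n * cmod z"
      by (simp add: w_def norm_mult norm_divide)
    also have "\<dots> \<le> 1 * cmod z"
      using that n0 by (intro mult_right_mono) auto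
    finally show ?thesis
      using z by simp
  qed
  have "invertible_op (id_minus (w k) T)" if "k \<le> n" for k
    using that
  proof (induction k)
    case 0
    have "id_minus (w 0) T = id"
      by (simp add: w_def id_minus_def fun_eq_iff)
    then show ?case
      using bounded_op_id by (metis comp_id invertible_op_def)
  next
    case (Suc k)
    have "w (Suc k) - w k = z / of_nat n"
      by (simp add: w_def field_simps add_divide_distrib)
    then have "cmod (w (Suc k) - w k) = cmod z / real n"
      by (simp add: norm_divide)
    moreover have "cmod z / real n * K < c"
      using n n0 c(1) by (simp add: field_simps)
    ultimately have "cmod (w (Suc k) - w k) * K < c"
      by simp
    then have "surj (id_minus (w (Suc k)) T)"
      using Suc wr K c by (intro surj_id_minus_perturb[OF T K(2), of "w k" c]) auto
    then show ?case
      using invertible_opI[OF bounded_op_id_minus[OF T] _ c(1)] c(2) wr[OF Suc.prems] by blast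
  qed
  from this[of n] show ?thesis
    using n0 by (simp add: w_def)
qed

section \<open>Adjoints of resolvents; conditions (iii) and (iv)\<close>

lemma adjoint_eqI:
  assumes "bounded_op (D :: 'h::complex_hilbert \<Rightarrow> 'h)" "\<And>x y. cinner (S x) y = cinner x (D y)"
  shows "adjoint_op D = S"
proof
  show "adjoint_op D x = S x" for x
    by (rule cinner_extensionality, subst (1 2) cinner_commute)
      (simp add: cinner_adjoint[OF assms(1)] assms(2))
qed

lemma id_minus_adjoint:
  assumes "bounded_op (T :: 'h::complex_hilbert \<Rightarrow> 'h)"
  shows "id_minus (cnj z) (adjoint_op T) = adjoint_op (id_minus z T)"
  by (rule adjoint_eqI[symmetric, OF bounded_op_id_minus[OF assms]])
    (simp add: id_minus_def cinner_simps cinner_adjoint[OF assms])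

lemma inv_adjoint:
  assumes D: "invertible_op (D :: 'h::complex_hilbert \<Rightarrow> 'h)"
  shows "inv (adjoint_op D) = adjoint_op (inv D)"
proof -
  have b: "bounded_op D" "bounded_op (inv D)"
    using D by (simp_all add: invertible_op_def bounded_op_inv[OF D])
  have inv: "D (inv D x) = x" "inv D (D x) = x" for x
    using invertible_op_bij[OF D] by (simp_all add: bij_is_surj surj_f_inv_f bij_is_inj)
  have "adjoint_op D \<circ> adjoint_op (inv D) = id"
    by (rule ext, rule cinner_extensionality) (simp add: cinner_adjoint_right b inv)
  moreover have "adjoint_op (inv D) \<circ> adjoint_op D = id"
    by (rule ext, rule cinner_extensionality) (simp add: cinner_adjoint_right b inv)
  ultimately show ?thesis
    by (intro inv_unique_comp)
qed

lemma resolvent_positive_invertible: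
  assumes A: "bounded_op A" and T: "bounded_op T" and pos: "resolvent_positive A T"
    and z: "cmod z < 1"
  shows "invertible_op (id_minus z T)"
proof -
  obtain c where "c > 0" "\<And>w h. cmod w \<le> cmod z \<Longrightarrow> c * norm h \<le> norm (id_minus w T h)"
    using resolvent_positive_bounded_below[OF A T pos z] by blast
  then show ?thesis
    using invertible_id_minus[OF T, of c "cmod z" z] by simp
qed

text \<open>Substitute \<open>y = (I - zT) h\<close>. On the diagonal the two inverses contribute
  conjugate numbers, which add up to the term \<open>2 Re\<close> of (iv); bijectivity of
  \<open>I - zT\<close> lets \<open>y\<close> range over everything.\<close>

lemma resolvent_positive_iff_inverse:
  assumes A: "positive_op A" and T: "bounded_op T"
  shows "resolvent_positive A T \<longleftrightarrow> (\<forall>z. cmod z < 1 \<longrightarrow>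
    invertible_op (id_minus z T) \<and>
    positive_op (\<lambda>h. inv (id_minus z T) h
      + inv (id_minus (cnj z) (adjoint_op T)) h + A h - 2 *\<^sub>C h))" (is "?L \<longleftrightarrow> ?R")
proof -
  note bA = positive_op_bounded[OF A]
  define P where "P = (\<lambda>z h. inv (id_minus z T) h
      + inv (id_minus (cnj z) (adjoint_op T)) h + A h - 2 *\<^sub>C h)"
  have P: "cinner y (P z y)
      = complex_of_real (Re (cinner y (A y)) - 2 * (norm y)\<^sup>2 + 2 * Re (cinner (inv (id_minus z T) y) y))"
    if inv: "invertible_op (id_minus z T)" for z y
  proof -
    have "cinner y (inv (id_minus (cnj z) (adjoint_op T)) y) = cinner (inv (id_minus z T) y) y"
      by (simp add: id_minus_adjoint[OF T] inv_adjoint[OF inv]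
          cinner_adjoint_right[OF bounded_op_inv[OF inv]])
    moreover have "cinner y (inv (id_minus z T) y) = cnj (cinner (inv (id_minus z T) y) y)"
      by (rule cinner_commute)
    ultimately show ?thesis
      unfolding P_def using positive_op_Im[OF A, of y]
      by (simp add: cinner_simps cinner_self complex_eq_iff)
  qed
  have bP: "bounded_op (P z)" if inv: "invertible_op (id_minus z T)" for z
    unfolding P_def id_minus_adjoint[OF T] inv_adjoint[OF inv]
    using bounded_op_scale[OF bounded_op_id, of 2]
    by (intro bounded_op_minus bounded_op_plus bounded_op_inv[OF inv] bA
        bounded_op_adjoint[OF bounded_op_inv[OF inv]]) simp
  show ?thesis
  proof
    assume L: ?L
    show ?R
    proof (intro allI impI)
      fix z assume z: "cmod z < 1"
      have inv: "invertible_op (id_minus z T)"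
        by (rule resolvent_positive_invertible[OF bA T L z])
      have "id_minus z T (inv (id_minus z T) y) = y" for y
        using invertible_op_bij[OF inv] by (simp add: bij_is_surj surj_f_inv_f)
      then have "0 \<le> Re (cinner y (A y)) - 2 * (norm y)\<^sup>2 + 2 * Re (cinner (inv (id_minus z T) y) y)" for y
        using L z unfolding resolvent_positive_def by metis
      then have "positive_op (P z)"
        using bP[OF inv] by (auto simp only: positive_op_def P[OF inv] nonneg_Reals_of_real_iff)
      then show "invertible_op (id_minus z T) \<and> positive_op (\<lambda>h. inv (id_minus z T) h
          + inv (id_minus (cnj z) (adjoint_op T)) h + A h - 2 *\<^sub>C h)"
        using inv by (simp add: P_def)
    qed
  next
    assume R: ?R
    show ?L
      unfolding resolvent_positive_def
    proof (intro allI impI)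
      fix z h assume z: "cmod z < 1"
      then have inv: "invertible_op (id_minus z T)" and pos: "positive_op (P z)"
        using R by (auto simp: P_def)
      have "inv (id_minus z T) (id_minus z T h) = h"
        using invertible_op_bij[OF inv] by (simp add: bij_is_inj)
      then show "0 \<le> Re (cinner (id_minus z T h) (A (id_minus z T h))) - 2 * (norm (id_minus z T h))\<^sup>2
         + 2 * Re (cinner h (id_minus z T h))"
        using positive_op_Re[OF pos, of "id_minus z T h"] by (simp only: P[OF inv] Re_complex_of_real)
    qed
  qed
qed

section \<open>The Toeplitz kernel\<close>

text \<open>For negative \<open>n\<close> the powers act on the left argument, in place of the
  powers of the adjoint in \<open>zeta\<close>.\<close>

definition kern :: "('h::complex_hilbert \<Rightarrow> 'h) \<Rightarrow> ('h \<Rightarrow> 'h) \<Rightarrow> int \<Rightarrow> 'h \<Rightarrow> 'h \<Rightarrow> complex" where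
  "kern A T n x y =
     (if n = 0 then cinner x (A y)
      else if n > 0 then cinner x ((T ^^ nat n) y)
      else cinner ((T ^^ nat (- n)) x) y)"

lemma cinner_zeta:
  assumes A: "positive_op A" "invertible_op A" and T: "bounded_op T"
  shows "cinner x (zeta A T n y) = kern A T n (inv_sqrt_op A x) (inv_sqrt_op A y)"
  by (simp add: zeta_def kern_def cinner_inv_sqrt_op[OF A] cinner_adjoint_funpow[OF T]
      inv_sqrt_op_selfadjoint[OF A, symmetric])

lemma bounded_zeta:
  assumes A: "positive_op A" "invertible_op A" and T: "bounded_op T"
  shows "bounded_op (zeta A T n)"
  unfolding zeta_def
  by (simp add: bounded_op_comp bounded_op_funpow bounded_inv_sqrt_op[OF A] T bounded_op_adjoint
      bounded_op_id)

lemma kern_commute: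
  assumes "positive_op A"
  shows "kern A T n x y = cnj (kern A T (- n) y x)"
proof -
  have "cnj (cinner u v) = cinner v u" for u v :: 'a
    by (rule cinner_commute[symmetric])
  then show ?thesis
    by (simp add: kern_def positive_op_selfadjoint[OF assms])
qed

text \<open>\<open>inv_sqrt_op A\<close> is surjective, with \<open>sqrt_op A x\<close> as preimage
  of \<open>x\<close>, so the conjugation disappears under the quantifier over vectors.\<close>

lemma positive_toeplitz_sums_iff:
  assumes A: "positive_op A" "invertible_op A" and T: "bounded_op T"
  shows "positive_op (\<lambda>h. \<Sum>l=0..N. \<Sum>k=0..N. (cnj (c l) * c k) *\<^sub>C zeta A T (int k - int l) h)
    \<longleftrightarrow> (\<forall>x. (\<Sum>l=0..N. \<Sum>k=0..N. (cnj (c l) * c k) * kern A T (int k - int l) x x) \<in> \<real>\<^sub>\<ge>\<^sub>0)"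
    (is "positive_op ?P \<longleftrightarrow> (\<forall>x. ?S x \<in> _)")
proof -
  have "bounded_op ?P"
    by (intro bounded_op_sum_op bounded_op_scale bounded_zeta assms)
  moreover have "cinner h (?P h) = ?S (inv_sqrt_op A h)" for h
    by (simp add: cinner_sum_right cinner_scaleC_right cinner_zeta[OF assms])
  ultimately have "positive_op ?P \<longleftrightarrow> (\<forall>h. ?S (inv_sqrt_op A h) \<in> \<real>\<^sub>\<ge>\<^sub>0)"
    by (simp only: positive_op_def simp_thms)
  also have "\<dots> \<longleftrightarrow> (\<forall>x. ?S x \<in> \<real>\<^sub>\<ge>\<^sub>0)"
  proof (intro iffI allI)
    fix x
    assume "\<forall>h. ?S (inv_sqrt_op A h) \<in> \<real>\<^sub>\<ge>\<^sub>0"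
    from this[rule_format, of "sqrt_op A x"] show "?S x \<in> \<real>\<^sub>\<ge>\<^sub>0"
      by (simp only: inv_sqrt_op_sqrt_op[OF A])
  qed blast
  finally show ?thesis .
qed

section \<open>From Toeplitz sums to the resolvent\<close>

lemma polarization_bound:
  assumes T: "bounded_op T" and C: "\<And>x. cmod (cinner x (T x)) \<le> Q x"
  shows "4 * cmod (cinner x (T y)) \<le> Q (x + y) + Q (x - y) + Q (x + \<i> *\<^sub>C y) + Q (x - \<i> *\<^sub>C y)"
proof -
  let ?q = "\<lambda>x. cinner x (T x)"
  have "4 * cinner x (T y) = ?q (x + y) - ?q (x - y)
      - \<i> * (?q (x + \<i> *\<^sub>C y) - ?q (x - \<i> *\<^sub>C y))"
    by (simp add: bounded_op_add[OF T] bounded_op_diff[OF T] bounded_op_scaleC[OF T] cinner_simps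
        algebra_simps)
  then have "cmod (4 * cinner x (T y)) \<le> cmod (?q (x + y) - ?q (x - y))
      + cmod (\<i> * (?q (x + \<i> *\<^sub>C y) - ?q (x - \<i> *\<^sub>C y)))"
    by (simp only: norm_triangle_ineq4)
  also have "\<dots> \<le> (Q (x + y) + Q (x - y)) + (Q (x + \<i> *\<^sub>C y) + Q (x - \<i> *\<^sub>C y))"
    unfolding norm_mult norm_ii mult_1
    by (intro add_mono order_trans[OF norm_triangle_ineq4] C)
  finally show ?thesis
    by (simp add: norm_mult)
qed

text \<open>A 2 by 2 principal minor: with coefficient 1 at index 0, \<open>t\<close> at index
  \<open>n\<close> and 0 elsewhere, the Toeplitz sum is a quadratic in \<open>t\<close>. The
  resulting bound does not depend on \<open>n\<close>.\<close>

lemma toeplitz_power_bound: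
  assumes A: "positive_op A"
    and pos: "\<And>N c x. (\<Sum>l=0..N::nat. \<Sum>k=0..N::nat. (cnj (c l) * c k) * kern A T (int k - int l) x x) \<in> \<real>\<^sub>\<ge>\<^sub>0"
    and n: "n > 0"
  shows "cmod (cinner x ((T ^^ n) x)) \<le> Re (cinner x (A x))"
proof -
  define a where "a = Re (cinner x (A x))"
  define b where "b = cinner x ((T ^^ n) x)"
  have a: "cinner x (A x) = complex_of_real a"
    using positive_op_Im[OF A, of x] by (simp add: a_def complex_eq_iff)
  have "0 \<le> a + 2 * Re (t * b) + (cmod t)\<^sup>2 * a" for t
  proof -
    define c where "c = (\<lambda>k. if k = 0 then 1 else if k = n then t else 0)"
    define f where "f = (\<lambda>l k. (cnj (c l) * c k) * kern A T (int k - int l) x x)"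
    have red: "(\<Sum>k=0..n. g k) = g 0 + g n" if "\<And>k. k \<noteq> 0 \<Longrightarrow> k \<noteq> n \<Longrightarrow> g k = (0::complex)" for g
    proof -
      have "(\<Sum>k=0..n. g k) = (\<Sum>k\<in>{0,n}. g k)"
        using that by (intro sum.mono_neutral_right) auto
      then show ?thesis
        using n by simp
    qed
    have "(\<Sum>l=0..n. \<Sum>k=0..n. f l k) = (\<Sum>l=0..n. f l 0 + f l n)"
      by (intro sum.cong refl red) (simp add: f_def c_def)
    also have "\<dots> = f 0 0 + f 0 n + (f n 0 + f n n)"
      by (rule red) (simp add: f_def c_def)
    also have "\<dots> = a + t * b + cnj (t * b) + cnj t * t * a"
      using n by (simp add: f_def c_def kern_def a b_def) (metis cinner_commute)
    also have "cnj t * t = complex_of_real ((cmod t)\<^sup>2)"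
      using complex_norm_square[of t] by (simp add: mult.commute)
    finally have "Re (\<Sum>l=0..n. \<Sum>k=0..n. f l k) = a + 2 * Re (t * b) + (cmod t)\<^sup>2 * a"
      by simp
    then show ?thesis
      using pos[where N=n and c=c and x=x] by (simp add: f_def complex_nonneg_Reals_iff)
  qed
  then have "(cmod b)\<^sup>2 \<le> a * a"
    by (rule complex_quadratic_nonneg_discriminant)
  moreover have "a \<ge> 0"
    using positive_op_Re[OF A] by (simp add: a_def)
  ultimately show ?thesis
    by (metis a_def b_def power2_eq_square power2_le_imp_le)
qed

text \<open>Raising both indices by one leaves \<open>a (int k - int l)\<close> unchanged and
  multiplies the coefficients by \<open>cnj z * z\<close>. What remains is the row and the column of
  index 0, conjugate to each other.\<close>

lemma toeplitz_sum_Suc: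
  fixes a :: "int \<Rightarrow> complex"
  assumes "\<And>n. a (- n) = cnj (a n)"
  shows "(\<Sum>l=0..Suc N. \<Sum>k=0..Suc N. (cnj (z ^ l) * z ^ k) * a (int k - int l))
    = cnj z * z * (\<Sum>l=0..N. \<Sum>k=0..N. (cnj (z ^ l) * z ^ k) * a (int k - int l))
      + a 0 + (\<Sum>k=0..N. z ^ Suc k * a (int (Suc k))) + cnj (\<Sum>k=0..N. z ^ Suc k * a (int (Suc k)))"
proof -
  have neg: "a (- 1 - int l) = cnj (a (1 + int l))" for l
    using assms[of "1 + int l"] by simp
  show ?thesis
    unfolding sum.atLeast0_atMost_Suc_shift
    by (simp add: sum.distrib sum_distrib_left mult_ac neg)
qed

lemma sum_power_id_minus:
  assumes "bounded_op (T :: 'h::complex_hilbert \<Rightarrow> 'h)"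
  shows "(\<Sum>k=0..N. z ^ Suc k *\<^sub>C (T ^^ Suc k) (id_minus z T h))
    = z *\<^sub>C T h - z ^ (N + 2) *\<^sub>C (T ^^ (N + 2)) h"
proof (induction N)
  case 0
  show ?case
    by (simp add: id_minus_def bounded_op_diff[OF assms] bounded_op_scaleC[OF assms]
        scaleC_diff_right scaleC_scaleC)
next
  case (Suc N)
  have "z ^ Suc (Suc N) *\<^sub>C (T ^^ Suc (Suc N)) (id_minus z T h)
      = z ^ (N + 2) *\<^sub>C (T ^^ (N + 2)) h - z ^ (Suc N + 2) *\<^sub>C (T ^^ (Suc N + 2)) h"
    by (simp add: id_minus_def bounded_op_diff[OF bounded_op_funpow[OF assms]]
        bounded_op_diff[OF assms] bounded_op_scaleC[OF bounded_op_funpow[OF assms]]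
        bounded_op_scaleC[OF assms] scaleC_diff_right scaleC_scaleC funpow_swap1 mult_ac)
  then show ?case
    using Suc.IH by simp
qed

lemma limit_nonneg_of_recurrence:
  fixes D F :: "nat \<Rightarrow> real"
  assumes D: "\<And>N. D N \<ge> 0" "\<And>N. D (Suc N) = s * D N + F N" and s: "s \<le> 1"
    and F: "F \<longlonglongrightarrow> L"
  shows "L \<ge> 0"
proof (rule ccontr)
  assume "\<not> L \<ge> 0"
  then have L: "L < L / 2" "L / 2 < 0"
    by auto
  have "\<forall>\<^sub>F N in sequentially. F N < L / 2"
    using order_tendstoD(2)[OF F L(1)] .
  then obtain M where M: "\<And>N. N \<ge> M \<Longrightarrow> F N < L / 2"
    by (auto simp: eventually_sequentially)
  have dec: "D (M + k) \<le> D M + real k * (L / 2)" for k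
  proof (induction k)
    case (Suc k)
    have "s * D (M + k) \<le> 1 * D (M + k)"
      using s D(1) by (intro mult_right_mono) auto
    moreover have "real (Suc k) * (L / 2) = real k * (L / 2) + L / 2"
      by (simp add: algebra_simps add_divide_distrib)
    ultimately show ?case
      unfolding add_Suc_right using Suc M[of "M + k"] D(2)[of "M + k"] by linarith
  qed simp
  obtain k where "D M / (- L / 2) < real k"
    using reals_Archimedean2 by blast
  then have "D M + real k * (L / 2) < 0"
    using L(2) by (simp add: field_simps)
  then show False
    using dec[of k] D(1)[of "M + k"] by linarith
qed

text \<open>With \<open>c\<^sub>k = z\<^sup>k\<close> the Toeplitz sums satisfy \<open>D\<^sub>N\<^sub>+\<^sub>1 = \<bar>z\<bar>\<^sup>2 D\<^sub>N + F\<^sub>N\<close> where \<open>F\<^sub>N\<close> are the partial sums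
  of \<open>Re \<langle>y, Ay\<rangle> + 2 Re (\<Sum>k\<ge>1. z\<^sup>k \<langle>y, T\<^sup>k y\<rangle>)\<close>; for \<open>y = (I - zT)h\<close> that series telescopes.\<close>

lemma toeplitz_imp_resolvent_positive:
  fixes T :: "'h::complex_hilbert \<Rightarrow> 'h"
  assumes A: "positive_op A" and T: "bounded_op T"
    and pos: "\<And>N c x. (\<Sum>l=0..N::nat. \<Sum>k=0..N::nat. (cnj (c l) * c k) * kern A T (int k - int l) x x) \<in> \<real>\<^sub>\<ge>\<^sub>0"
  shows "resolvent_positive A T"
  unfolding resolvent_positive_def
proof (intro allI impI)
  fix z :: complex and h :: 'h
  assume z: "cmod z < 1"
  define y where "y = id_minus z T h"
  define a where "a = (\<lambda>n. kern A T n y y)"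
  define D where "D = (\<lambda>N. \<Sum>l=0..N::nat. \<Sum>k=0..N::nat. (cnj (z ^ l) * z ^ k) * a (int k - int l))"
  define G where "G = (\<lambda>N. \<Sum>k=0..N::nat. z ^ Suc k * a (int (Suc k)))"
  have "a (- n) = cnj (a n)" for n
    unfolding a_def using kern_commute[OF A, of T "- n" y y] by simp
  then have "D (Suc N) = cnj z * z * D N + a 0 + G N + cnj (G N)" for N
    unfolding D_def G_def by (rule toeplitz_sum_Suc)
  moreover have "cnj z * z = complex_of_real ((cmod z)\<^sup>2)"
    using complex_norm_square[of z] by (simp add: mult.commute)
  ultimately have rec: "Re (D (Suc N)) = (cmod z)\<^sup>2 * Re (D N) + (Re (a 0) + 2 * Re (G N))" for N
    by simp
  have D0: "0 \<le> Re (D N)" for N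
    using pos[where N=N and c="\<lambda>k. z ^ k" and x=y] by (simp add: D_def a_def complex_nonneg_Reals_iff)
  have G: "G N = cinner y (z *\<^sub>C T h) - z ^ (N + 2) * cinner y ((T ^^ (N + 2)) h)" for N
  proof -
    have "G N = cinner y (\<Sum>k=0..N. z ^ Suc k *\<^sub>C (T ^^ Suc k) y)"
      unfolding cinner_sum_right by (simp add: G_def a_def kern_def cinner_scaleC_right nat_add_distrib)
    then show ?thesis
      unfolding y_def sum_power_id_minus[OF T] by (simp only: cinner_diff_right cinner_scaleC_right)
  qed
  \<comment> \<open>The remainder of the telescoping sum has to vanish although no norm bound on the
    powers is at hand: the diagonal bounds from (ii) are uniform in the exponent, and polarization
    carries this over to the pair \<open>y\<close>, \<open>h\<close>.\<close>
  obtain C where C: "\<And>N. cmod (cinner y ((T ^^ (N + 2)) h)) \<le> C"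
  proof -
    have "4 * cmod (cinner y ((T ^^ (N + 2)) h)) \<le> Re (cinner (y + h) (A (y + h)))
        + Re (cinner (y - h) (A (y - h))) + Re (cinner (y + \<i> *\<^sub>C h) (A (y + \<i> *\<^sub>C h)))
        + Re (cinner (y - \<i> *\<^sub>C h) (A (y - \<i> *\<^sub>C h)))" for N
      by (rule polarization_bound[OF bounded_op_funpow[OF T]], rule toeplitz_power_bound[OF A pos]) simp
    then show ?thesis
      using that by (metis divide_right_mono mult.commute nonzero_mult_div_cancel_right zero_le_numeral
          zero_neq_numeral)
  qed
  have "(\<lambda>N. z ^ (N + 2) * cinner y ((T ^^ (N + 2)) h)) \<longlonglongrightarrow> 0"
  proof (rule Lim_null_comparison)
    show "\<forall>\<^sub>F N in sequentially. norm (z ^ (N + 2) * cinner y ((T ^^ (N + 2)) h)) \<le> cmod z ^ (N + 2) * C"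
      by (intro always_eventually allI) (simp only: norm_mult norm_power mult_left_mono C zero_le_power norm_ge_zero)
    have "(\<lambda>N. cmod z ^ (N + 2)) \<longlonglongrightarrow> 0"
      using z by (intro LIMSEQ_ignore_initial_segment LIMSEQ_power_zero) simp
    then show "(\<lambda>N. cmod z ^ (N + 2) * C) \<longlonglongrightarrow> 0"
      using tendsto_mult_left_zero by blast
  qed
  then have "(\<lambda>N. Re (a 0) + 2 * Re (G N)) \<longlonglongrightarrow> Re (a 0) + 2 * Re (cinner y (z *\<^sub>C T h) - 0)"
    unfolding G by (intro tendsto_intros)
  then have "0 \<le> Re (a 0) + 2 * Re (cinner y (z *\<^sub>C T h))"
    using limit_nonneg_of_recurrence[where D="\<lambda>N. Re (D N)", OF D0 rec] z by (simp add: power_le_one)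
  moreover have "z *\<^sub>C T h = h - y"
    by (simp add: y_def id_minus_def)
  moreover have "Re (cinner h y) = Re (cinner y h)"
    by (metis inner_commute inner_eq_Re_cinner)
  ultimately show "0 \<le> Re (cinner (id_minus z T h) (A (id_minus z T h))) - 2 * (norm (id_minus z T h))\<^sup>2
         + 2 * Re (cinner h (id_minus z T h))"
    by (simp add: y_def[symmetric] a_def kern_def cinner_diff_right cinner_self)
qed

section \<open>Positivity of the Toeplitz kernel\<close>

text \<open>A geometric sum with ratio an \<open>M\<close>-th root of unity. The ratio is not 1
  because no nonzero multiple of \<open>M\<close> is smaller than \<open>M\<close> in absolute
  value.\<close>

lemma sum_cis_roots_of_unity:
  fixes m :: int
  assumes "\<bar>m\<bar> < int M"
  shows "(\<Sum>j<M. cis (of_int m * (2 * pi * real j / real M))) = (if m = 0 then of_nat M else 0)"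
proof (cases "m = 0")
  case False
  have M: "M > 0"
    using assms by (cases M) auto
  define w where "w = cis (of_int m * (2 * pi) / real M)"
  have "w \<noteq> 1"
  proof
    assume "w = 1"
    then obtain k :: int where "of_int m * (2 * pi) / real M = of_int k * (2 * pi)"
      unfolding w_def cis_eq_1_iff by blast
    then have "real_of_int m = of_int k * real M"
      using M by (simp add: field_simps)
    then have "m = k * int M"
      by (metis of_int_eq_iff of_int_mult of_int_of_nat_eq)
    then have "\<bar>m\<bar> = \<bar>k\<bar> * int M"
      by (simp add: abs_mult)
    moreover have "k \<noteq> 0"
      using False \<open>m = k * int M\<close> by auto
    then have "1 * int M \<le> \<bar>k\<bar> * int M"
      by (intro mult_right_mono) auto
    ultimately show False
      using assms by simp
  qed
  have "w ^ M = cis (2 * pi * of_int m)"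
    using M by (simp add: w_def Complex.DeMoivre mult.commute)
  also have "\<dots> = 1"
    unfolding cis_eq_1_iff by (intro exI[of _ m]) simp
  finally have "(\<Sum>j<M. w ^ j) = 0"
    using \<open>w \<noteq> 1\<close> by (simp add: sum_gp_strict)
  moreover have "cis (of_int m * (2 * pi * real j / real M)) = w ^ j" for j
    by (simp add: w_def Complex.DeMoivre mult_ac)
  ultimately show ?thesis
    using False by simp
qed simp

section \<open>The weak power series of the resolvent\<close>

lemma resolvent_identity:
  assumes T: "bounded_op (T :: 'h::complex_hilbert \<Rightarrow> 'h)"
    and z: "invertible_op (id_minus z T)" and w: "invertible_op (id_minus w T)"
  shows "inv (id_minus z T) v - inv (id_minus w T) v
    = (z - w) *\<^sub>C inv (id_minus z T) (T (inv (id_minus w T) v))"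
proof -
  note bz = bounded_op_inv[OF z]
  define u where "u = inv (id_minus w T) v"
  have iz: "inv (id_minus z T) (id_minus z T x) = x" for x
    using invertible_op_bij[OF z] by (simp add: bij_is_inj)
  have "id_minus w T u = v"
    using invertible_op_bij[OF w] by (simp add: u_def bij_is_surj surj_f_inv_f)
  then have v: "v = id_minus z T u + (z - w) *\<^sub>C T u"
    by (simp add: id_minus_def scaleC_diff_left)
  show ?thesis
    unfolding u_def[symmetric] by (subst v) (simp add: bounded_op_add[OF bz] bounded_op_scaleC[OF bz] iz)
qed

lemma resolvent_locally_bounded:
  fixes T :: "'h::complex_hilbert \<Rightarrow> 'h"
  assumes A: "bounded_op A" and T: "bounded_op T" and pos: "resolvent_positive A T" and r: "r < 1"
  obtains C where "C > 0" "\<And>z v. cmod z \<le> r \<Longrightarrow> norm (inv (id_minus z T) v) \<le> C * norm v"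
proof -
  obtain c where c: "c > 0" "\<And>z h. cmod z \<le> r \<Longrightarrow> c * norm h \<le> norm (id_minus z T h)"
    using resolvent_positive_bounded_below[OF A T pos r] by blast
  have "norm (inv (id_minus z T) v) \<le> 1 / c * norm v" if z: "cmod z \<le> r" for z v
  proof -
    have "id_minus z T (inv (id_minus z T) v) = v"
      using invertible_op_bij[OF resolvent_positive_invertible[OF A T pos, of z]] z r
      by (simp add: bij_is_surj surj_f_inv_f)
    then show ?thesis
      using c(2)[OF z, of "inv (id_minus z T) v"] c(1) by (simp add: field_simps)
  qed
  then show ?thesis
    using that[of "1 / c"] c(1) by simp
qed

lemma resolvent_tendsto:
  fixes T :: "'h::complex_hilbert \<Rightarrow> 'h"
  assumes A: "bounded_op A" and T: "bounded_op T" and pos: "resolvent_positive A T" and w: "cmod w < 1"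
  shows "((\<lambda>z. inv (id_minus z T) v) \<longlongrightarrow> inv (id_minus w T) v) (at w)"
proof -
  define r where "r = (1 + cmod w) / 2"
  have r: "r < 1" "cmod w < r"
    using w by (simp_all add: r_def)
  obtain C where C: "C > 0" "\<And>z v. cmod z \<le> r \<Longrightarrow> norm (inv (id_minus z T) v) \<le> C * norm v"
    using resolvent_locally_bounded[OF A T pos r(1)] by blast
  have "((\<lambda>z. inv (id_minus z T) v - inv (id_minus w T) v) \<longlongrightarrow> 0) (at w)"
  proof (rule Lim_null_comparison)
    have "\<forall>\<^sub>F z in at w. cmod z < r"
      by (rule order_tendstoD(2)[OF _ r(2)]) (intro tendsto_intros)
    then show "\<forall>\<^sub>F z in at w. norm (inv (id_minus z T) v - inv (id_minus w T) v)
        \<le> cmod (z - w) * (C * norm (T (inv (id_minus w T) v)))"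
    proof eventually_elim
      case (elim z)
      have "invertible_op (id_minus z T)" "invertible_op (id_minus w T)"
        using resolvent_positive_invertible[OF A T pos] elim r w by auto
      then show ?case
        using C(2)[of z] elim by (simp add: resolvent_identity[OF T] norm_scaleC mult_left_mono)
    qed
    have "((\<lambda>z. cmod (z - w) * (C * norm (T (inv (id_minus w T) v))))
        \<longlongrightarrow> cmod (w - w) * (C * norm (T (inv (id_minus w T) v)))) (at w)"
      by (intro tendsto_intros)
    then show "((\<lambda>z. cmod (z - w) * (C * norm (T (inv (id_minus w T) v)))) \<longlongrightarrow> 0) (at w)"
      by simp
  qed
  then show ?thesis
    by (rule LIM_zero_cancel)
qed

text \<open>By the resolvent identity the difference quotient at \<open>w\<close> is the matrix
  element of \<open>R(z) T R(w)\<close>, where \<open>R\<close> is the resolvent; its limit is given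
  by strong continuity.\<close>

lemma resolvent_holomorphic:
  fixes T :: "'h::complex_hilbert \<Rightarrow> 'h"
  assumes A: "bounded_op A" and T: "bounded_op T" and pos: "resolvent_positive A T"
  shows "(\<lambda>z. cinner x (inv (id_minus z T) y)) holomorphic_on ball 0 1"
proof -
  define f where "f = (\<lambda>z. cinner x (inv (id_minus z T) y))"
  have "(f has_field_derivative
      cinner x (inv (id_minus w T) (T (inv (id_minus w T) y)))) (at w)" if w: "cmod w < 1" for w
    unfolding has_field_derivative_iff
  proof (rule Lim_transform_eventually)
    let ?g = "\<lambda>z. cinner x (inv (id_minus z T) (T (inv (id_minus w T) y)))"
    show "(?g \<longlongrightarrow> cinner x (inv (id_minus w T) (T (inv (id_minus w T) y)))) (at w)"
      by (intro bounded_bilinear.tendsto[OF bounded_bilinear_cinner] tendsto_const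
          resolvent_tendsto[OF A T pos w])
    have "\<forall>\<^sub>F z in at w. cmod z < 1"
      by (rule order_tendstoD(2)[OF _ w]) (intro tendsto_intros)
    moreover have "\<forall>\<^sub>F z in at w. z \<noteq> w"
      by (simp add: eventually_at_filter)
    ultimately show "\<forall>\<^sub>F z in at w. ?g z = (f z - f w) / (z - w)"
    proof eventually_elim
      case (elim z)
      have "invertible_op (id_minus z T)" "invertible_op (id_minus w T)"
        using resolvent_positive_invertible[OF A T pos] elim w by auto
      then have "f z - f w = (z - w) * ?g z"
        by (simp add: f_def cinner_diff_right[symmetric] resolvent_identity[OF T] cinner_scaleC_right)
      then show ?case
        using elim by simp
    qed
  qed
  then have "f holomorphic_on ball 0 1"
    unfolding holomorphic_on_def field_differentiable_def
    by (metis has_field_derivative_at_within mem_ball_0)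
  then show ?thesis
    by (simp add: f_def)
qed

text \<open>The Neumann series converges weakly on the whole disc, not only where \<open>\<parallel>zT\<parallel> < 1\<close>: the resolvent
  is holomorphic there, and \<open>R(z)y = y + z R(z)Ty\<close> identifies its Taylor coefficients.\<close>

lemma resolvent_sums:
  fixes T :: "'h::complex_hilbert \<Rightarrow> 'h"
  assumes A: "bounded_op A" and T: "bounded_op T" and pos: "resolvent_positive A T" and z: "cmod z < 1"
  shows "(\<lambda>n. cinner x ((T ^^ n) y) * z ^ n) sums cinner x (inv (id_minus z T) y)"
proof -
  define f where "f = (\<lambda>y z. cinner x (inv (id_minus z T) y))"
  define F where "F = (\<lambda>y. fps_expansion (f y) 0)"
  have hol: "f y holomorphic_on ball 0 1" for y
    unfolding f_def by (rule resolvent_holomorphic[OF A T pos])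
  have F: "f y has_fps_expansion F y" for y
    unfolding F_def by (rule has_fps_expansion_fps_expansion[OF open_ball _ hol]) simp
  have id0: "id_minus 0 T = id"
    by (simp add: id_minus_def fun_eq_iff)
  have rec: "f y w = cinner x y + w * f (T y) w" if w: "cmod w < 1" for y w
  proof -
    have "invertible_op (id_minus w T)" "invertible_op (id_minus 0 T)"
      using resolvent_positive_invertible[OF A T pos] w by auto
    from resolvent_identity[OF T this, of y]
    have "inv (id_minus w T) y = y + w *\<^sub>C inv (id_minus w T) (T y)"
      by (simp add: id0 algebra_simps)
    then show ?thesis
      by (simp add: f_def cinner_simps)
  qed
  have F_rec: "F y = fps_const (cinner x y) + fps_X * F (T y)" for y
  proof (rule fps_expansion_unique_complex[OF F])
    have "(\<lambda>w. cinner x y + w * f (T y) w) has_fps_expansion fps_const (cinner x y) + fps_X * F (T y)"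
      by (rule has_fps_expansion_add[OF has_fps_expansion_const
            has_fps_expansion_mult[OF has_fps_expansion_fps_X F]])
    moreover have "\<forall>\<^sub>F w in nhds 0. f y w = cinner x y + w * f (T y) w"
      by (rule eventually_mono[OF eventually_nhds_in_open[of "ball 0 1"]], simp, simp) (rule rec, simp)
    ultimately show "f y has_fps_expansion fps_const (cinner x y) + fps_X * F (T y)"
      using has_fps_expansion_cong[OF _ refl, of "f y"] by simp
  qed
  have coeff: "fps_nth (F y) 0 = cinner x y" "fps_nth (F y) (Suc n) = fps_nth (F (T y)) n" for y n
    by (subst F_rec, simp)+
  have "fps_nth (F y) n = cinner x ((T ^^ n) y)" for n y
    by (induction n arbitrary: y) (simp_all add: coeff funpow_swap1)
  then have "(deriv ^^ n) (f y) 0 / fact n = cinner x ((T ^^ n) y)" for n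
    by (simp add: F_def fps_expansion_def)
  then show ?thesis
    using holomorphic_power_series[OF hol, of z y] z by (simp add: f_def)
qed

lemma summable_resolvent_coeffs:
  fixes T :: "'h::complex_hilbert \<Rightarrow> 'h"
  assumes A: "bounded_op A" and T: "bounded_op T" and pos: "resolvent_positive A T"
    and r: "0 \<le> r" "r < 1"
  shows "summable (\<lambda>n. r ^ n * cmod (cinner x ((T ^^ n) y)))"
proof -
  \<comment> \<open>The midpoint between \<open>r\<close> and 1: convergence there gives absolute
    convergence at \<open>r\<close>.\<close>
  define s where "s = complex_of_real ((1 + r) / 2)"
  have s: "cmod s = (1 + r) / 2"
    using r unfolding s_def norm_of_real by simp
  have "summable (\<lambda>n. cmod (cinner x ((T ^^ n) y) * complex_of_real r ^ n))"
  proof (rule powser_insidea)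
    show "summable (\<lambda>n. cinner x ((T ^^ n) y) * s ^ n)"
      using resolvent_sums[OF A T pos, of s x y] s r sums_summable by auto
    show "cmod (complex_of_real r) < cmod s"
      using r by (simp add: s)
  qed
  then show ?thesis
    using r by (simp add: norm_mult norm_power mult.commute)
qed

section \<open>Averaging Poisson sums over roots of unity\<close>

text \<open>The zeroth term of the series of \<open>2 Re cinner y (R(z) y)\<close>, with
  \<open>R\<close> the resolvent, cancels \<open>- 2 * (norm y)^2\<close>, which leaves the
  truncated Poisson sum and twice a tail. The majorant \<open>b\<close> is a parameter so that one
  majorant can serve a whole family of vectors \<open>y\<close>.\<close>

lemma resolvent_positive_partial_sums:
  fixes T :: "'h::complex_hilbert \<Rightarrow> 'h"
  assumes A: "bounded_op A" and T: "bounded_op T" and pos: "resolvent_positive A T"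
    and z: "cmod z = r" "r < 1"
    and b: "summable b" "\<And>n. r ^ n * cmod (cinner y ((T ^^ n) y)) \<le> b n"
  shows "- 2 * (\<Sum>n. b (n + Suc L)) \<le> Re (cinner y (A y) + 2 * (\<Sum>n=1..L. z ^ n * cinner y ((T ^^ n) y)))"
proof -
  define g where "g = (\<lambda>n. cinner y ((T ^^ n) y) * z ^ n)"
  have inv: "invertible_op (id_minus z T)"
    using resolvent_positive_invertible[OF A T pos] z by simp
  have g: "g sums cinner y (inv (id_minus z T) y)"
    unfolding g_def using z by (intro resolvent_sums[OF A T pos]) simp
  have gb: "norm (g n) \<le> b n" for n
    using b(2)[of n] z by (simp add: g_def norm_mult norm_power mult.commute)
  have bL: "summable (\<lambda>n. b (n + Suc L))"
    using b(1) by (subst summable_iff_shift)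
  have "norm (\<Sum>n. g (n + Suc L)) \<le> (\<Sum>n. b (n + Suc L))"
    by (rule norm_suminf_le[OF gb bL])
  then have tail: "Re (\<Sum>n. g (n + Suc L)) \<le> (\<Sum>n. b (n + Suc L))"
    using complex_Re_le_cmod order_trans by blast
  have "cinner y (inv (id_minus z T) y) = (\<Sum>n. g (n + Suc L)) + (\<Sum>n<Suc L. g n)"
    using suminf_split_initial_segment[OF sums_summable[OF g], of "Suc L"] sums_unique[OF g] by simp
  moreover have "(\<Sum>n<Suc L. g n) = g 0 + (\<Sum>n=1..L. g n)"
    by (simp add: lessThan_Suc_atMost atMost_atLeast0 sum.atLeast_Suc_atMost)
  moreover have "g 0 = complex_of_real ((norm y)\<^sup>2)"
    by (simp add: g_def cinner_self)
  ultimately have R: "cinner y (inv (id_minus z T) y)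
      = (\<Sum>n. g (n + Suc L)) + complex_of_real ((norm y)\<^sup>2) + (\<Sum>n=1..L. g n)"
    by simp
  have "id_minus z T (inv (id_minus z T) y) = y"
    using invertible_op_bij[OF inv] by (simp add: bij_is_surj surj_f_inv_f)
  then have "0 \<le> Re (cinner y (A y)) - 2 * (norm y)\<^sup>2 + 2 * Re (cinner (inv (id_minus z T) y) y)"
    using pos z unfolding resolvent_positive_def by metis
  also have "Re (cinner (inv (id_minus z T) y) y) = Re (cinner y (inv (id_minus z T) y))"
    by (metis inner_commute inner_eq_Re_cinner)
  finally show ?thesis
    using tail by (simp add: R g_def mult.commute)
qed

text \<open>Half of the kernel, damped by powers of \<open>r\<close>: by hermitian symmetry the sums of \<open>kern\<close> are the
  real parts of the sums of \<open>half_kern\<close> at \<open>r = 1\<close>.\<close>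

definition half_kern :: "real \<Rightarrow> ('h::complex_hilbert \<Rightarrow> 'h) \<Rightarrow> ('h \<Rightarrow> 'h) \<Rightarrow> int \<Rightarrow> 'h \<Rightarrow> 'h \<Rightarrow> complex" where
  "half_kern r A T n x y =
     (if n = 0 then cinner x (A y)
      else if n > 0 then 2 * complex_of_real (r ^ nat n) * cinner x ((T ^^ nat n) y) else 0)"

lemma sum_kern_eq_Re_sum_half_kern:
  assumes A: "positive_op A"
  shows "(\<Sum>i\<in>I. \<Sum>j\<in>I. kern A T (n j - n i) (x i) (x j))
    = complex_of_real (Re (\<Sum>i\<in>I. \<Sum>j\<in>I. half_kern 1 A T (n j - n i) (x i) (x j)))"
proof -
  let ?k = "\<lambda>i j. kern A T (n j - n i) (x i) (x j)"
  let ?h = "\<lambda>i j. half_kern 1 A T (n j - n i) (x i) (x j)"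
  have flip: "cnj (cinner u v) = cinner v u" for u v :: 'a
    by (rule cinner_commute[symmetric])
  have "2 * ?k i j = ?h i j + cnj (?h j i)" for i j
    by (simp add: kern_def half_kern_def flip positive_op_selfadjoint[OF A])
  then have "2 * (\<Sum>i\<in>I. \<Sum>j\<in>I. ?k i j) = (\<Sum>i\<in>I. \<Sum>j\<in>I. ?h i j) + (\<Sum>i\<in>I. \<Sum>j\<in>I. cnj (?h j i))"
    by (simp add: sum_distrib_left sum.distrib)
  also have "(\<Sum>i\<in>I. \<Sum>j\<in>I. cnj (?h j i)) = cnj (\<Sum>i\<in>I. \<Sum>j\<in>I. ?h i j)"
    by (subst sum.swap) simp
  also have "(\<Sum>i\<in>I. \<Sum>j\<in>I. ?h i j) + cnj (\<Sum>i\<in>I. \<Sum>j\<in>I. ?h i j)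
      = 2 * complex_of_real (Re (\<Sum>i\<in>I. \<Sum>j\<in>I. ?h i j))"
    by (simp only: complex_add_cnj of_real_mult of_real_numeral)
  finally show ?thesis
    by simp
qed

text \<open>For the vectors \<open>y p\<close> and the points \<open>z p\<close> the truncated
  Poisson sum is a trigonometric polynomial in \<open>p\<close>, in which the term of
  \<open>i\<close>, \<open>j\<close>, \<open>k\<close> has frequency \<open>k + n i - n j\<close>.
  Averaging retains frequency 0, that is \<open>k = n j - n i\<close>, which is the term of
  \<open>half_kern\<close>. Truncation is what makes a finite average sufficient.\<close>

lemma sum_half_kern_lower_bound:
  fixes T :: "'h::complex_hilbert \<Rightarrow> 'h" and n :: "'i \<Rightarrow> int"
  assumes A: "bounded_op A" and T: "bounded_op T" and pos: "resolvent_positive A T"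
    and I: "finite I" and r: "0 \<le> r" "r < 1" and L: "\<And>i j. i \<in> I \<Longrightarrow> j \<in> I \<Longrightarrow> \<bar>n j - n i\<bar> \<le> int L"
  shows "- 2 * (\<Sum>k. \<Sum>i\<in>I. \<Sum>j\<in>I. r ^ (k + Suc L) * cmod (cinner (x i) ((T ^^ (k + Suc L)) (x j))))
    \<le> Re (\<Sum>i\<in>I. \<Sum>j\<in>I. half_kern r A T (n j - n i) (x i) (x j))"
proof -
  define b where "b = (\<lambda>k. \<Sum>i\<in>I. \<Sum>j\<in>I. r ^ k * cmod (cinner (x i) ((T ^^ k) (x j))))"
  have b: "summable b"
    unfolding b_def by (intro summable_sum summable_resolvent_coeffs[OF A T pos r])
  \<comment> \<open>The frequencies are at most \<open>2 * L\<close> in absolute value, so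
    \<open>2 * L + 1\<close> points separate all of them from 0.\<close>
  define M where "M = Suc (2 * L)"
  define \<theta> where "\<theta> = (\<lambda>p. 2 * pi * real p / real M)"
  define u where "u = (\<lambda>(m::int) p. cis (of_int m * \<theta> p))"
  define y where "y = (\<lambda>p. \<Sum>i\<in>I. u (- n i) p *\<^sub>C x i)"
  define z where "z = (\<lambda>p. complex_of_real r * u 1 p)"
  have u_mult: "u a p * u b p = u (a + b) p" for a b p
    by (simp add: u_def cis_mult algebra_simps)
  have u_cnj: "cnj (u a p) = u (- a) p" for a p
    by (simp add: u_def cis_cnj)
  have u_power: "u 1 p ^ k = u (int k) p" for k p
    by (simp only: u_def of_int_1 mult_1_left Complex.DeMoivre of_int_of_nat_eq)
  have nu: "cmod (u a p) = 1" for a p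
    by (simp add: u_def)
  have u_sum: "(\<Sum>p<M. u m p) = (if m = 0 then of_nat M else 0)" if "\<bar>m\<bar> \<le> 2 * int L" for m
    unfolding u_def \<theta>_def by (rule sum_cis_roots_of_unity) (use that in \<open>simp add: M_def\<close>)
  have expand: "cinner (y p) (S (y p)) = (\<Sum>i\<in>I. \<Sum>j\<in>I. u (n i - n j) p * cinner (x i) (S (x j)))"
    if S: "bounded_op S" for S p
  proof -
    have "cinner (y p) (S (y p))
        = (\<Sum>i\<in>I. \<Sum>j\<in>I. cinner (u (- n i) p *\<^sub>C x i) (u (- n j) p *\<^sub>C S (x j)))"
      unfolding y_def bounded_op_sum[OF S] bounded_op_scaleC[OF S] cinner_sum_left
      by (simp only: cinner_sum_right)
    also have "\<dots> = (\<Sum>i\<in>I. \<Sum>j\<in>I. (u (n i) p * u (- n j) p) * cinner (x i) (S (x j)))"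
      by (simp add: cinner_simps u_cnj mult_ac)
    finally show ?thesis
      by (simp add: u_mult)
  qed
  define P where "P = (\<lambda>p. cinner (y p) (A (y p)) + 2 * (\<Sum>k=1..L. z p ^ k * cinner (y p) ((T ^^ k) (y p))))"
  have lower: "- 2 * (\<Sum>k. b (k + Suc L)) \<le> Re (P p)" for p
    unfolding P_def
  proof (rule resolvent_positive_partial_sums[OF A T pos _ r(2) b])
    show "cmod (z p) = r"
      using r by (simp add: z_def norm_mult nu)
    show "r ^ k * cmod (cinner (y p) ((T ^^ k) (y p))) \<le> b k" for k
    proof -
      have "cmod (cinner (y p) ((T ^^ k) (y p))) \<le> (\<Sum>i\<in>I. \<Sum>j\<in>I. cmod (cinner (x i) ((T ^^ k) (x j))))"
        unfolding expand[OF bounded_op_funpow[OF T]]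
        by (intro sum_norm_le) (simp add: norm_mult nu)
      then have "r ^ k * cmod (cinner (y p) ((T ^^ k) (y p)))
          \<le> r ^ k * (\<Sum>i\<in>I. \<Sum>j\<in>I. cmod (cinner (x i) ((T ^^ k) (x j))))"
        using r(1) by (intro mult_left_mono) auto
      then show ?thesis
        by (simp add: b_def sum_distrib_left)
    qed
  qed
  have P_expand: "P p = (\<Sum>i\<in>I. \<Sum>j\<in>I. u (n i - n j) p * cinner (x i) (A (x j))
      + (\<Sum>k=1..L. u (int k + n i - n j) p * (2 * complex_of_real (r ^ k) * cinner (x i) ((T ^^ k) (x j)))))" for p
  proof -
    have "(\<Sum>k=1..L. z p ^ k * cinner (y p) ((T ^^ k) (y p)))
        = (\<Sum>k=1..L. \<Sum>i\<in>I. \<Sum>j\<in>I. u (int k + n i - n j) p * (complex_of_real (r ^ k) * cinner (x i) ((T ^^ k) (x j))))"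
    proof (intro sum.cong refl)
      fix k
      have "z p ^ k = complex_of_real (r ^ k) * u (int k) p"
        by (simp add: z_def power_mult_distrib u_power)
      moreover have "u (int k) p * u (n i - n j) p = u (int k + n i - n j) p" for i j
        by (simp add: u_mult add_diff_eq)
      ultimately show "z p ^ k * cinner (y p) ((T ^^ k) (y p))
          = (\<Sum>i\<in>I. \<Sum>j\<in>I. u (int k + n i - n j) p * (complex_of_real (r ^ k) * cinner (x i) ((T ^^ k) (x j))))"
        unfolding expand[OF bounded_op_funpow[OF T]] sum_distrib_left
        by (intro sum.cong refl) (metis mult.assoc mult.left_commute)
    qed
    also have "\<dots> = (\<Sum>i\<in>I. \<Sum>j\<in>I. \<Sum>k=1..L. u (int k + n i - n j) p * (complex_of_real (r ^ k) * cinner (x i) ((T ^^ k) (x j))))"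
      by (subst sum.swap, intro sum.cong refl, rule sum.swap)
    finally have powers: "(\<Sum>k=1..L. z p ^ k * cinner (y p) ((T ^^ k) (y p))) = \<dots>" .
    show ?thesis
      unfolding P_def powers expand[OF A] by (simp add: sum.distrib sum_distrib_left mult_ac)
  qed
  have avg: "(\<Sum>p<M. P p) = of_nat M * (\<Sum>i\<in>I. \<Sum>j\<in>I. half_kern r A T (n j - n i) (x i) (x j))"
  proof -
    have "(\<Sum>p<M. P p) = (\<Sum>i\<in>I. \<Sum>j\<in>I. (\<Sum>p<M. u (n i - n j) p) * cinner (x i) (A (x j))
      + (\<Sum>k=1..L. (\<Sum>p<M. u (int k + n i - n j) p) * (2 * complex_of_real (r ^ k) * cinner (x i) ((T ^^ k) (x j)))))"
      unfolding P_expand sum_distrib_right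
      by (subst sum.swap, intro sum.cong refl, subst sum.swap, intro sum.cong refl)
        (simp only: sum.distrib, subst sum.swap, rule refl)
    also have "\<dots> = (\<Sum>i\<in>I. \<Sum>j\<in>I. of_nat M * half_kern r A T (n j - n i) (x i) (x j))"
    proof (intro sum.cong refl)
      fix i j assume ij: "i \<in> I" "j \<in> I"
      note Lij = L[OF ij]
      define c where "c = (\<lambda>k. 2 * complex_of_real (r ^ k) * cinner (x i) ((T ^^ k) (x j)))"
      \<comment> \<open>The choice of \<open>L\<close> guarantees that a positive
        \<open>n j - n i\<close> occurs among the summation indices, so no surviving term was cut
        off.\<close>
      have "(\<Sum>k=1..L. (\<Sum>p<M. u (int k + n i - n j) p) * c k)
          = (\<Sum>k=1..L. if k = nat (n j - n i) then of_nat M * c k else 0)"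
        using Lij by (intro sum.cong refl) (subst u_sum, auto)
      also have "\<dots> = (if n j - n i > 0 then of_nat M * c (nat (n j - n i)) else 0)"
        using Lij by (subst sum.delta) auto
      finally have "(\<Sum>k=1..L. (\<Sum>p<M. u (int k + n i - n j) p) * c k)
          = (if n j - n i > 0 then of_nat M * c (nat (n j - n i)) else 0)" .
      moreover have "(\<Sum>p<M. u (n i - n j) p) = (if n i - n j = 0 then of_nat M else 0)"
        using Lij by (intro u_sum) auto
      ultimately show "(\<Sum>p<M. u (n i - n j) p) * cinner (x i) (A (x j))
          + (\<Sum>k=1..L. (\<Sum>p<M. u (int k + n i - n j) p) * (2 * complex_of_real (r ^ k) * cinner (x i) ((T ^^ k) (x j))))
          = of_nat M * half_kern r A T (n j - n i) (x i) (x j)"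
        by (auto simp: c_def half_kern_def)
    qed
    finally show ?thesis
      by (simp add: sum_distrib_left)
  qed
  have "real M * (- 2 * (\<Sum>k. b (k + Suc L))) = (\<Sum>p<M. - 2 * (\<Sum>k. b (k + Suc L)))"
    by simp
  also have "\<dots> \<le> (\<Sum>p<M. Re (P p))"
    by (intro sum_mono lower)
  also have "\<dots> = real M * Re (\<Sum>i\<in>I. \<Sum>j\<in>I. half_kern r A T (n j - n i) (x i) (x j))"
    unfolding Re_sum[symmetric] avg by simp
  finally have "- 2 * (\<Sum>k. b (k + Suc L)) \<le> Re (\<Sum>i\<in>I. \<Sum>j\<in>I. half_kern r A T (n j - n i) (x i) (x j))"
    by (rule mult_left_le_imp_le) (simp add: M_def)
  then show ?thesis
    by (simp only: b_def)
qed

text \<open>For fixed \<open>r < 1\<close> the tail vanishes as \<open>L\<close> grows, while the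
  finite sum does not depend on \<open>L\<close>. That sum is a polynomial in \<open>r\<close>, so
  its nonnegativity extends to \<open>r = 1\<close>.\<close>

lemma resolvent_positive_imp_sum_kern:
  fixes T :: "'h::complex_hilbert \<Rightarrow> 'h" and n :: "'i \<Rightarrow> int"
  assumes A: "positive_op A" and T: "bounded_op T" and pos: "resolvent_positive A T" and I: "finite I"
  shows "(\<Sum>i\<in>I. \<Sum>j\<in>I. kern A T (n j - n i) (x i) (x j)) \<in> \<real>\<^sub>\<ge>\<^sub>0"
proof -
  note bA = positive_op_bounded[OF A]
  define S where "S = (\<lambda>r. Re (\<Sum>i\<in>I. \<Sum>j\<in>I. half_kern r A T (n j - n i) (x i) (x j)))"
  define L0 where "L0 = nat (\<Sum>i\<in>I. \<Sum>j\<in>I. \<bar>n j - n i\<bar>)"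
  have L0: "\<bar>n j - n i\<bar> \<le> int L0" if "i \<in> I" "j \<in> I" for i j
  proof -
    have "\<bar>n j - n i\<bar> \<le> (\<Sum>j\<in>I. \<bar>n j - n i\<bar>)"
      using that I by (intro member_le_sum) auto
    also have "\<dots> \<le> (\<Sum>i\<in>I. \<Sum>j\<in>I. \<bar>n j - n i\<bar>)"
      using that I by (intro member_le_sum[of i I "\<lambda>i. \<Sum>j\<in>I. \<bar>n j - n i\<bar>"] sum_nonneg) auto
    finally show ?thesis
      by (simp add: L0_def sum_nonneg)
  qed
  have Sr: "0 \<le> S r" if r: "0 \<le> r" "r < 1" for r
  proof -
    define b where "b = (\<lambda>k. \<Sum>i\<in>I. \<Sum>j\<in>I. r ^ k * cmod (cinner (x i) ((T ^^ k) (x j))))"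
    have b: "summable b"
      unfolding b_def by (intro summable_sum summable_resolvent_coeffs[OF bA T pos r])
    have "- 2 * (\<Sum>k. b (k + Suc L)) \<le> S r" if "L \<ge> L0" for L
      unfolding b_def S_def using L0 that
      by (intro sum_half_kern_lower_bound[OF bA T pos I r]) (meson nat_le_iff of_nat_mono order_trans)
    moreover have "(\<lambda>L. - 2 * (\<Sum>k. b (k + Suc L))) \<longlonglongrightarrow> - 2 * 0"
      by (intro tendsto_intros LIMSEQ_Suc[OF suminf_exist_split2[OF b]])
    ultimately show ?thesis
      by (intro LIMSEQ_le_const2[of _ _ "S r"]) auto
  qed
  have cont: "continuous_on UNIV (\<lambda>r. half_kern r A T m u v)" for m u v
    by (cases "m = 0"; cases "m > 0") (auto simp: half_kern_def intro!: continuous_intros)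
  have "continuous_on UNIV S"
    unfolding S_def by (intro continuous_intros cont)
  then have "(S \<longlongrightarrow> S 1) (at_left 1)"
    by (simp add: continuous_on_def filterlim_at_split)
  moreover have "\<forall>\<^sub>F r in at_left 1. 0 \<le> S r"
    using eventually_at_left_real[of 0 1] by (auto elim!: eventually_mono intro: Sr)
  ultimately have "0 \<le> S 1"
    by (intro tendsto_lowerbound[of S "S 1" "at_left 1" 0]) auto
  then show ?thesis
    unfolding sum_kern_eq_Re_sum_half_kern[OF A] S_def by (simp only: nonneg_Reals_of_real_iff)
qed

section \<open>Completion of a semi-inner product\<close>

text \<open>Elements of the completion are the functionals \<open>u \<mapsto> lim (B u (x m))\<close> for Cauchy sequences \<open>x\<close>,
  so that null vectors are divided out without quotients. The operations \<open>add\<close> and \<open>scale\<close> need only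
  be compatible with \<open>B\<close>: lists of vectors under \<open>@\<close>, read as formal sums, are an instance.\<close>

locale semi_inner_product =
  fixes add :: "'v \<Rightarrow> 'v \<Rightarrow> 'v" and scale :: "complex \<Rightarrow> 'v \<Rightarrow> 'v" and B :: "'v \<Rightarrow> 'v \<Rightarrow> complex"
  assumes B_commute: "B u v = cnj (B v u)"
    and B_add: "B u (add v w) = B u v + B u w"
    and B_scale: "B u (scale a v) = a * B u v"
    and B_nonneg: "B v v \<in> \<real>\<^sub>\<ge>\<^sub>0"
begin

definition sdiff :: "'v \<Rightarrow> 'v \<Rightarrow> 'v" where
  "sdiff u v = add u (scale (- 1) v)"

definition snorm :: "'v \<Rightarrow> real" where
  "snorm v = sqrt (Re (B v v))"

definition scauchy :: "(nat \<Rightarrow> 'v) \<Rightarrow> bool" where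
  "scauchy x \<longleftrightarrow> (\<forall>e>0. \<exists>M. \<forall>m\<ge>M. \<forall>n\<ge>M. snorm (sdiff (x m) (x n)) < e)"

definition represents :: "(nat \<Rightarrow> 'v) \<Rightarrow> ('v \<Rightarrow> complex) \<Rightarrow> bool" where
  "represents x f \<longleftrightarrow> scauchy x \<and> (\<forall>u. (\<lambda>m. B u (x m)) \<longlonglongrightarrow> f u)"

definition completion_inner :: "('v \<Rightarrow> complex) \<Rightarrow> ('v \<Rightarrow> complex) \<Rightarrow> complex" where
  "completion_inner f g =
     lim (\<lambda>m. B ((SOME x. represents x f) m) ((SOME y. represents y g) m))"

definition completion :: "('v \<Rightarrow> complex) hilbert_structure" where
  "completion = \<lparr>hcarrier = {f. \<exists>x. represents x f}, hzero = (\<lambda>u. 0),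
     hadd = (\<lambda>f g u. f u + g u), hscale = (\<lambda>a f u. a * f u), hinner = completion_inner\<rparr>"

section \<open>Cauchy sequences for the semi-norm\<close>

lemma B_sdiff: "B u (sdiff v w) = B u v - B u w"
  by (simp add: sdiff_def B_add B_scale)

lemma B_sdiff_left: "B (sdiff v w) u = B v u - B w u"
  by (subst (1 2 3) B_commute) (simp add: B_sdiff)

lemma B_add_left: "B (add v w) u = B v u + B w u"
  by (subst (1 2 3) B_commute) (simp add: B_add)

lemma B_scale_left: "B (scale a v) u = cnj a * B v u"
  by (subst (1 2) B_commute) (simp add: B_scale)

lemma Re_B_nonneg: "Re (B v v) \<ge> 0"
  using B_nonneg by (simp add: complex_nonneg_Reals_iff)

lemma snorm_nonneg: "snorm v \<ge> 0"
  by (simp add: snorm_def Re_B_nonneg)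

lemma snorm_power2: "(snorm v)\<^sup>2 = Re (B v v)"
  by (simp add: snorm_def Re_B_nonneg)

lemma B_le_snorm: "cmod (B u v) \<le> snorm u * snorm v"
proof (rule power2_le_imp_le)
  have "(cmod (B u v))\<^sup>2 \<le> Re (B u u) * Re (B v v)"
  proof (rule complex_quadratic_nonneg_discriminant)
    fix t
    have "B v u = cnj (B u v)"
      by (rule B_commute)
    then have "B (add u (scale t v)) (add u (scale t v))
        = B u u + (t * B u v + cnj (t * B u v)) + (t * cnj t) * B v v"
      by (simp add: B_add B_add_left B_scale B_scale_left algebra_simps)
    also have "\<dots> = B u u + complex_of_real (2 * Re (t * B u v)) + complex_of_real ((cmod t)\<^sup>2) * B v v"
      by (simp only: complex_add_cnj complex_norm_square)
    finally show "0 \<le> Re (B u u) + 2 * Re (t * B u v) + (cmod t)\<^sup>2 * Re (B v v)"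
      using Re_B_nonneg[of "add u (scale t v)"] by simp
  qed
  then show "(cmod (B u v))\<^sup>2 \<le> (snorm u * snorm v)\<^sup>2"
    by (simp add: power_mult_distrib snorm_power2)
qed (simp add: snorm_nonneg)

text \<open>The hypothesis is on the values of \<open>B\<close> and not \<open>w = add a b\<close>,
  since \<open>add\<close> satisfies the vector space laws only up to null vectors.\<close>

lemma snorm_triangle:
  assumes "\<And>u. B u w = B u a + B u b"
  shows "snorm w \<le> snorm a + snorm b"
proof (cases "snorm w = 0")
  case True
  then show ?thesis
    by (simp add: snorm_nonneg)
next
  case False
  have "(snorm w)\<^sup>2 = Re (B w a) + Re (B w b)"
    using assms[of w] by (simp add: snorm_power2)
  also have "\<dots> \<le> snorm w * snorm a + snorm w * snorm b"
    by (intro add_mono order_trans[OF complex_Re_le_cmod] B_le_snorm)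
  finally have "snorm w * snorm w \<le> snorm w * (snorm a + snorm b)"
    by (simp add: power2_eq_square algebra_simps)
  then show ?thesis
    using False snorm_nonneg[of w] by (simp add: mult_le_cancel_left)
qed

lemma snorm_scale:
  assumes "\<And>u. B u w = c * B u a"
  shows "snorm w \<le> cmod c * snorm a"
proof (cases "snorm w = 0")
  case False
  have "(snorm w)\<^sup>2 = Re (c * B w a)"
    using assms[of w] by (simp add: snorm_power2)
  also have "\<dots> \<le> cmod c * cmod (B w a)"
    by (metis complex_Re_le_cmod norm_mult)
  also have "\<dots> \<le> cmod c * (snorm w * snorm a)"
    by (intro mult_left_mono B_le_snorm) simp
  finally have "snorm w * snorm w \<le> snorm w * (cmod c * snorm a)"
    by (simp add: power2_eq_square mult_ac)
  then show ?thesis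
    using False snorm_nonneg[of w] by (simp add: mult_le_cancel_left)
qed (simp add: snorm_nonneg)

lemma snorm_le_add_sdiff: "snorm a \<le> snorm (sdiff a b) + snorm b"
  by (rule snorm_triangle) (simp add: B_sdiff)

lemma scauchyD:
  assumes "scauchy x" "e > 0"
  obtains M where "\<And>m n. m \<ge> M \<Longrightarrow> n \<ge> M \<Longrightarrow> snorm (sdiff (x m) (x n)) < e"
  using assms unfolding scauchy_def by blast

lemma scauchy_const: "scauchy (\<lambda>m. v)"
  unfolding scauchy_def snorm_def by (simp add: B_sdiff B_sdiff_left)

lemma scauchy_bounded:
  assumes x: "scauchy x"
  obtains C where "C > 0" "\<And>m. snorm (x m) \<le> C"
proof -
  have "Cauchy (\<lambda>m. snorm (x m))"
  proof (rule metric_CauchyI)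
    fix e :: real assume "e > 0"
    then obtain M where M: "\<And>m n. m \<ge> M \<Longrightarrow> n \<ge> M \<Longrightarrow> snorm (sdiff (x m) (x n)) < e"
      using scauchyD[OF x] by blast
    have "dist (snorm (x m)) (snorm (x n)) < e" if "m \<ge> M" "n \<ge> M" for m n
      using M[OF that] M[OF that(2,1)] snorm_le_add_sdiff[of "x m" "x n"]
        snorm_le_add_sdiff[of "x n" "x m"]
      by (simp add: dist_real_def abs_less_iff)
    then show "\<exists>M. \<forall>m\<ge>M. \<forall>n\<ge>M. dist (snorm (x m)) (snorm (x n)) < e"
      by blast
  qed
  then have "Bseq (\<lambda>m. snorm (x m))"
    by (intro convergent_imp_Bseq) (simp add: Cauchy_convergent_iff)
  then show ?thesis
    using that by (auto simp: Bseq_def snorm_nonneg)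
qed

lemma B_convergent:
  assumes x: "scauchy x" and y: "scauchy y"
  shows "convergent (\<lambda>m. B (x m) (y m))"
proof -
  obtain C where C: "C > 0" "\<And>m. snorm (x m) \<le> C"
    using scauchy_bounded[OF x] by blast
  obtain D where D: "D > 0" "\<And>m. snorm (y m) \<le> D"
    using scauchy_bounded[OF y] by blast
  have "Cauchy (\<lambda>m. B (x m) (y m))"
  proof (rule metric_CauchyI)
    fix e :: real assume "e > 0"
    then have "e / (C + D) > 0"
      using C(1) D(1) by simp
    then obtain M1 M2 where M1: "\<And>m n. m \<ge> M1 \<Longrightarrow> n \<ge> M1 \<Longrightarrow> snorm (sdiff (x m) (x n)) < e / (C + D)"
      and M2: "\<And>m n. m \<ge> M2 \<Longrightarrow> n \<ge> M2 \<Longrightarrow> snorm (sdiff (y m) (y n)) < e / (C + D)"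
      using scauchyD[OF x] scauchyD[OF y] by meson
    have "dist (B (x m) (y m)) (B (x n) (y n)) < e" if "m \<ge> max M1 M2" "n \<ge> max M1 M2" for m n
    proof -
      have "B (x m) (y m) - B (x n) (y n) = B (sdiff (x m) (x n)) (y m) + B (x n) (sdiff (y m) (y n))"
        by (simp add: B_sdiff B_sdiff_left)
      then have "dist (B (x m) (y m)) (B (x n) (y n))
          \<le> cmod (B (sdiff (x m) (x n)) (y m)) + cmod (B (x n) (sdiff (y m) (y n)))"
        by (simp add: dist_norm norm_triangle_ineq)
      also have "\<dots> \<le> snorm (sdiff (x m) (x n)) * snorm (y m) + snorm (x n) * snorm (sdiff (y m) (y n))"
        by (intro add_mono B_le_snorm)
      also have "\<dots> \<le> snorm (sdiff (x m) (x n)) * D + C * snorm (sdiff (y m) (y n))"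
        by (intro add_mono mult_left_mono mult_right_mono C D snorm_nonneg)
      also have "\<dots> < e / (C + D) * D + C * (e / (C + D))"
        using that C(1) D(1) by (intro add_strict_mono mult_strict_right_mono mult_strict_left_mono M1 M2) auto
      also have "\<dots> = e"
        unfolding mult.commute[of C] distrib_left[symmetric] add.commute[of C] using C(1) D(1) by simp
      finally show ?thesis .
    qed
    then show "\<exists>M. \<forall>m\<ge>M. \<forall>n\<ge>M. dist (B (x m) (y m)) (B (x n) (y n)) < e"
      by blast
  qed
  then show ?thesis
    by (simp add: Cauchy_convergent_iff)
qed

lemma represents_exists:
  assumes "scauchy x"
  shows "\<exists>f. represents x f"
proof -
  have "\<exists>l. (\<lambda>m. B u (x m)) \<longlonglongrightarrow> l" for u
    using B_convergent[OF scauchy_const assms] by (simp add: convergent_def)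
  then show ?thesis
    unfolding represents_def using assms by metis
qed

text \<open>\<open>g (x m)\<close> is the limit of \<open>B (x m) (y n)\<close> in \<open>n\<close>,
  uniformly in \<open>m\<close> because \<open>x\<close> is bounded and \<open>y\<close> is Cauchy.
  Hence the limit of \<open>B (x m) (y m)\<close> depends on \<open>y\<close> only through
  \<open>g\<close>.\<close>

lemma represents_tendsto_mixed:
  assumes f: "represents x f" and g: "represents y g"
  shows "(\<lambda>m. g (x m) - B (x m) (y m)) \<longlonglongrightarrow> 0"
proof (rule LIMSEQ_I)
  fix e :: real assume e: "e > 0"
  obtain C where C: "C > 0" "\<And>m. snorm (x m) \<le> C"
    using f scauchy_bounded unfolding represents_def by blast
  have "e / (2 * C) > 0"
    using e C by simp
  then obtain M where M: "\<And>m n. m \<ge> M \<Longrightarrow> n \<ge> M \<Longrightarrow> snorm (sdiff (y m) (y n)) < e / (2 * C)"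
    using g scauchyD unfolding represents_def by metis
  have "norm (g (x m) - B (x m) (y m) - 0) < e" if m: "m \<ge> M" for m
  proof -
    have "(\<lambda>n. cmod (B (x m) (y n) - B (x m) (y m))) \<longlonglongrightarrow> cmod (g (x m) - B (x m) (y m))"
      using g unfolding represents_def by (intro tendsto_intros) auto
    moreover have "cmod (B (x m) (y n) - B (x m) (y m)) \<le> e / 2" if "n \<ge> M" for n
    proof -
      have "cmod (B (x m) (sdiff (y n) (y m))) \<le> snorm (x m) * snorm (sdiff (y n) (y m))"
        by (rule B_le_snorm)
      also have "\<dots> \<le> C * (e / (2 * C))"
        using C M[OF that m] by (intro mult_mono snorm_nonneg) auto
      finally show ?thesis
        using C(1) by (simp add: B_sdiff)
    qed
    ultimately have "cmod (g (x m) - B (x m) (y m)) \<le> e / 2"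
      by (intro LIMSEQ_le_const2) auto
    then show ?thesis
      using e by simp
  qed
  then show "\<exists>M. \<forall>m\<ge>M. norm (g (x m) - B (x m) (y m) - 0) < e"
    by blast
qed

lemma lim_B_unique:
  assumes x: "represents x f" and y: "represents y g" and y': "represents y' g"
    and l: "(\<lambda>m. B (x m) (y m)) \<longlonglongrightarrow> l"
  shows "(\<lambda>m. B (x m) (y' m)) \<longlonglongrightarrow> l"
proof -
  have "(\<lambda>m. (g (x m) - B (x m) (y m)) + B (x m) (y m) - (g (x m) - B (x m) (y' m))) \<longlonglongrightarrow> 0 + l - 0"
    by (intro tendsto_intros represents_tendsto_mixed[OF x y] represents_tendsto_mixed[OF x y'] l)
  then show ?thesis
    by simp
qed

text \<open>Independence of the chosen representatives: exchange the right one, conjugate, and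
  exchange the other.\<close>

lemma tendsto_completion_inner:
  assumes x: "represents x f" and y: "represents y g"
  shows "(\<lambda>m. B (x m) (y m)) \<longlonglongrightarrow> completion_inner f g"
proof -
  define x' where "x' = (SOME x. represents x f)"
  define y' where "y' = (SOME y. represents y g)"
  have x': "represents x' f"
    unfolding x'_def by (rule someI[of "\<lambda>x. represents x f", OF x])
  have y': "represents y' g"
    unfolding y'_def by (rule someI[of "\<lambda>y. represents y g", OF y])
  have "(\<lambda>m. B (x' m) (y' m)) \<longlonglongrightarrow> completion_inner f g"
    unfolding completion_inner_def x'_def[symmetric] y'_def[symmetric]
    using B_convergent x' y' by (simp add: convergent_LIMSEQ_iff represents_def)
  then have "(\<lambda>m. B (x' m) (y m)) \<longlonglongrightarrow> completion_inner f g"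
    by (rule lim_B_unique[OF x' y' y])
  then have "(\<lambda>m. cnj (B (x' m) (y m))) \<longlonglongrightarrow> cnj (completion_inner f g)"
    by (rule tendsto_cnj)
  then have "(\<lambda>m. B (y m) (x' m)) \<longlonglongrightarrow> cnj (completion_inner f g)"
    by (simp add: B_commute[symmetric])
  then have "(\<lambda>m. B (y m) (x m)) \<longlonglongrightarrow> cnj (completion_inner f g)"
    by (rule lim_B_unique[OF y x' x])
  then have "(\<lambda>m. cnj (B (y m) (x m))) \<longlonglongrightarrow> completion_inner f g"
    using tendsto_cnj by fastforce
  then show ?thesis
    by (simp add: B_commute[symmetric])
qed

lemma represents_const: "represents (\<lambda>m. v) (\<lambda>u. B u v)"
  by (simp add: represents_def scauchy_const)

lemma represents_add:
  assumes x: "represents x f" and y: "represents y g"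
  shows "represents (\<lambda>m. add (x m) (y m)) (\<lambda>u. f u + g u)"
  unfolding represents_def
proof
  show "scauchy (\<lambda>m. add (x m) (y m))"
    unfolding scauchy_def
  proof (intro allI impI)
    fix e :: real assume "e > 0"
    then obtain M1 M2 where M1: "\<And>m n. m \<ge> M1 \<Longrightarrow> n \<ge> M1 \<Longrightarrow> snorm (sdiff (x m) (x n)) < e / 2"
      and M2: "\<And>m n. m \<ge> M2 \<Longrightarrow> n \<ge> M2 \<Longrightarrow> snorm (sdiff (y m) (y n)) < e / 2"
      using scauchyD x y unfolding represents_def by (metis half_gt_zero)
    have "snorm (sdiff (add (x m) (y m)) (add (x n) (y n))) < e"
      if "m \<ge> max M1 M2" "n \<ge> max M1 M2" for m n
    proof -
      have "snorm (sdiff (add (x m) (y m)) (add (x n) (y n)))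
          \<le> snorm (sdiff (x m) (x n)) + snorm (sdiff (y m) (y n))"
        by (rule snorm_triangle) (simp add: B_sdiff B_add)
      then show ?thesis
        using M1[of m n] M2[of m n] that by simp
    qed
    then show "\<exists>M. \<forall>m\<ge>M. \<forall>n\<ge>M. snorm (sdiff (add (x m) (y m)) (add (x n) (y n))) < e"
      by blast
  qed
  show "\<forall>u. (\<lambda>m. B u (add (x m) (y m))) \<longlonglongrightarrow> f u + g u"
    using x y by (auto simp: represents_def B_add intro: tendsto_add)
qed

lemma represents_scale:
  assumes x: "represents x f"
  shows "represents (\<lambda>m. scale a (x m)) (\<lambda>u. a * f u)"
  unfolding represents_def
proof
  show "scauchy (\<lambda>m. scale a (x m))"
    unfolding scauchy_def
  proof (intro allI impI)
    fix e :: real assume "e > 0"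
    then have "e / (cmod a + 1) > 0"
      by (simp add: add_nonneg_pos)
    then obtain M where M: "\<And>m n. m \<ge> M \<Longrightarrow> n \<ge> M \<Longrightarrow> snorm (sdiff (x m) (x n)) < e / (cmod a + 1)"
      using scauchyD x unfolding represents_def by metis
    have "snorm (sdiff (scale a (x m)) (scale a (x n))) < e" if "m \<ge> M" "n \<ge> M" for m n
    proof -
      have "snorm (sdiff (scale a (x m)) (scale a (x n))) \<le> cmod a * snorm (sdiff (x m) (x n))"
        by (rule snorm_scale) (simp add: B_sdiff B_scale algebra_simps)
      also have "\<dots> \<le> (cmod a + 1) * snorm (sdiff (x m) (x n))"
        by (intro mult_right_mono snorm_nonneg) simp
      also have "\<dots> < (cmod a + 1) * (e / (cmod a + 1))"
        by (intro mult_strict_left_mono M that) (simp add: add_nonneg_pos)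
      also have "\<dots> = e"
        by (simp add: add_nonneg_eq_0_iff)
      finally show ?thesis .
    qed
    then show "\<exists>M. \<forall>m\<ge>M. \<forall>n\<ge>M. snorm (sdiff (scale a (x m)) (scale a (x n))) < e"
      by blast
  qed
  show "\<forall>u. (\<lambda>m. B u (scale a (x m))) \<longlonglongrightarrow> a * f u"
    using x by (auto simp: represents_def B_scale intro: tendsto_mult)
qed

lemma represents_sdiff:
  assumes "represents x f" "represents y g"
  shows "represents (\<lambda>m. sdiff (x m) (y m)) (hdiff completion f g)"
  using represents_add[OF assms(1) represents_scale[OF assms(2), of "- 1"]]
  by (simp add: sdiff_def hdiff_def completion_def)

lemma represents_zero: "represents (\<lambda>m. scale 0 v) (\<lambda>u. 0)"
  using represents_scale[OF represents_const, of 0 v] by simp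

lemma snorm_tendsto_hnorm:
  assumes "represents x f"
  shows "(\<lambda>m. snorm (x m)) \<longlonglongrightarrow> hnorm completion f"
  unfolding snorm_def hnorm_def completion_def hilbert_structure.simps
  by (intro tendsto_real_sqrt tendsto_Re tendsto_completion_inner assms)

lemma hnorm_triangle:
  assumes f: "represents x f" and g: "represents y g"
  shows "hnorm completion (\<lambda>u. f u + g u) \<le> hnorm completion f + hnorm completion g"
proof (rule LIMSEQ_le)
  show "(\<lambda>m. snorm (add (x m) (y m))) \<longlonglongrightarrow> hnorm completion (\<lambda>u. f u + g u)"
    by (rule snorm_tendsto_hnorm[OF represents_add[OF f g]])
  show "(\<lambda>m. snorm (x m) + snorm (y m)) \<longlonglongrightarrow> hnorm completion f + hnorm completion g"
    by (intro tendsto_add snorm_tendsto_hnorm f g)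
  show "\<exists>M. \<forall>m\<ge>M. snorm (add (x m) (y m)) \<le> snorm (x m) + snorm (y m)"
    by (intro exI allI impI snorm_triangle) (simp add: B_add)
qed

lemma represents_approx:
  assumes f: "represents x f" and e: "e > 0"
  obtains M where "\<And>k. k \<ge> M \<Longrightarrow> hnorm completion (hdiff completion f (\<lambda>u. B u (x k))) \<le> e"
    and "\<And>k. k \<ge> M \<Longrightarrow> hnorm completion (hdiff completion (\<lambda>u. B u (x k)) f) \<le> e"
proof -
  obtain M where M: "\<And>m n. m \<ge> M \<Longrightarrow> n \<ge> M \<Longrightarrow> snorm (sdiff (x m) (x n)) < e"
    using scauchyD f e unfolding represents_def by metis
  have "hnorm completion (hdiff completion f (\<lambda>u. B u (x k))) \<le> e" if "k \<ge> M" for k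
    using snorm_tendsto_hnorm[OF represents_sdiff[OF f represents_const]]
    by (rule LIMSEQ_le_const2) (use M that in \<open>auto intro!: exI[of _ M] less_imp_le\<close>)
  moreover have "hnorm completion (hdiff completion (\<lambda>u. B u (x k)) f) \<le> e" if "k \<ge> M" for k
    using snorm_tendsto_hnorm[OF represents_sdiff[OF represents_const f]]
    by (rule LIMSEQ_le_const2) (use M that in \<open>auto intro!: exI[of _ M] less_imp_le\<close>)
  ultimately show ?thesis
    using that by blast
qed

text \<open>Approximate \<open>X n\<close> within \<open>1 / (n + 1)\<close> by an embedded vector
  \<open>v n\<close>. The sequence \<open>v\<close> is Cauchy for \<open>snorm\<close>, so it
  represents an element, and this element is the limit.\<close>

lemma completion_complete:
  assumes X: "\<And>n::nat. \<exists>x. represents x (X n)"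
    and cauchy: "\<And>e. e > 0 \<Longrightarrow> \<exists>M. \<forall>m\<ge>M. \<forall>n\<ge>M. hnorm completion (hdiff completion (X m) (X n)) < e"
  shows "\<exists>F. (\<exists>x. represents x F) \<and> (\<lambda>n. hnorm completion (hdiff completion (X n) F)) \<longlonglongrightarrow> 0"
proof -
  obtain r where r: "\<And>n. represents (r n) (X n)"
    using X by metis
  have "\<exists>v. hnorm completion (hdiff completion (X n) (\<lambda>u. B u v)) \<le> 1 / real (Suc n)
      \<and> hnorm completion (hdiff completion (\<lambda>u. B u v) (X n)) \<le> 1 / real (Suc n)" for n
    using represents_approx[OF r[of n], of "1 / real (Suc n)"] by (metis of_nat_0_less_iff zero_less_Suc zero_less_divide_1_iff order_refl)
  then obtain v where v1: "\<And>n. hnorm completion (hdiff completion (X n) (\<lambda>u. B u (v n))) \<le> 1 / real (Suc n)"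
    and v2: "\<And>n. hnorm completion (hdiff completion (\<lambda>u. B u (v n)) (X n)) \<le> 1 / real (Suc n)"
    by metis
  have rd: "represents (\<lambda>k. sdiff (r m k) (r n k)) (hdiff completion (X m) (X n))"
    "represents (\<lambda>k. sdiff (v m) (r n k)) (hdiff completion (\<lambda>u. B u (v m)) (X n))"
    "represents (\<lambda>k. sdiff (r m k) (v n)) (hdiff completion (X m) (\<lambda>u. B u (v n)))" for m n
    by (intro represents_sdiff r represents_const)+
  have small: "\<exists>M. \<forall>n\<ge>M. 1 / real (Suc n) < e" if "e > 0" for e :: real
    using LIMSEQ_Suc[OF lim_1_over_n[where 'a=real]] that
    by (auto dest!: order_tendstoD(2) simp: eventually_sequentially)
  have "scauchy v"
    unfolding scauchy_def
  proof (intro allI impI)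
    fix e :: real assume "e > 0"
    then have e3: "e / 3 > 0"
      by simp
    obtain M1 where M1: "\<And>m n. m \<ge> M1 \<Longrightarrow> n \<ge> M1 \<Longrightarrow> hnorm completion (hdiff completion (X m) (X n)) < e / 3"
      using cauchy[OF e3] by blast
    obtain M2 where M2: "\<And>n. n \<ge> M2 \<Longrightarrow> 1 / real (Suc n) < e / 3"
      using small[OF e3] by blast
    have "snorm (sdiff (v m) (v n)) < e" if mn: "m \<ge> max M1 M2" "n \<ge> max M1 M2" for m n
    proof -
      let ?d = "hdiff completion"
      let ?k = "\<lambda>n u. B u (v n)"
      have "(\<lambda>k. snorm (sdiff (v m) (v n))) \<longlonglongrightarrow> hnorm completion (?d (?k m) (?k n))"
        by (intro snorm_tendsto_hnorm represents_sdiff represents_const)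
      then have "snorm (sdiff (v m) (v n)) = hnorm completion (?d (?k m) (?k n))"
        by (simp add: LIMSEQ_const_iff)
      also have "?d (?k m) (?k n) = (\<lambda>u. ?d (?k m) (X m) u + (\<lambda>u. ?d (X m) (X n) u + ?d (X n) (?k n) u) u)"
        by (simp add: hdiff_def completion_def fun_eq_iff)
      also have "hnorm completion \<dots> \<le> hnorm completion (?d (?k m) (X m))
          + hnorm completion (\<lambda>u. ?d (X m) (X n) u + ?d (X n) (?k n) u)"
        by (rule hnorm_triangle[OF rd(2) represents_add[OF rd(1,3)]])
      also have "\<dots> \<le> hnorm completion (?d (?k m) (X m))
          + (hnorm completion (?d (X m) (X n)) + hnorm completion (?d (X n) (?k n)))"
        by (intro add_left_mono hnorm_triangle[OF rd(1,3)])
      also have "\<dots> < e / 3 + (e / 3 + e / 3)"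
        using v1[of n] v2[of m] M1[of m n] M2[of m] M2[of n] mn by auto
      finally show ?thesis
        by simp
    qed
    then show "\<exists>M. \<forall>m\<ge>M. \<forall>n\<ge>M. snorm (sdiff (v m) (v n)) < e"
      by blast
  qed
  then obtain F where F: "represents v F"
    using represents_exists by blast
  have "(\<lambda>n. hnorm completion (hdiff completion (X n) F)) \<longlonglongrightarrow> 0"
  proof (rule LIMSEQ_I)
    fix e :: real assume "e > 0"
    then have e2: "e / 2 > 0"
      by simp
    obtain M1 where M1: "\<And>k. k \<ge> M1 \<Longrightarrow> hnorm completion (hdiff completion (\<lambda>u. B u (v k)) F) \<le> e / 2"
      using represents_approx[OF F e2] by blast
    obtain M2 where M2: "\<And>n. n \<ge> M2 \<Longrightarrow> 1 / real (Suc n) < e / 2"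
      using small[OF e2] by blast
    have "norm (hnorm completion (hdiff completion (X n) F) - 0) < e" if n: "n \<ge> max M1 M2" for n
    proof -
      let ?d = "hdiff completion"
      let ?k = "\<lambda>n u. B u (v n)"
      have "?d (X n) F = (\<lambda>u. ?d (X n) (?k n) u + ?d (?k n) F u)"
        by (simp add: hdiff_def completion_def fun_eq_iff)
      then have "hnorm completion (?d (X n) F) \<le> hnorm completion (?d (X n) (?k n)) + hnorm completion (?d (?k n) F)"
        using hnorm_triangle[OF rd(3) represents_sdiff[OF represents_const F]] by simp
      also have "\<dots> < e / 2 + e / 2"
        using v1[of n] M1[of n] M2[of n] n by auto
      finally have "hnorm completion (?d (X n) F) < e"
        by simp
      moreover have "0 \<le> hnorm completion (?d (X n) F)"
        using snorm_tendsto_hnorm[OF represents_sdiff[OF r F]]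
        by (rule LIMSEQ_le_const) (simp add: snorm_nonneg)
      ultimately show ?thesis
        by simp
    qed
    then show "\<exists>M. \<forall>n\<ge>M. norm (hnorm completion (hdiff completion (X n) F) - 0) < e"
      by blast
  qed
  then show ?thesis
    using F by blast
qed

lemma hilbert_space_completion: "hilbert_space_on completion"
proof
  fix x y z :: "'v \<Rightarrow> complex" and a b :: complex
  have car: "f \<in> hcarrier completion \<longleftrightarrow> (\<exists>x. represents x f)" for f
    by (simp add: completion_def)
  have ops: "hzero completion = (\<lambda>u. 0)" "hadd completion f g = (\<lambda>u. f u + g u)"
    "hscale completion a f = (\<lambda>u. a * f u)" "hinner completion f g = completion_inner f g" for a f g
    by (simp_all add: completion_def)
  show "hzero completion \<in> hcarrier completion"
    unfolding car ops using represents_zero by blast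
  show "x \<in> hcarrier completion \<Longrightarrow> y \<in> hcarrier completion \<Longrightarrow> hadd completion x y \<in> hcarrier completion"
    unfolding car ops using represents_add by blast
  show "x \<in> hcarrier completion \<Longrightarrow> hscale completion a x \<in> hcarrier completion"
    unfolding car ops using represents_scale by blast
  show "\<exists>y\<in>hcarrier completion. hadd completion x y = hzero completion" if "x \<in> hcarrier completion"
    using that represents_scale[of _ x "- 1"] unfolding ops by (intro bexI[of _ "\<lambda>u. - 1 * x u"]) (auto simp: car)
  show "hadd completion (hadd completion x y) z = hadd completion x (hadd completion y z)"
    "hadd completion x y = hadd completion y x" "hadd completion x (hzero completion) = x"
    "hscale completion a (hadd completion x y) = hadd completion (hscale completion a x) (hscale completion a y)"
    "hscale completion (a + b) x = hadd completion (hscale completion a x) (hscale completion b x)"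
    "hscale completion a (hscale completion b x) = hscale completion (a * b) x"
    "hscale completion 1 x = x"
    unfolding ops by (simp_all add: algebra_simps fun_eq_iff)
  show "hinner completion x y = cnj (hinner completion y x)"
    if xy: "x \<in> hcarrier completion" "y \<in> hcarrier completion"
  proof -
    obtain r s where rs: "represents r x" "represents s y"
      using xy by (auto simp: car)
    have "(\<lambda>m. cnj (B (s m) (r m))) \<longlonglongrightarrow> cnj (completion_inner y x)"
      by (intro tendsto_cnj tendsto_completion_inner rs)
    then show ?thesis
      using LIMSEQ_unique[OF tendsto_completion_inner[OF rs]] unfolding ops by (simp add: B_commute[symmetric])
  qed
  show "hinner completion x (hadd completion y z) = hinner completion x y + hinner completion x z"
    if xyz: "x \<in> hcarrier completion" "y \<in> hcarrier completion" "z \<in> hcarrier completion"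
  proof -
    obtain r s t where rs: "represents r x" "represents s y" "represents t z"
      using xyz by (auto simp: car)
    have "(\<lambda>m. B (r m) (s m) + B (r m) (t m)) \<longlonglongrightarrow> completion_inner x y + completion_inner x z"
      by (intro tendsto_add tendsto_completion_inner rs)
    then show ?thesis
      using LIMSEQ_unique[OF tendsto_completion_inner[OF rs(1) represents_add[OF rs(2,3)]]]
      unfolding ops by (simp add: B_add)
  qed
  show "hinner completion x (hscale completion a y) = a * hinner completion x y"
    if xy: "x \<in> hcarrier completion" "y \<in> hcarrier completion"
  proof -
    obtain r s where rs: "represents r x" "represents s y"
      using xy by (auto simp: car)
    have "(\<lambda>m. a * B (r m) (s m)) \<longlonglongrightarrow> a * completion_inner x y"
      by (intro tendsto_mult_left tendsto_completion_inner rs)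
    moreover have "(\<lambda>m. a * B (r m) (s m)) \<longlonglongrightarrow> completion_inner x (\<lambda>u. a * y u)"
      using tendsto_completion_inner[OF rs(1) represents_scale[OF rs(2)]] by (simp add: B_scale)
    ultimately show ?thesis
      unfolding ops using LIMSEQ_unique by blast
  qed
  show "hinner completion x x \<in> \<real>\<^sub>\<ge>\<^sub>0" if x: "x \<in> hcarrier completion"
  proof -
    obtain r where r: "represents r x"
      using x by (auto simp: car)
    show ?thesis
      unfolding ops
      by (rule Lim_in_closed_set[OF closed_nonneg_Reals_complex _ _ tendsto_completion_inner[OF r r]])
        (auto simp: B_nonneg)
  qed
  show "x = hzero completion" if x: "x \<in> hcarrier completion" "hinner completion x x = 0"
  proof -
    obtain r where r: "represents r x"
      using x(1) by (auto simp: car)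
    have "hnorm completion x = 0"
      using x(2) by (simp add: hnorm_def)
    then have n0: "(\<lambda>m. snorm (r m)) \<longlonglongrightarrow> 0"
      using snorm_tendsto_hnorm[OF r] by simp
    \<comment> \<open>Cauchy-Schwarz makes a functional of norm 0 literally the zero function; here
      the encoding by functionals pays off.\<close>
    have "x u = 0" for u
    proof -
      have "(\<lambda>m. B u (r m)) \<longlonglongrightarrow> 0"
      proof (rule Lim_null_comparison)
        show "\<forall>\<^sub>F m in sequentially. norm (B u (r m)) \<le> snorm u * snorm (r m)"
          by (simp add: B_le_snorm)
        show "(\<lambda>m. snorm u * snorm (r m)) \<longlonglongrightarrow> 0"
          using tendsto_mult_right_zero[OF n0] .
      qed
      then show ?thesis
        using r LIMSEQ_unique unfolding represents_def by blast
    qed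
    then show ?thesis
      unfolding ops by auto
  qed
  show "\<exists>F\<in>hcarrier completion. (\<lambda>n. hnorm completion (hdiff completion (X n) F)) \<longlonglongrightarrow> 0"
    if "\<And>n::nat. X n \<in> hcarrier completion"
      "\<And>e. e > 0 \<Longrightarrow> \<exists>M. \<forall>m\<ge>M. \<forall>n\<ge>M. hnorm completion (hdiff completion (X m) (X n)) < e" for X
    using completion_complete[of X, OF that[unfolded car]] unfolding Bex_def car .
qed

lemma completion_bounded:
  assumes "f \<in> hcarrier completion"
  obtains C where "\<And>u. cmod (f u) \<le> snorm u * C"
proof -
  obtain x where x: "represents x f"
    using assms by (auto simp: completion_def)
  then obtain C where C: "\<And>m. snorm (x m) \<le> C"
    using scauchy_bounded unfolding represents_def by blast
  have "cmod (f u) \<le> snorm u * C" for u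
  proof (rule Lim_norm_ubound)
    show "(\<lambda>m. B u (x m)) \<longlonglongrightarrow> f u"
      using x by (simp add: represents_def)
    show "\<forall>\<^sub>F m in sequentially. cmod (B u (x m)) \<le> snorm u * C"
      by (intro always_eventually allI order_trans[OF B_le_snorm] mult_left_mono C snorm_nonneg)
  qed simp
  then show ?thesis
    by (rule that)
qed

text \<open>Elements of the completion are antilinear functionals. Stated through \<open>B\<close>,
  this also covers formal sums that differ as lists but have the same products with all
  vectors.\<close>

lemma completion_additive:
  assumes "f \<in> hcarrier completion"
  shows "(\<And>u. B w u = B v u + B v' u) \<Longrightarrow> f w = f v + f v'"
    and "(\<And>u. B w u = cnj a * B v u) \<Longrightarrow> f w = cnj a * f v"
proof -
  obtain x where x: "\<And>u. (\<lambda>m. B u (x m)) \<longlonglongrightarrow> f u"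
    using assms by (auto simp: completion_def represents_def)
  show "f w = f v + f v'" if "\<And>u. B w u = B v u + B v' u"
    using LIMSEQ_unique[OF x[of w]] tendsto_add[OF x[of v] x[of v']] by (simp add: that)
  show "f w = cnj a * f v" if "\<And>u. B w u = cnj a * B v u"
    using LIMSEQ_unique[OF x[of w]] tendsto_mult_left[OF x[of v], of "cnj a"] by (simp add: that)
qed

lemma embed_in_completion: "(\<lambda>u. B u v) \<in> hcarrier completion"
  using represents_const by (auto simp: completion_def)

lemma completion_inner_embed: "hinner completion (\<lambda>u. B u v) (\<lambda>u. B u w) = B v w"
  using LIMSEQ_unique[OF tendsto_completion_inner[OF represents_const represents_const] tendsto_const]
  by (simp add: completion_def)

text \<open>The functional of \<open>\<sigma> v\<close> at \<open>u\<close> is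
  \<open>B u (\<sigma> v) = B (\<sigma>' u) v\<close>, so a symmetry acts on functionals by
  composition with its inverse.\<close>

lemma unitary_completion:
  assumes inv: "\<And>u. \<sigma> (\<sigma>' u) = u" "\<And>u. \<sigma>' (\<sigma> u) = u" and B: "\<And>u v. B (\<sigma> u) (\<sigma> v) = B u v"
  shows "unitary_on completion (\<lambda>f u. f (\<sigma>' u))"
proof -
  have rep: "represents (\<lambda>m. \<tau> (x m)) (\<lambda>u. f (\<tau>' u))"
    if x: "represents x f" and \<tau>: "\<And>u. \<tau> (\<tau>' u) = u" "\<And>u v. B (\<tau> u) (\<tau> v) = B u v" for x f \<tau> \<tau>'
    unfolding represents_def
  proof
    have "snorm (sdiff (\<tau> a) (\<tau> b)) = snorm (sdiff a b)" for a b
      by (simp add: snorm_def B_sdiff B_sdiff_left \<tau>(2))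
    then show "scauchy (\<lambda>m. \<tau> (x m))"
      using x by (simp add: represents_def scauchy_def)
    have "B u (\<tau> v) = B (\<tau>' u) v" for u v
      using \<tau>(2)[of "\<tau>' u" v] by (simp add: \<tau>(1))
    then show "\<forall>u. (\<lambda>m. B u (\<tau> (x m))) \<longlonglongrightarrow> f (\<tau>' u)"
      using x by (simp add: represents_def)
  qed
  have B': "B (\<sigma>' u) (\<sigma>' v) = B u v" for u v
    using B[of "\<sigma>' u" "\<sigma>' v"] by (simp add: inv)
  have "bij_betw (\<lambda>f u. f (\<sigma>' u)) (hcarrier completion) (hcarrier completion)"
  proof (rule bij_betw_byWitness[where f'="\<lambda>f u. f (\<sigma> u)"])
    show "(\<lambda>f u. f (\<sigma>' u)) ` hcarrier completion \<subseteq> hcarrier completion"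
      using rep[OF _ inv(1) B] by (auto simp: completion_def)
    show "(\<lambda>f u. f (\<sigma> u)) ` hcarrier completion \<subseteq> hcarrier completion"
      using rep[OF _ inv(2) B'] by (auto simp: completion_def)
  qed (simp_all add: inv)
  moreover have "hinner completion (\<lambda>u. f (\<sigma>' u)) (\<lambda>u. g (\<sigma>' u)) = hinner completion f g"
    if fg: "f \<in> hcarrier completion" "g \<in> hcarrier completion" for f g
  proof -
    obtain x y where xy: "represents x f" "represents y g"
      using fg by (auto simp: completion_def)
    show ?thesis
      using LIMSEQ_unique[OF tendsto_completion_inner[OF rep[OF xy(1) inv(1) B] rep[OF xy(2) inv(1) B]]]
        tendsto_completion_inner[OF xy] by (simp add: B completion_def)
  qed
  ultimately show ?thesis
    by (simp add: unitary_on_def completion_def)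
qed

end

section \<open>Dilations\<close>

lemma (in hilbert_space_on) inner_hdiff_right:
  assumes "x \<in> hcarrier K" "y \<in> hcarrier K" "z \<in> hcarrier K"
  shows "hinner K x (hdiff K y z) = hinner K x y - hinner K x z"
  using assms by (simp add: hdiff_def inner_add_right inner_scale_right scale_closed)

lemma (in hilbert_space_on) norm_hinner_le:
  assumes x: "x \<in> hcarrier K" and y: "y \<in> hcarrier K"
  shows "(cmod (hinner K x y))\<^sup>2 \<le> Re (hinner K x x) * Re (hinner K y y)"
proof (rule complex_quadratic_nonneg_discriminant)
  fix t
  let ?v = "hadd K x (hscale K t y)"
  have c: "hscale K t y \<in> hcarrier K" "?v \<in> hcarrier K"
    using x y by (simp_all add: add_closed scale_closed)
  have left: "hinner K ?v u = hinner K x u + cnj t * hinner K y u" if u: "u \<in> hcarrier K" for u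
    using inner_commute[OF c(2) u] inner_commute[OF u x] inner_commute[OF u y]
    by (simp add: inner_add_right inner_scale_right u x y c)
  have "hinner K y x = cnj (hinner K x y)"
    by (rule inner_commute[OF y x])
  then have "hinner K ?v ?v
      = hinner K x x + (t * hinner K x y + cnj (t * hinner K x y)) + (t * cnj t) * hinner K y y"
    by (simp add: left c x y inner_add_right inner_scale_right algebra_simps)
  also have "\<dots> = hinner K x x + complex_of_real (2 * Re (t * hinner K x y))
      + complex_of_real ((cmod t)\<^sup>2) * hinner K y y"
    by (simp only: complex_add_cnj complex_norm_square)
  finally show "0 \<le> Re (hinner K x x) + 2 * Re (t * hinner K x y) + (cmod t)\<^sup>2 * Re (hinner K y y)"
    using inner_nonneg[OF c(2)] by (simp add: complex_nonneg_Reals_iff)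
qed

lemma orth_proj_range_eq:
  fixes J :: "'h::complex_hilbert \<Rightarrow> 'k"
  assumes K: "hilbert_space_on K" and J: "isometric_embedding K J" and w: "w \<in> hcarrier K"
    and v: "\<And>g. hinner K (J g) w = cinner g v"
  shows "orth_proj K (range J) w = J v"
proof -
  interpret hilbert_space_on K by fact
  have Jc: "J x \<in> hcarrier K" and Ji: "hinner K (J x) (J y) = cinner x y" for x y
    using J by (simp_all add: isometric_embedding_def)
  have *: "hinner K (J g) (hdiff K w (J v')) = cinner g v - cinner g v'" for g v'
    by (simp add: inner_hdiff_right Jc w v Ji)
  show ?thesis
    unfolding orth_proj_def
  proof (rule the_equality)
    show "J v \<in> range J \<and> (\<forall>s\<in>range J. hinner K s (hdiff K w (J v)) = 0)"
      by (auto simp: *)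
  next
    fix y assume "y \<in> range J \<and> (\<forall>s\<in>range J. hinner K s (hdiff K w y) = 0)"
    then obtain v' where y: "y = J v'" and "\<forall>g. hinner K (J g) (hdiff K w (J v')) = 0"
      by auto
    then have "v' = v"
      by (intro cinner_extensionality) (simp add: *)
    then show "y = J v"
      by (simp add: y)
  qed
qed

text \<open>Existence of the projection comes from Riesz on \<open>'h\<close> itself: the vector
  representing \<open>u \<mapsto> hinner K w (J u)\<close> is mapped by \<open>J\<close> to the
  projection of \<open>w\<close>.\<close>

lemma hinner_orth_proj_range:
  fixes J :: "'h::complex_hilbert \<Rightarrow> 'k"
  assumes K: "hilbert_space_on K" and J: "isometric_embedding K J" and w: "w \<in> hcarrier K"
  shows "hinner K (J g) (orth_proj K (range J) w) = hinner K (J g) w"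
proof -
  interpret hilbert_space_on K by fact
  have Jc: "J x \<in> hcarrier K" and Ji: "hinner K (J x) (J y) = cinner x y"
    and Ja: "J (x + y) = hadd K (J x) (J y)" and Js: "J (a *\<^sub>C x) = hscale K a (J x)" for x y a
    using J by (simp_all add: isometric_embedding_def)
  have "\<exists>v. \<forall>u. hinner K w (J u) = cinner v u"
  proof (rule riesz)
    show "hinner K w (J (x + y)) = hinner K w (J x) + hinner K w (J y)" for x y
      by (simp add: Ja inner_add_right Jc w)
    show "hinner K w (J (c *\<^sub>C x)) = c * hinner K w (J x)" for c x
      by (simp add: Js inner_scale_right Jc w)
    show "cmod (hinner K w (J x)) \<le> norm x * sqrt (Re (hinner K w w))" for x
    proof (rule power2_le_imp_le)
      have "Re (hinner K w w) \<ge> 0"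
        using inner_nonneg[OF w] by (simp add: complex_nonneg_Reals_iff)
      then show "(cmod (hinner K w (J x)))\<^sup>2 \<le> (norm x * sqrt (Re (hinner K w w)))\<^sup>2"
        "0 \<le> norm x * sqrt (Re (hinner K w w))"
        using norm_hinner_le[OF w Jc, of x] by (simp_all add: Ji cinner_self power_mult_distrib mult.commute)
    qed
  qed
  then obtain v where v: "\<And>u. hinner K w (J u) = cinner v u"
    by blast
  have v': "hinner K (J g) w = cinner g v" for g
    using v[of g] inner_commute[OF Jc w] cinner_commute by metis
  show ?thesis
    unfolding orth_proj_range_eq[OF K J w v'] by (simp add: Ji v')
qed

lemma unitary_on_funpow:
  assumes "unitary_on K U" "x \<in> hcarrier K"
  shows "(U ^^ n) x \<in> hcarrier K"
  using assms by (induction n) (auto simp: unitary_on_def bij_betw_def)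

lemma hinner_unitary_funpow:
  assumes "unitary_on K U" "x \<in> hcarrier K" "y \<in> hcarrier K"
  shows "hinner K ((U ^^ n) x) ((U ^^ n) y) = hinner K x y"
proof (induction n)
  case (Suc n)
  then show ?case
    using assms unitary_on_funpow[OF assms(1)] by (simp add: unitary_on_def)
qed simp

text \<open>Testing against the vectors \<open>J g\<close> replaces the projection by inner
  products, which can be carried from one space to another.\<close>

lemma C_class_iff:
  fixes A T :: "'h::complex_hilbert \<Rightarrow> 'h"
  shows "C_class TYPE('k) A T \<longleftrightarrow> bounded_op T \<and>
    (\<exists>(K :: ('k + (int \<Rightarrow> 'h)) hilbert_structure) J U.
        hilbert_space_on K \<and> isometric_embedding K J \<and> unitary_on K U \<and>
        (\<forall>n\<ge>1. \<forall>g h. hinner K (J g) ((U ^^ n) (J h)) = cinner g (zeta A T (int n) h)))"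
proof -
  have "(J ((inv_sqrt_op A \<circ> (T ^^ n) \<circ> inv_sqrt_op A) h) = orth_proj K (range J) ((U ^^ n) (J h)))
      \<longleftrightarrow> (\<forall>g. hinner K (J g) ((U ^^ n) (J h)) = cinner g (zeta A T (int n) h))"
    if K: "hilbert_space_on K" "isometric_embedding K J" "unitary_on K U" and n: "n \<ge> 1"
    for K :: "('k + (int \<Rightarrow> 'h)) hilbert_structure" and J U n h
  proof -
    have Jc: "J x \<in> hcarrier K" and Ji: "hinner K (J x) (J y) = cinner x y" for x y
      using K(2) by (simp_all add: isometric_embedding_def)
    have w: "(U ^^ n) (J h) \<in> hcarrier K"
      by (rule unitary_on_funpow[OF K(3) Jc])
    have z: "zeta A T (int n) = inv_sqrt_op A \<circ> (T ^^ n) \<circ> inv_sqrt_op A"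
      using n by (simp add: zeta_def)
    show ?thesis
      unfolding z[symmetric]
      using orth_proj_range_eq[OF K(1,2) w] hinner_orth_proj_range[OF K(1,2) w] Ji by metis
  qed
  then show ?thesis
    unfolding C_class_def by (intro conj_cong refl arg_cong[where f=Ex] ext) blast
qed

text \<open>The Toeplitz sum is the squared norm of the sum of \<open>c k U^k J h\<close> with
  \<open>h = sqrt_op A x\<close>. Its Gram entries come from the dilation for \<open>k > l\<close>,
  from the isometry for \<open>k = l\<close>, and by conjugation for \<open>k < l\<close>.\<close>

lemma C_class_imp_toeplitz:
  fixes A T :: "'h::complex_hilbert \<Rightarrow> 'h"
  assumes A: "positive_op A" "invertible_op A" and C: "C_class TYPE('k) A T"
  shows "(\<Sum>l=0..N. \<Sum>k=0..N. (cnj (c l) * c k) * kern A T (int k - int l) x x) \<in> \<real>\<^sub>\<ge>\<^sub>0"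
proof -
  from C obtain K :: "('k + (int \<Rightarrow> 'h)) hilbert_structure" and J U
    where T: "bounded_op T" and K: "hilbert_space_on K" and J: "isometric_embedding K J"
      and U: "unitary_on K U"
      and dil: "\<And>n g h. n \<ge> 1 \<Longrightarrow> hinner K (J g) ((U ^^ n) (J h)) = cinner g (zeta A T (int n) h)"
    unfolding C_class_iff by blast
  interpret hilbert_space_on K by fact
  define h where "h = sqrt_op A x"
  define e where "e = (\<lambda>k. (U ^^ k) (J h))"
  have e: "e k \<in> hcarrier K" for k
    unfolding e_def using J by (intro unitary_on_funpow[OF U]) (simp add: isometric_embedding_def)
  have kern: "kern A T n x x = cinner h (zeta A T n h)" for n
    by (simp add: cinner_zeta[OF A T] h_def inv_sqrt_op_sqrt_op[OF A])
  have up: "hinner K (e l) (e k) = kern A T (int k - int l) x x" if "l \<le> k" for k l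
  proof -
    have "hinner K (e l) (e k) = hinner K ((U ^^ l) (J h)) ((U ^^ l) ((U ^^ (k - l)) (J h)))"
      using that by (simp add: e_def flip: funpow_add[unfolded o_def fun_eq_iff, rule_format])
    also have "\<dots> = hinner K (J h) (e (k - l))"
      unfolding e_def using J
      by (intro hinner_unitary_funpow[OF U] unitary_on_funpow[OF U]) (simp_all add: isometric_embedding_def)
    also have "\<dots> = cinner h (zeta A T (int (k - l)) h)"
    proof (cases "k = l")
      case True
      then show ?thesis
        using J by (simp add: e_def zeta_def isometric_embedding_def)
    next
      case False
      then show ?thesis
        using that by (simp add: e_def dil)
    qed
    finally show ?thesis
      using that by (simp add: kern of_nat_diff)
  qed
  have gram: "hinner K (e l) (e k) = kern A T (int k - int l) x x" for k l
  proof (cases "l \<le> k")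
    case False
    have "hinner K (e l) (e k) = cnj (hinner K (e k) (e l))"
      by (rule inner_commute[OF e e])
    also have "\<dots> = cnj (kern A T (int l - int k) x x)"
      using False by (simp add: up)
    also have "\<dots> = kern A T (int k - int l) x x"
      using kern_commute[OF A(1), of T "int k - int l" x x] by simp
    finally show ?thesis .
  qed (rule up)
  define S where "S = rec_nat (hscale K (c 0) (e 0)) (\<lambda>n s. hadd K s (hscale K (c (Suc n)) (e (Suc n))))"
  have S: "S n \<in> hcarrier K" for n
    by (induction n) (simp_all add: S_def add_closed scale_closed e)
  have right: "hinner K u (S n) = (\<Sum>k=0..n. c k * hinner K u (e k))" if u: "u \<in> hcarrier K" for u n
  proof (induction n)
    case (Suc n)
    have "S (Suc n) = hadd K (S n) (hscale K (c (Suc n)) (e (Suc n)))"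
      by (simp add: S_def)
    then show ?case
      using Suc by (simp add: inner_add_right inner_scale_right u S scale_closed e)
  qed (simp add: S_def inner_scale_right u e)
  have left: "hinner K (S n) u = (\<Sum>l=0..n. cnj (c l) * hinner K (e l) u)" if u: "u \<in> hcarrier K" for u n
    by (simp add: inner_commute[OF S u] right[OF u] inner_commute[OF u e])
  have "hinner K (S N) (S N) = (\<Sum>l=0..N. \<Sum>k=0..N. (cnj (c l) * c k) * kern A T (int k - int l) x x)"
    by (simp add: left[OF S] right[OF e] gram sum_distrib_left mult.assoc)
  then show ?thesis
    using inner_nonneg[OF S] by metis
qed

text \<open>Only the type of the carrier changes: all structure is pulled back along an injection,
  which places the completion in the type demanded by \<open>C_class\<close>.\<close>

lemma hilbert_transport:
  fixes J :: "'h::complex_hilbert \<Rightarrow> 'a" and \<phi> :: "'a \<Rightarrow> 'b"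
  assumes K: "hilbert_space_on K" and J: "isometric_embedding K J" and U: "unitary_on K U"
    and inj: "inj_on \<phi> (hcarrier K)"
  obtains K' :: "'b hilbert_structure" and J' U' where "hilbert_space_on K'" "isometric_embedding K' J'" "unitary_on K' U'"
    "\<And>n g h. hinner K' (J' g) ((U' ^^ n) (J' h)) = hinner K (J g) ((U ^^ n) (J h))"
proof -
  interpret K: hilbert_space_on K by fact
  define \<psi> where "\<psi> = inv_into (hcarrier K) \<phi>"
  define K' where "K' = \<lparr>hcarrier = \<phi> ` hcarrier K, hzero = \<phi> (hzero K),
    hadd = (\<lambda>x y. \<phi> (hadd K (\<psi> x) (\<psi> y))), hscale = (\<lambda>a x. \<phi> (hscale K a (\<psi> x))),
    hinner = (\<lambda>x y. hinner K (\<psi> x) (\<psi> y))\<rparr>"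
  have K': "hcarrier K' = \<phi> ` hcarrier K" "hzero K' = \<phi> (hzero K)"
    "\<And>x y. hadd K' x y = \<phi> (hadd K (\<psi> x) (\<psi> y))" "\<And>a x. hscale K' a x = \<phi> (hscale K a (\<psi> x))"
    "\<And>x y. hinner K' x y = hinner K (\<psi> x) (\<psi> y)"
    by (simp_all add: K'_def)
  have \<psi>[simp]: "\<psi> (\<phi> x) = x" if "x \<in> hcarrier K" for x
    unfolding \<psi>_def using inj that by (rule inv_into_f_f)
  have hnorm': "hnorm K' (hdiff K' (\<phi> x) (\<phi> y)) = hnorm K (hdiff K x y)"
    if "x \<in> hcarrier K" "y \<in> hcarrier K" for x y
    using that by (simp add: hnorm_def hdiff_def K' K.add_closed K.scale_closed)
  have Uc: "U x \<in> hcarrier K" if "x \<in> hcarrier K" for x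
    using U that by (auto simp: unitary_on_def bij_betw_def)
  have "hilbert_space_on K'"
  proof
    show "hzero K' \<in> hcarrier K'"
      by (simp add: K' K.zero_closed)
  next
    fix x assume x: "x \<in> hcarrier K'"
    then obtain a where a: "a \<in> hcarrier K" "x = \<phi> a"
      by (auto simp: K')
    show "hadd K' x (hzero K') = x"
      by (simp add: K' a K.zero_closed K.add_zero)
    obtain b where "b \<in> hcarrier K" "hadd K a b = hzero K"
      using K.add_inverse[OF a(1)] by blast
    then show "\<exists>y\<in>hcarrier K'. hadd K' x y = hzero K'"
      by (intro bexI[of _ "\<phi> b"]) (simp_all add: K' a)
    show "hscale K' c x \<in> hcarrier K'" "hscale K' 1 x = x"
      "hscale K' (c + d) x = hadd K' (hscale K' c x) (hscale K' d x)"
      "hscale K' c (hscale K' d x) = hscale K' (c * d) x" for c d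
      by (simp_all add: K' a K.scale_closed K.scale_one K.scale_add_left K.scale_scale)
    show "hinner K' x x \<in> \<real>\<^sub>\<ge>\<^sub>0"
      by (simp add: K' a K.inner_nonneg)
    show "hinner K' x x = 0 \<Longrightarrow> x = hzero K'"
      using K.inner_definite[OF a(1)] by (simp add: K' a)
    fix y assume y: "y \<in> hcarrier K'"
    then obtain b where b: "b \<in> hcarrier K" "y = \<phi> b"
      by (auto simp: K')
    show "hadd K' x y \<in> hcarrier K'"
      by (simp add: K' a b K.add_closed)
    show "hadd K' x y = hadd K' y x"
      using K.add_commute[OF a(1) b(1)] by (simp add: K' a b)
    show "hscale K' c (hadd K' x y) = hadd K' (hscale K' c x) (hscale K' c y)" for c
      by (simp add: K' a b K.add_closed K.scale_closed K.scale_add_right)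
    show "hinner K' x y = cnj (hinner K' y x)"
      using K.inner_commute[OF a(1) b(1)] by (simp add: K' a b)
    show "hinner K' x (hscale K' c y) = c * hinner K' x y" for c
      by (simp add: K' a b K.scale_closed K.inner_scale_right)
    fix z assume z: "z \<in> hcarrier K'"
    then obtain c where c: "c \<in> hcarrier K" "z = \<phi> c"
      by (auto simp: K')
    show "hadd K' (hadd K' x y) z = hadd K' x (hadd K' y z)"
      by (simp add: K' a b c K.add_closed K.add_assoc)
    show "hinner K' x (hadd K' y z) = hinner K' x y + hinner K' x z"
      by (simp add: K' a b c K.add_closed K.inner_add_right)
  next
    fix X :: "nat \<Rightarrow> 'b"
    assume X: "\<And>n. X n \<in> hcarrier K'"
      and cauchy: "\<And>e. e > 0 \<Longrightarrow> \<exists>M. \<forall>m\<ge>M. \<forall>n\<ge>M. hnorm K' (hdiff K' (X m) (X n)) < e"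
    have "\<exists>y. y \<in> hcarrier K \<and> X n = \<phi> y" for n
      using X[of n] by (auto simp: K')
    then obtain Y where Y: "\<And>n. Y n \<in> hcarrier K" "\<And>n. X n = \<phi> (Y n)"
      by metis
    have "\<exists>M. \<forall>m\<ge>M. \<forall>n\<ge>M. hnorm K (hdiff K (Y m) (Y n)) < e" if "e > 0" for e
      using cauchy[OF that] by (simp add: Y hnorm')
    from K.complete[OF Y(1) this]
    obtain y where "y \<in> hcarrier K" "(\<lambda>n. hnorm K (hdiff K (Y n) y)) \<longlonglongrightarrow> 0"
      by blast
    then show "\<exists>x\<in>hcarrier K'. (\<lambda>n. hnorm K' (hdiff K' (X n) x)) \<longlonglongrightarrow> 0"
      by (auto simp: K'(1) Y hnorm')
  qed
  moreover have "isometric_embedding K' (\<phi> \<circ> J)"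
    using J by (simp add: isometric_embedding_def K')
  moreover have "unitary_on K' (\<phi> \<circ> U \<circ> \<psi>)"
  proof -
    have "bij_betw \<phi> (hcarrier K) (hcarrier K')"
      using inj by (simp add: bij_betw_def K')
    moreover from this have "bij_betw \<psi> (hcarrier K') (hcarrier K)"
      unfolding \<psi>_def by (rule bij_betw_inv_into)
    ultimately have "bij_betw (\<phi> \<circ> U \<circ> \<psi>) (hcarrier K') (hcarrier K')"
      using U unfolding unitary_on_def by (metis bij_betw_trans comp_assoc)
    then show ?thesis
      using U Uc by (auto simp: unitary_on_def K' K.add_closed K.scale_closed)
  qed
  moreover have "hinner K' ((\<phi> \<circ> J) g) (((\<phi> \<circ> U \<circ> \<psi>) ^^ n) ((\<phi> \<circ> J) h)) = hinner K (J g) ((U ^^ n) (J h))" for n g h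
  proof -
    have Jc: "J x \<in> hcarrier K" for x
      using J by (simp add: isometric_embedding_def)
    have "((\<phi> \<circ> U \<circ> \<psi>) ^^ n) (\<phi> (J h)) = \<phi> ((U ^^ n) (J h))"
      by (induction n) (simp_all add: Jc unitary_on_funpow[OF U])
    then show ?thesis
      by (simp add: K' Jc unitary_on_funpow[OF U])
  qed
  ultimately show ?thesis
    by (rule that)
qed

text \<open>A list of pairs \<open>(n, h)\<close> stands for the formal sum of the vectors \<open>U\<^sup>n h\<close>; its Gram matrix
  is prescribed by \<open>zeta\<close>, and \<open>U\<close> acts by shifting the exponents.\<close>

definition zeta_form :: "('h::complex_hilbert \<Rightarrow> 'h) \<Rightarrow> ('h \<Rightarrow> 'h) \<Rightarrow> (int \<times> 'h) list \<Rightarrow> (int \<times> 'h) list \<Rightarrow> complex" where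
  "zeta_form A T xs ys = (\<Sum>p\<leftarrow>xs. \<Sum>q\<leftarrow>ys. cinner (snd p) (zeta A T (fst q - fst p) (snd q)))"

lemma zeta_form_semi_inner_product:
  fixes A T :: "'h::complex_hilbert \<Rightarrow> 'h"
  assumes A: "positive_op A" "invertible_op A" and T: "bounded_op T" and pos: "resolvent_positive A T"
  shows "semi_inner_product (@) (\<lambda>a. map (\<lambda>(n, h). (n, a *\<^sub>C h))) (zeta_form A T)"
proof
  fix xs ys zs :: "(int \<times> 'h) list" and a :: complex
  note bz = bounded_zeta[OF A T]
  have sums: "(\<Sum>p\<leftarrow>xs. \<Sum>q\<leftarrow>ys. f p q)
      = (\<Sum>i<length xs. \<Sum>j<length ys. f (xs ! i) (ys ! j))" for f :: "_ \<Rightarrow> _ \<Rightarrow> complex"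
      and xs ys :: "(int \<times> 'h) list"
    by (simp add: sum_list_sum_nth atLeast0LessThan)
  have herm: "cinner x (zeta A T n y) = cnj (cinner y (zeta A T (- n) x))" for x y n
    unfolding cinner_zeta[OF A T] by (rule kern_commute[OF A(1)])
  show "zeta_form A T xs ys = cnj (zeta_form A T ys xs)"
    unfolding zeta_form_def sums cnj_sum
    by (subst sum.swap, intro sum.cong refl, subst herm) simp
  show "zeta_form A T xs (ys @ zs) = zeta_form A T xs ys + zeta_form A T xs zs"
    by (simp add: zeta_form_def sum_list_addf)
  show "zeta_form A T xs (map (\<lambda>(n, h). (n, a *\<^sub>C h)) ys) = a * zeta_form A T xs ys"
    by (simp add: zeta_form_def o_def case_prod_beta bounded_op_scaleC[OF bz] cinner_scaleC_right
        sum_list_const_mult)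
  \<comment> \<open>The index set consists of the positions in the list, so exponents may
    repeat.\<close>
  show "zeta_form A T xs xs \<in> \<real>\<^sub>\<ge>\<^sub>0"
    unfolding zeta_form_def sums cinner_zeta[OF A T]
    by (rule resolvent_positive_imp_sum_kern[OF A(1) T pos]) simp
qed

lemma resolvent_positive_imp_C_class:
  fixes A T :: "'h::complex_hilbert \<Rightarrow> 'h"
  assumes A: "positive_op A" "invertible_op A" and T: "bounded_op T" and pos: "resolvent_positive A T"
  shows "C_class TYPE('k) A T"
proof -
  note bz = bounded_zeta[OF A T]
  define scale where "scale = (\<lambda>a. map (\<lambda>(n::int, h::'h). (n, a *\<^sub>C h)))"
  interpret semi_inner_product "(@)" scale "zeta_form A T"
    unfolding scale_def by (rule zeta_form_semi_inner_product[OF A T pos])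
  define shift where "shift = (\<lambda>m. map (\<lambda>(n::int, h::'h). (n + m, h)))"
  define J where "J = (\<lambda>h u. zeta_form A T u [(0, h)])"
  define U where "U = (\<lambda>(f :: (int \<times> 'h) list \<Rightarrow> complex) u. f (shift (- 1) u))"
  have shift_inv: "shift 1 (shift (- 1) u) = u" "shift (- 1) (shift 1 u) = u" for u
    by (simp_all add: shift_def o_def case_prod_beta)
  have shift_form: "zeta_form A T (shift m u) (shift m v) = zeta_form A T u v" for m u v
    by (simp add: shift_def zeta_form_def o_def case_prod_beta)
  have U: "unitary_on completion U"
    unfolding U_def by (rule unitary_completion[OF shift_inv shift_form])
  have J: "isometric_embedding completion J"
    unfolding isometric_embedding_def
  proof (intro conjI allI)
    show "J x \<in> hcarrier completion" for x
      unfolding J_def by (rule embed_in_completion)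
    show "J (x + y) = hadd completion (J x) (J y)" for x y
      by (simp add: J_def completion_def zeta_form_def bounded_op_add[OF bz] cinner_add_right sum_list_addf)
    show "J (a *\<^sub>C x) = hscale completion a (J x)" for a x
      by (simp add: J_def completion_def zeta_form_def bounded_op_scaleC[OF bz] cinner_scaleC_right
          sum_list_const_mult)
    show "hinner completion (J x) (J y) = cinner x y" for x y
      unfolding J_def completion_inner_embed by (simp add: zeta_form_def zeta_def)
  qed
  have "(U ^^ n) (J h) = (\<lambda>u. zeta_form A T u [(int n, h)])" for n h
  proof (induction n)
    case (Suc n)
    have "zeta_form A T (shift (- 1) u) [(int n, h)] = zeta_form A T u [(int (Suc n), h)]" for u
      using shift_form[of 1 "shift (- 1) u" "[(int n, h)]"] unfolding shift_inv
      by (simp add: shift_def add.commute)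
    then show ?case
      using Suc by (simp add: U_def)
  qed (simp add: J_def)
  then have dil: "hinner completion (J g) ((U ^^ n) (J h)) = cinner g (zeta A T (int n) h)" for n g h
    unfolding J_def by (simp add: completion_inner_embed) (simp add: zeta_form_def)
  \<comment> \<open>A functional is determined by its values on one-element lists, hence by the vectors that
    represent the functionals \<open>g \<mapsto> f [(n, g)]\<close>.\<close>
  define rep where "rep = (\<lambda>(f :: (int \<times> 'h) list \<Rightarrow> complex) n. SOME w. \<forall>g. cnj (f [(n, g)]) = cinner w g)"
  define \<phi> where "\<phi> = (\<lambda>f. Inr (rep f) :: 'k + (int \<Rightarrow> 'h))"
  have "inj_on \<phi> (hcarrier completion)"
  proof (rule inj_onI)
    fix f1 f2 assume f: "f1 \<in> hcarrier completion" "f2 \<in> hcarrier completion" "\<phi> f1 = \<phi> f2"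
    \<comment> \<open>Conjugation makes the antilinear functional linear, as \<open>riesz\<close>
      requires; the semi-norm of a one-element list is the norm of its vector because
      \<open>zeta\<close> is the identity at 0.\<close>
    have rep: "cnj (f [(n, g)]) = cinner (rep f n) g"
      if f: "f \<in> hcarrier completion" for f n g
    proof -
      obtain C where C: "\<And>u. cmod (f u) \<le> snorm u * C"
        using completion_bounded[OF f] by blast
      have "\<exists>w. \<forall>g. cnj (f [(n, g)]) = cinner w g"
      proof (rule riesz)
        show "cnj (f [(n, x + y)]) = cnj (f [(n, x)]) + cnj (f [(n, y)])" for x y
          using completion_additive(1)[OF f, of "[(n, x + y)]" "[(n, x)]" "[(n, y)]"]
          by (simp add: zeta_form_def cinner_add_left sum_list_addf)
        show "cnj (f [(n, a *\<^sub>C x)]) = a * cnj (f [(n, x)])" for a x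
          using completion_additive(2)[OF f, of "[(n, a *\<^sub>C x)]" a "[(n, x)]"]
          by (simp add: zeta_form_def cinner_scaleC_left sum_list_const_mult)
        show "cmod (cnj (f [(n, x)])) \<le> norm x * C" for x
          using C[of "[(n, x)]"] by (simp add: snorm_def zeta_form_def zeta_def cinner_self)
      qed
      then show ?thesis
        unfolding rep_def by (rule someI2_ex) blast
    qed
    have single: "f1 [p] = f2 [p]" for p
    proof -
      have "cnj (f1 [(n, g)]) = cnj (f2 [(n, g)])" for n g
        using f(3) by (simp only: rep[OF f(1)] rep[OF f(2)] \<phi>_def sum.inject)
      then show ?thesis
        by (cases p) simp
    qed
    show "f1 = f2"
    proof
      show "f1 u = f2 u" for u
      \<comment> \<open>The list \<open>p # u\<close> is the formal sum of \<open>[p]\<close> and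
        \<open>u\<close>; for the empty list, additivity gives \<open>f [] = f [] + f []\<close>,
        hence 0.\<close>
      proof (induction u)
        case Nil
        show ?case
          using completion_additive(1)[OF f(1), of "[]" "[]" "[]"]
            completion_additive(1)[OF f(2), of "[]" "[]" "[]"] by (simp add: zeta_form_def)
      next
        case (Cons p u)
        show ?case
          using completion_additive(1)[OF f(1), of "p # u" "[p]" u]
            completion_additive(1)[OF f(2), of "p # u" "[p]" u] Cons single
          by (simp add: zeta_form_def)
      qed
    qed
  qed
  then obtain K :: "('k + (int \<Rightarrow> 'h)) hilbert_structure" and J' U'
    where "hilbert_space_on K" "isometric_embedding K J'" "unitary_on K U'"
      "\<And>n g h. hinner K (J' g) ((U' ^^ n) (J' h)) = hinner completion (J g) ((U ^^ n) (J h))"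
    using hilbert_transport[OF hilbert_space_completion J U] by blast
  then show ?thesis
    unfolding C_class_iff dil using T by blast
qed

theorem theorem4p2:
  fixes A T :: "'h::complex_hilbert \<Rightarrow> 'h"
  assumes "positive_op A" and "invertible_op A" and "bounded_op T"
  defines "cond_i \<equiv> C_class TYPE('k) A T"
    and "cond_ii \<equiv> (\<forall>(N::nat) (c :: nat \<Rightarrow> complex). positive_op (\<lambda>h. \<Sum>l=0..N. \<Sum>k=0..N.
           (cnj (c l) * c k) *\<^sub>C zeta A T (int k - int l) h))"
    and "cond_iii \<equiv> (\<forall>z::complex. cmod z < 1 \<longrightarrow>
           invertible_op (id_minus z T) \<and>
           positive_op (\<lambda>h. inv (id_minus z T) h
             + inv (id_minus (cnj z) (adjoint_op T)) h + A h - 2 *\<^sub>C h))"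
    and "cond_iv \<equiv> (\<forall>(z::complex) (h::'h). cmod z < 1 \<longrightarrow>
           cinner (id_minus z T h) (A (id_minus z T h) - 2 *\<^sub>C id_minus z T h)
             + 2 * complex_of_real (Re (cinner h (id_minus z T h))) \<in> \<real>\<^sub>\<ge>\<^sub>0)"
  shows "(cond_i \<longleftrightarrow> cond_ii) \<and> (cond_ii \<longleftrightarrow> cond_iii) \<and> (cond_iii \<longleftrightarrow> cond_iv)"
proof -
  note A = assms(1,2) and T = assms(3)
  have iii: "cond_iii \<longleftrightarrow> resolvent_positive A T"
    unfolding cond_iii_def by (rule resolvent_positive_iff_inverse[OF A(1) T, symmetric])
  have iv: "cond_iv \<longleftrightarrow> resolvent_positive A T"
    unfolding cond_iv_def by (rule resolvent_positive_iff[OF A(1), symmetric])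
  have ii: "cond_ii \<longleftrightarrow> (\<forall>(N::nat) c x. (\<Sum>l=0..N. \<Sum>k=0..N.
      (cnj (c l) * c k) * kern A T (int k - int l) x x) \<in> \<real>\<^sub>\<ge>\<^sub>0)"
    unfolding cond_ii_def positive_toeplitz_sums_iff[OF A T] ..
  have "cond_i \<Longrightarrow> cond_ii"
    unfolding cond_i_def ii using C_class_imp_toeplitz[OF A] by blast
  moreover have "cond_ii \<Longrightarrow> resolvent_positive A T"
    unfolding ii by (rule toeplitz_imp_resolvent_positive[OF A(1) T]) blast
  moreover have "resolvent_positive A T \<Longrightarrow> cond_i"
    unfolding cond_i_def by (rule resolvent_positive_imp_C_class[OF A T])
  ultimately show ?thesis
    using iii iv by blast
qed

end
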